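(* Let $H$ be the Hilbert transformation over $L^2(\mathbb{R}^3,\mathrm{Cl}_3)$. Then $H$ has two nontrivial maximal invariant subspaces $H^+$ and $H^-$ such that $$L^2(\mathbb{R}^3,\mathrm{Cl}_3)=H^+\oplus H^-,$$ and $$Hf=f\quad\forall f\in H^+;\qquad Hg=-g\quad\forall g\in H^-.$$
   Context: $\mathrm{Cl}_3$ is the Clifford algebra with generators $e_1,e_2,e_3$, $e_j^2=-1$, $e_je_k=-e_ke_j$ for $j\ne k$; function values lie in its complexification, with $i$ commuting with the $e_j$. $x\in\mathbb{R}^3$ is identified with $\underline{x}=x_1e_1+x_2e_2+x_3e_3$. The Hilbert transformation is $Hf(\underline{x})=c_3\,\mathrm{p.v.}\!\int_{\mathbb{R}^3}\frac{\underline{x}-\underline{y}}{|\underline{x}-\underline{y}|^{4}}f(\underline{y})\,d\underline{y}$, with $c_3=1/\pi^2$, so that $H^2=I$. $\mathrm{Spin}(3)=\{\underline{u}\,\underline{v}:\underline{u},\underline{v}\in\mathbb{R}^3,\ |\underline{u}|=|\underline{v}|=1\}\subset\mathrm{Cl}_3$, and $\gamma:S^2\to\mathrm{Spin}(3)$ is a fixed choice with $\gamma(\omega)e_3\gamma(\omega)^{-1}=\omega$. Write $L(w)=\{g(\underline{y})=\gamma(\underline{y}/|\underline{y}|)\beta(\underline{y})w:\beta\in L^2(\mathbb{R}^3)\}$ ($\beta$ complex-valued) and $p=1-e_3e_1e_2$. Set $H'^-_1=L(p(1-ie_1e_2))$, $H'^+_1=L(p(e_1+ie_2))$; $H'^-_2=L(p(e_1-ie_2))$,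 $H'^+_2=L(p(1+ie_1e_2))$; $H'^-_3=L(p(1-ie_1e_2)e_3)$, $H'^+_3=L(p(e_1+ie_2)e_3)$; $H'^-_4=L(p(e_1-ie_2)e_3)$, $H'^+_4=L(p(1+ie_1e_2)e_3)$. With $\mathfrak{F}f(\underline{\xi})=\int_{\mathbb{R}^3}e^{-i2\pi\langle\underline{x},\underline{\xi}\rangle}f(\underline{x})\,d\underline{x}$ (extended to $L^2$), put $H_j^\pm=\mathfrak{F}H'^\pm_j$ and $H^\pm=\bigoplus_{j=1}^4H_j^\pm$.
   Formalization: The sums of the H_j^± take values in the ideal p·Cl_3 and are not direct, so they cannot be H^±; here H^± are the ±1 eigenspaces, whose p·Cl_3-valued parts equal those sums. Maximal means among invariant subspaces where H = ±1. γ is taken measurable. *)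

theory Defs
  imports "HOL-Analysis.Analysis"
begin

section \<open>The complexified Clifford algebra\<close>

text \<open>
  The component of a multivector at index \<open>(a, b, c)\<close> is its coefficient at the basis element
  \<open>e1^a e2^b e3^c\<close>. The Clifford product is written \<open>\<odot>\<close>: the product \<open>*\<close> and the unit \<open>1\<close> that
  the library provides on this type are componentwise and play no role here. Multiplication
  by a complex number is the library's \<open>*s\<close>.
\<close>

type_synonym blade = "bool \<times> bool \<times> bool"
type_synonym cl3 = "complex ^ blade"

text \<open>
  The sign of \<open>e1^a e2^b e3^c \<cdot> e1^a' e2^b' e3^c'\<close>: the exponent counts the anticommutations
  needed to sort the factors and the squares \<open>ej^2 = -1\<close>.
\<close>

definition blade_sign :: "blade \<Rightarrow> blade \<Rightarrow> complex" where
  "blade_sign = (\<lambda>(a, b, c) (a', b', c').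
     (-1) ^ (of_bool (b \<and> a') + of_bool (c \<and> a') + of_bool (c \<and> b')
           + of_bool (a \<and> a') + of_bool (b \<and> b') + of_bool (c \<and> c')))"

definition blade_diff :: "blade \<Rightarrow> blade \<Rightarrow> blade" where
  "blade_diff = (\<lambda>(a, b, c) (a', b', c'). (a \<noteq> a', b \<noteq> b', c \<noteq> c'))"

definition cl_mult :: "cl3 \<Rightarrow> cl3 \<Rightarrow> cl3" (infixl "\<odot>" 70) where
  "x \<odot> y = (\<chi> C. \<Sum>A\<in>UNIV. blade_sign A (blade_diff A C) * x $ A * y $ blade_diff A C)"

definition cl_one :: cl3 where "cl_one = axis (False, False, False) 1"
definition e1 :: cl3 where "e1 = axis (True, False, False) 1"
definition e2 :: cl3 where "e2 = axis (False, True, False) 1"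
definition e3 :: cl3 where "e3 = axis (False, False, True) 1"

definition cl_inv :: "cl3 \<Rightarrow> cl3" where
  "cl_inv a = (THE b. a \<odot> b = cl_one \<and> b \<odot> a = cl_one)"

definition cl_vec :: "real ^ 3 \<Rightarrow> cl3" where
  "cl_vec x = x $ 1 *\<^sub>R e1 + x $ 2 *\<^sub>R e2 + x $ 3 *\<^sub>R e3"

definition Spin3 :: "cl3 set" where
  "Spin3 = {cl_vec u \<odot> cl_vec v | u v. norm u = 1 \<and> norm v = 1}"

lemma blade_diff_diff: "blade_diff A (blade_diff A B) = B"
    "blade_diff (blade_diff A B) (blade_diff A C) = blade_diff B C"
  by (cases A; cases B; simp add: blade_diff_def; blast)
     (cases A; cases B; cases C; simp add: blade_diff_def; blast)

lemma blade_diff_eq_iff: "blade_diff A B = C \<longleftrightarrow> B = blade_diff A C"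
  by (metis blade_diff_diff(1))

lemma power_of_bool_diff:
  "(-1 :: complex) ^ of_bool ((p \<noteq> q) \<and> r) = (-1) ^ of_bool (p \<and> r) * (-1) ^ of_bool (q \<and> r)"
  "(-1 :: complex) ^ of_bool (r \<and> (p \<noteq> q)) = (-1) ^ of_bool (r \<and> p) * (-1) ^ of_bool (r \<and> q)"
  by (cases p; cases q; cases r; simp)+

lemma blade_sign_diff:
  "blade_sign (blade_diff A B) C = blade_sign A C * blade_sign B C"
  "blade_sign C (blade_diff A B) = blade_sign C A * blade_sign C B"
  by (cases A; cases B; cases C;
      simp only: blade_sign_def blade_diff_def prod.case power_add power_of_bool_diff mult_ac)+

lemma blade_sign_square: "blade_sign A B * (blade_sign A B * z) = z"
proof -
  have "blade_sign A B = 1 \<or> blade_sign A B = -1"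
    by (cases A; cases B) (simp only: blade_sign_def prod.case
        minus_one_power_iff split: if_split, simp)
  then show ?thesis by auto
qed

lemma cl_mult_nth:
  "(x \<odot> y) $ C = (\<Sum>A\<in>UNIV. blade_sign A (blade_diff A C) * x $ A * y $ blade_diff A C)"
  by (simp add: cl_mult_def)

lemma cl_assoc: "x \<odot> y \<odot> z = x \<odot> (y \<odot> z)"
proof -
  have "(x \<odot> y \<odot> z) $ C = (x \<odot> (y \<odot> z)) $ C" for C
  proof -
    have "(x \<odot> y \<odot> z) $ C = (\<Sum>B\<in>UNIV. \<Sum>A\<in>UNIV. blade_sign B (blade_diff B C) *
        blade_sign A (blade_diff A B) * (x $ A * y $ blade_diff A B * z $ blade_diff B C))"
      by (simp add: cl_mult_nth sum_distrib_left sum_distrib_right mult_ac)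
    also have "\<dots> = (\<Sum>A\<in>UNIV. \<Sum>B\<in>UNIV. blade_sign A (blade_diff A C) *
        blade_sign (blade_diff A B) (blade_diff B C) *
        (x $ A * y $ blade_diff A B * z $ blade_diff B C))"
      by (subst sum.swap) (simp add: blade_sign_diff blade_sign_square mult_ac)
    also have "\<dots> = (\<Sum>A\<in>UNIV. \<Sum>D\<in>UNIV. blade_sign A (blade_diff A C) *
        blade_sign D (blade_diff D (blade_diff A C)) *
        (x $ A * y $ D * z $ blade_diff D (blade_diff A C)))"
    proof (rule sum.cong[OF refl])
      fix A
      show "(\<Sum>B\<in>UNIV. blade_sign A (blade_diff A C) *
          blade_sign (blade_diff A B) (blade_diff B C) *
          (x $ A * y $ blade_diff A B * z $ blade_diff B C)) =
        (\<Sum>D\<in>UNIV. blade_sign A (blade_diff A C) *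
          blade_sign D (blade_diff D (blade_diff A C)) *
          (x $ A * y $ D * z $ blade_diff D (blade_diff A C)))"
        by (rule sum.reindex_bij_witness[of _ "blade_diff A" "blade_diff A"])
          (simp_all add: blade_diff_diff)
    qed
    also have "\<dots> = (x \<odot> (y \<odot> z)) $ C"
      by (simp add: cl_mult_nth sum_distrib_left mult_ac)
    finally show ?thesis .
  qed
  then show ?thesis by (simp add: vec_eq_iff)
qed

lemma cl_bilinear:
  "(x + y) \<odot> z = x \<odot> z + y \<odot> z" "z \<odot> (x + y) = z \<odot> x + z \<odot> y"
  "(x - y) \<odot> z = x \<odot> z - y \<odot> z" "z \<odot> (x - y) = z \<odot> x - z \<odot> y"
  "(- x) \<odot> z = - (x \<odot> z)" "z \<odot> (- x) = - (z \<odot> x)"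
  "(c *s x) \<odot> z = c *s (x \<odot> z)" "z \<odot> (c *s x) = c *s (z \<odot> x)"
  "0 \<odot> z = 0" "z \<odot> 0 = 0"
  by (simp_all add: vec_eq_iff cl_mult_nth sum.distrib sum_subtractf sum_negf sum_distrib_left
      algebra_simps)

lemma axis_mult: "axis A 1 \<odot> x = (\<chi> C. blade_sign A (blade_diff A C) * x $ blade_diff A C)"
  by (simp add: vec_eq_iff cl_mult_nth axis_def if_distrib if_distribR cong: if_cong)

lemma axis_mult_axis: "axis A 1 \<odot> axis B 1 = blade_sign A B *s axis (blade_diff A B) 1"
  unfolding axis_mult by (auto simp: vec_eq_iff axis_def blade_diff_eq_iff blade_diff_diff)

lemma cl_one_left: "cl_one \<odot> x = x"
  by (simp add: cl_one_def axis_mult vec_eq_iff blade_sign_def blade_diff_def)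

lemma cl_squares: "e1 \<odot> e1 = - cl_one" "e2 \<odot> e2 = - cl_one" "e3 \<odot> e3 = - cl_one"
  by (simp_all add: e1_def e2_def e3_def cl_one_def axis_mult_axis blade_sign_def blade_diff_def)

lemma cl_anticommute:
  "e2 \<odot> e1 = - (e1 \<odot> e2)" "e3 \<odot> e1 = - (e1 \<odot> e3)" "e3 \<odot> e2 = - (e2 \<odot> e3)"
  by (simp_all add: e1_def e2_def e3_def axis_mult_axis blade_sign_def blade_diff_def)

lemma cl_one_right: "x \<odot> cl_one = x"
proof -
  have diff: "(False, False, False) = blade_diff A C \<longleftrightarrow> A = C" for A C
    by (cases A; cases C) (simp add: blade_diff_def)
  have sgn: "blade_sign A (False, False, False) = 1" for A
    by (cases A) (simp add: blade_sign_def)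
  have "(x \<odot> cl_one) $ C = (\<Sum>A\<in>UNIV. if A = C then x $ A else 0)" for C
    unfolding cl_mult_nth
  proof (rule sum.cong[OF refl])
    fix A
    show "blade_sign A (blade_diff A C) * x $ A * cl_one $ blade_diff A C =
        (if A = C then x $ A else 0)"
      using diff[of A C] sgn[of A] by (auto simp: cl_one_def axis_def)
  qed
  then show ?thesis by (simp add: vec_eq_iff)
qed

lemma cl_squares': "e1 \<odot> (e1 \<odot> x) = - x" "e2 \<odot> (e2 \<odot> x) = - x" "e3 \<odot> (e3 \<odot> x) = - x"
  by (simp_all add: cl_squares cl_bilinear cl_one_left flip: cl_assoc)

lemma cl_anticommute':
  "e2 \<odot> (e1 \<odot> x) = - (e1 \<odot> (e2 \<odot> x))" "e3 \<odot> (e1 \<odot> x) = - (e1 \<odot> (e3 \<odot> x))"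
  "e3 \<odot> (e2 \<odot> x) = - (e2 \<odot> (e3 \<odot> x))"
  by (simp_all add: cl_anticommute cl_bilinear flip: cl_assoc)

lemmas cl_simps = cl_assoc cl_bilinear cl_one_left cl_one_right cl_squares cl_squares'
  cl_anticommute cl_anticommute'


section \<open>Square-integrable functions on \<open>\<real>^3\<close>\<close>

text \<open>
  Elements of \<open>L^2\<close> are represented by functions, not by classes modulo null sets; a set of
  functions that is closed under \<open>L2_lim\<close> below is saturated under equality almost everywhere.
\<close>

definition L2 :: "(real ^ 3 \<Rightarrow> 'b::real_normed_vector) set" where
  "L2 = {f \<in> borel_measurable lborel. integrable lborel (\<lambda>x. (norm (f x))\<^sup>2)}"

definition L2_lim :: "('i \<Rightarrow> real ^ 3 \<Rightarrow> cl3) \<Rightarrow> 'i filter \<Rightarrow> (real ^ 3 \<Rightarrow> cl3) \<Rightarrow> bool" where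
  "L2_lim F \<phi> g \<longleftrightarrow> (\<forall>\<^sub>F t in \<phi>. F t \<in> L2) \<and> g \<in> L2 \<and>
     ((\<lambda>t. LINT x|lborel. (norm (F t x - g x))\<^sup>2) \<longlongrightarrow> 0) \<phi>"

definition L2_subspace :: "(real ^ 3 \<Rightarrow> cl3) set \<Rightarrow> bool" where
  "L2_subspace V \<longleftrightarrow> V \<subseteq> L2 \<and> (\<lambda>x. 0) \<in> V \<and>
     (\<forall>f\<in>V. \<forall>g\<in>V. (\<lambda>x. f x + g x) \<in> V) \<and>
     (\<forall>c. \<forall>f\<in>V. (\<lambda>x. c *s f x) \<in> V) \<and>
     (\<forall>F g. (\<forall>n. F n \<in> V) \<and> L2_lim F sequentially g \<longrightarrow> g \<in> V)"

definition nontrivial_subspace :: "(real ^ 3 \<Rightarrow> cl3) set \<Rightarrow> bool" where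
  "nontrivial_subspace V \<longleftrightarrow> (\<exists>f\<in>V. \<not> (AE x in lborel. f x = 0)) \<and> V \<noteq> L2"

definition L2_direct_sum :: "(real ^ 3 \<Rightarrow> cl3) set \<Rightarrow> (real ^ 3 \<Rightarrow> cl3) set \<Rightarrow> bool" where
  "L2_direct_sum V W \<longleftrightarrow> L2 = {\<lambda>x. f x + g x | f g. f \<in> V \<and> g \<in> W} \<and>
     (\<forall>f \<in> V \<inter> W. AE x in lborel. f x = 0)"


section \<open>The Hilbert transformation\<close>

definition hilbert_trunc :: "real \<Rightarrow> (real ^ 3 \<Rightarrow> cl3) \<Rightarrow> real ^ 3 \<Rightarrow> cl3" where
  "hilbert_trunc \<epsilon> f x = (1 / pi\<^sup>2) *\<^sub>R
     (LINT y:{y. \<epsilon> < norm (x - y)}|lborel. (1 / norm (x - y) ^ 4) *\<^sub>R (cl_vec (x - y) \<odot> f y))"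

text \<open>
  \<open>has_hilbert f g\<close> says \<open>H f = g\<close> in \<open>L^2\<close>; the principal value is the limit of the truncated
  integrals in the norm of \<open>L^2\<close>.
\<close>

definition has_hilbert :: "(real ^ 3 \<Rightarrow> cl3) \<Rightarrow> (real ^ 3 \<Rightarrow> cl3) \<Rightarrow> bool" where
  "has_hilbert f g \<longleftrightarrow> f \<in> L2 \<and> L2_lim (\<lambda>\<epsilon>. hilbert_trunc \<epsilon> f) (at_right 0) g"

definition invariant_subspace :: "(real ^ 3 \<Rightarrow> cl3) set \<Rightarrow> bool" where
  "invariant_subspace V \<longleftrightarrow> L2_subspace V \<and> (\<forall>f\<in>V. \<exists>g\<in>V. has_hilbert f g)"

text \<open>
  Maximality is among the invariant subspaces on which \<open>H\<close> acts as the scalar \<open>s\<close>. It cannot be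
  maximality among all proper invariant subspaces: since \<open>H\<close> is \<open>-1\<close> on \<open>H-\<close>, the subspace
  \<open>H+\<close> together with one nonzero element of \<open>H-\<close> spans a larger proper invariant subspace.
\<close>

definition maximal_invariant_subspace :: "complex \<Rightarrow> (real ^ 3 \<Rightarrow> cl3) set \<Rightarrow> bool" where
  "maximal_invariant_subspace s V \<longleftrightarrow> invariant_subspace V \<and>
     (\<forall>f\<in>V. has_hilbert f (\<lambda>x. s *s f x)) \<and>
     (\<forall>W. invariant_subspace W \<and> (\<forall>f\<in>W. has_hilbert f (\<lambda>x. s *s f x)) \<and> V \<subseteq> W \<longrightarrow> W = V)"


section \<open>The spaces built from a choice of spinors\<close>

text \<open>
  Measurability of the choice is what makes \<open>\<gamma> (y / |y|) \<beta> y w\<close> an element of \<open>L^2\<close> for every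
  complex-valued \<open>\<beta>\<close> in \<open>L^2\<close>.
\<close>

definition spinor_choice :: "(real ^ 3 \<Rightarrow> cl3) \<Rightarrow> bool" where
  "spinor_choice \<gamma> \<longleftrightarrow> \<gamma> \<in> borel_measurable (restrict_space borel (sphere 0 1)) \<and>
     (\<forall>\<omega>\<in>sphere 0 1. \<gamma> \<omega> \<in> Spin3 \<and> \<gamma> \<omega> \<odot> e3 \<odot> cl_inv (\<gamma> \<omega>) = cl_vec \<omega>)"

definition spinor_space :: "(real ^ 3 \<Rightarrow> cl3) \<Rightarrow> cl3 \<Rightarrow> (real ^ 3 \<Rightarrow> cl3) set" where
  "spinor_space \<gamma> w = {g \<in> L2. \<exists>\<beta> :: real ^ 3 \<Rightarrow> complex. \<beta> \<in> L2 \<and>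
     (AE y in lborel. g y = \<beta> y *s (\<gamma> (y /\<^sub>R norm y) \<odot> w))}"

definition cl_p :: cl3 where "cl_p = cl_one - e3 \<odot> e1 \<odot> e2"

definition w_minus :: "nat \<Rightarrow> cl3" where
  "w_minus j =
    (if j = 1 then cl_p \<odot> (cl_one - \<i> *s (e1 \<odot> e2))
     else if j = 2 then cl_p \<odot> (e1 - \<i> *s e2)
     else if j = 3 then cl_p \<odot> (cl_one - \<i> *s (e1 \<odot> e2)) \<odot> e3
     else cl_p \<odot> (e1 - \<i> *s e2) \<odot> e3)"

definition w_plus :: "nat \<Rightarrow> cl3" where
  "w_plus j =
    (if j = 1 then cl_p \<odot> (e1 + \<i> *s e2)
     else if j = 2 then cl_p \<odot> (cl_one + \<i> *s (e1 \<odot> e2))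
     else if j = 3 then cl_p \<odot> (e1 + \<i> *s e2) \<odot> e3
     else cl_p \<odot> (cl_one + \<i> *s (e1 \<odot> e2)) \<odot> e3)"

text \<open>The Fourier transform on \<open>L^2\<close>, as the limit over integrals on growing balls.\<close>

definition fourier_trunc :: "real \<Rightarrow> (real ^ 3 \<Rightarrow> cl3) \<Rightarrow> real ^ 3 \<Rightarrow> cl3" where
  "fourier_trunc R f \<xi> = (LINT x:cball 0 R|lborel. exp (- \<i> * 2 * pi * (x \<bullet> \<xi>)) *s f x)"

definition has_fourier :: "(real ^ 3 \<Rightarrow> cl3) \<Rightarrow> (real ^ 3 \<Rightarrow> cl3) \<Rightarrow> bool" where
  "has_fourier f g \<longleftrightarrow> f \<in> L2 \<and> L2_lim (\<lambda>R. fourier_trunc R f) at_top g"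

definition fourier_image :: "(real ^ 3 \<Rightarrow> cl3) set \<Rightarrow> (real ^ 3 \<Rightarrow> cl3) set" where
  "fourier_image V = {f. \<exists>g\<in>V. has_fourier g f}"

definition H_minus :: "(real ^ 3 \<Rightarrow> cl3) \<Rightarrow> nat \<Rightarrow> (real ^ 3 \<Rightarrow> cl3) set" where
  "H_minus \<gamma> j = fourier_image (spinor_space \<gamma> (w_minus j))"

definition H_plus :: "(real ^ 3 \<Rightarrow> cl3) \<Rightarrow> nat \<Rightarrow> (real ^ 3 \<Rightarrow> cl3) set" where
  "H_plus \<gamma> j = fourier_image (spinor_space \<gamma> (w_plus j))"

definition sum4 :: "(nat \<Rightarrow> (real ^ 3 \<Rightarrow> cl3) set) \<Rightarrow> (real ^ 3 \<Rightarrow> cl3) set" where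
  "sum4 V = {\<lambda>x. \<Sum>j = 1..4. f j x | f. \<forall>j\<in>{1..4}. f j \<in> V j}"

text \<open>
  Since \<open>e3 e1 e2\<close> is central with square \<open>1\<close>, left or right multiplication never leads out of the
  ideal \<open>p Cl\<close>, which is only half of the algebra, and on it right multiplication by \<open>e3\<close> merely
  rescales the elements \<open>w_minus j\<close>, \<open>w_plus j\<close> with \<open>j = 1, 2\<close>. Consequently \<open>H_plus \<gamma> 3\<close> and
  \<open>H_plus \<gamma> 4\<close> coincide with \<open>H_plus \<gamma> 1\<close> and \<open>H_plus \<gamma> 2\<close> (likewise for \<open>H_minus\<close>), and the sum
  over \<open>j\<close> only accounts for the functions in \<open>H+\<close> (respectively \<open>H-\<close>) that are \<open>p Cl\<close>-valued.
\<close>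

definition p_valued :: "(real ^ 3 \<Rightarrow> cl3) set" where
  "p_valued = {f. AE x in lborel. \<exists>a. f x = cl_p \<odot> a}"

lemma w_dependent:
  "w_minus 3 = \<i> *s w_minus 1" "w_minus 4 = - \<i> *s w_minus 2"
  "w_plus 3 = \<i> *s w_plus 1" "w_plus 4 = - \<i> *s w_plus 2"
  by (simp_all add: cl_p_def w_minus_def w_plus_def cl_simps)

lemma w_in_ideal: "\<exists>a. w_minus j = cl_p \<odot> a" "\<exists>a. w_plus j = cl_p \<odot> a"
  unfolding w_minus_def w_plus_def by (auto simp: cl_assoc)

lemma cl_p_ideal_proper: "cl_one \<noteq> cl_p \<odot> a"
proof
  assume "cl_one = cl_p \<odot> a"
  then have "(cl_one + e3 \<odot> e1 \<odot> e2) \<odot> cl_one = (cl_one + e3 \<odot> e1 \<odot> e2) \<odot> cl_p \<odot> a"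
    by (simp add: cl_assoc)
  also have "(cl_one + e3 \<odot> e1 \<odot> e2) \<odot> cl_p = 0"
    by (simp add: cl_p_def cl_simps)
  finally have "cl_one + e3 \<odot> e1 \<odot> e2 = 0"
    by (simp add: cl_one_right cl_bilinear)
  then have "(cl_one + e3 \<odot> e1 \<odot> e2) $ (False, False, False) = 0"
    by simp
  then show False
    by (simp add: cl_one_def e1_def e2_def e3_def axis_mult_axis cl_assoc cl_bilinear
        blade_sign_def blade_diff_def) (simp add: axis_def)
qed

end

theory Submission
  imports Defs "HOL-Probability.Characteristic_Functions"
begin

text \<open>
  On the Fourier side \<open>H\<close> is multiplication by \<open>-i \<xi>/|\<xi>|\<close>, an element of square one, so \<open>H+\<close> and \<open>H-\<close> are
  the eigenspaces for \<open>1\<close> and \<open>-1\<close>, with projections \<open>(1 + H)/2\<close> and \<open>(1 - H)/2\<close>.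

  The multiplier is computed without polar coordinates from the Gaussian superposition
  \<open>z / (pi^2 |z|^4) = \<integral> t z exp (-pi t |z|^2) dt\<close> over \<open>0 < t\<close>. The kernel truncated at \<open>|z| = \<epsilon>\<close> differs from
  the superposition over \<open>0 < t < 1/\<epsilon>^2\<close> by \<open>\<epsilon>^-3 D (z/\<epsilon>)\<close> with \<open>D\<close> integrable and odd; the transform of
  this difference at \<open>\<xi>\<close> is that of \<open>D\<close> at \<open>\<epsilon> \<xi>\<close>, hence tends to the integral of \<open>D\<close>, which is \<open>0\<close>.

  Since the square of the Fourier transform is the reflection, the transform of \<open>g\<close> lies in the eigenspace for
  \<open>s\<close> iff \<open>i \<omega> g = s g\<close> where \<open>\<omega> = y/|y|\<close>, that is, iff \<open>v = \<gamma>(\<omega>)^-1 g\<close> satisfies \<open>i e3 v = s v\<close>. In the ideal \<open>p Cl\<close>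
  the solutions \<open>v\<close> form a plane, spanned by the first two of the vectors \<open>w\<close>.
\<close>

section \<open>The seminorm on \<open>L^2\<close>\<close>

text \<open>Two obstacles shape the development. The kernel of \<open>hilbert_trunc\<close> decays
  only like |z|^-3: it is square integrable but not integrable, so its transform is no absolutely
  convergent integral and the convolution theorem for integrable kernels does not apply. The
  superposition is therefore taken over a \<le> t \<le> b with 0 < a, where everything is
  integrable, and a \<rightarrow> 0 is carried out on kernels dominated in L^2 and multipliers that
  converge boundedly. Moreover \<open>has_fourier\<close> is itself a limit in L^2, so Plancherel's
  theorem and completeness come before any statement about it.

  The constants fit as follows. The integral of t exp (-pi t q) over t > 0 is 1 / (pi q)^2, whence
  the factor 1 / pi^2 of the kernel. The transform of t z exp (-pi t |z|^2) is -i \<xi> t^(-3/2) exp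
  (-pi |\<xi>|^2 / t), and u = |\<xi>| / sqrt t turns its t-integral into -i \<xi>/|\<xi>| times the
  integral of 2 exp (-pi u^2) over u > 0, which equals 1.

  Maximality is immediate: a subspace on which H acts as s lies in the eigenspace by
  definition.\<close>

definition N2 :: "(real ^ 3 \<Rightarrow> 'b::euclidean_space) \<Rightarrow> real" where
  "N2 f = sqrt (LINT x|lborel. (norm (f x))\<^sup>2)"

lemma L2_iff: "f \<in> L2 \<longleftrightarrow> f \<in> borel_measurable borel \<and> integrable lborel (\<lambda>x. (norm (f x))\<^sup>2)"
  by (simp add: L2_def)

lemma L2_measurable[measurable_dest]: "f \<in> L2 \<Longrightarrow> f \<in> borel_measurable borel"
  by (simp add: L2_iff)

lemma L2_integrable: "f \<in> L2 \<Longrightarrow> integrable lborel (\<lambda>x. (norm (f x))\<^sup>2)"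
  by (simp add: L2_iff)

lemma N2_nonneg: "0 \<le> N2 f"
  by (simp add: N2_def)

lemma N2_square: "(N2 f)\<^sup>2 = (LINT x|lborel. (norm (f x))\<^sup>2)"
  by (simp add: N2_def)

lemma L2_0: "(\<lambda>x. 0) \<in> L2" and N2_0: "N2 (\<lambda>x. 0) = 0"
  by (simp_all add: L2_iff N2_def)

text \<open>The two codomains may differ: vector-valued kernels are compared with scalar majorants,
  single components with whole vectors.\<close>

lemma
  fixes f :: "real ^ 3 \<Rightarrow> 'b::euclidean_space" and g :: "real ^ 3 \<Rightarrow> 'c::euclidean_space"
  assumes f: "f \<in> L2" and g[measurable]: "g \<in> borel_measurable borel" and C: "0 \<le> C"
    and le: "AE x in lborel. norm (g x) \<le> C * norm (f x)"
  shows L2_dominated: "g \<in> L2" and N2_dominated: "N2 g \<le> C * N2 f"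
proof -
  have sq: "AE x in lborel. (norm (g x))\<^sup>2 \<le> C\<^sup>2 * (norm (f x))\<^sup>2"
    using le by eventually_elim (metis norm_ge_zero power_mono power_mult_distrib)
  have int: "integrable lborel (\<lambda>x. C\<^sup>2 * (norm (f x))\<^sup>2)"
    using L2_integrable[OF f] by simp
  show g': "g \<in> L2"
    unfolding L2_iff
    by (intro conjI Bochner_Integration.integrable_bound[OF int]) (use sq in auto)
  have "(LINT x|lborel. (norm (g x))\<^sup>2) \<le> (LINT x|lborel. C\<^sup>2 * (norm (f x))\<^sup>2)"
    using L2_integrable[OF g'] int sq by (rule integral_mono_AE)
  also have "\<dots> = (C * N2 f)\<^sup>2"
    by (simp add: power_mult_distrib N2_square)
  finally show "N2 g \<le> C * N2 f"
    unfolding N2_def[of g] using C N2_nonneg[of f] by (simp add: real_le_lsqrt)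
qed

lemma N2_cong_AE:
  assumes "f \<in> borel_measurable borel" "g \<in> borel_measurable borel" "AE x in lborel. f x = g x"
  shows "N2 f = N2 g"
  unfolding N2_def
  by (rule arg_cong[where f = sqrt], rule integral_cong_AE) (use assms in auto)

lemma L2_cong_AE:
  fixes f g :: "real ^ 3 \<Rightarrow> 'b::euclidean_space"
  assumes "f \<in> L2" "g \<in> borel_measurable borel" "AE x in lborel. f x = g x"
  shows "g \<in> L2"
  by (rule L2_dominated[OF assms(1,2), of 1]) (use assms(3) in auto)

lemma N2_zero_iff:
  assumes f: "f \<in> L2" shows "N2 f = 0 \<longleftrightarrow> (AE x in lborel. f x = 0)"
  unfolding N2_def using integral_nonneg_eq_0_iff_AE[OF L2_integrable[OF f]] by simp

lemma norm_mult_integrable: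
  fixes f :: "real ^ 3 \<Rightarrow> 'b::euclidean_space" and g :: "real ^ 3 \<Rightarrow> 'c::euclidean_space"
  assumes [measurable]: "f \<in> L2" "g \<in> L2"
  shows "integrable lborel (\<lambda>x. norm (f x) * norm (g x))"
proof (rule Bochner_Integration.integrable_bound)
  show "integrable lborel (\<lambda>x. (norm (f x))\<^sup>2 + (norm (g x))\<^sup>2)"
    using assms by (intro Bochner_Integration.integrable_add L2_integrable)
  have "norm (norm (f x) * norm (g x)) \<le> norm ((norm (f x))\<^sup>2 + (norm (g x))\<^sup>2)" for x
    using sum_squares_bound[of "norm (f x)" "norm (g x)"]
      mult_nonneg_nonneg[OF norm_ge_zero[of "f x"] norm_ge_zero[of "g x"]]
    unfolding real_norm_def abs_le_iff by linarith
  then show "AE x in lborel. norm (norm (f x) * norm (g x)) \<le> norm ((norm (f x))\<^sup>2 + (norm (g x))\<^sup>2)"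
    by simp
qed simp

text \<open>The integral of \<open>(s * norm (f x) - norm (g x))\<^sup>2\<close> is a nonnegative
  quadratic polynomial in s.\<close>

lemma Cauchy_Schwarz_N2:
  fixes f :: "real ^ 3 \<Rightarrow> 'b::euclidean_space" and g :: "real ^ 3 \<Rightarrow> 'c::euclidean_space"
  assumes f: "f \<in> L2" and g: "g \<in> L2"
  shows "(LINT x|lborel. norm (f x) * norm (g x)) \<le> N2 f * N2 g"
proof -
  let ?C = "LINT x|lborel. norm (f x) * norm (g x)"
  note I = L2_integrable[OF f] L2_integrable[OF g] norm_mult_integrable[OF f g]
  have "0 \<le> (LINT x|lborel. (s * norm (f x) - norm (g x))\<^sup>2)" for s
    by simp
  moreover have "(LINT x|lborel. (s * norm (f x) - norm (g x))\<^sup>2)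
      = (LINT x|lborel. s\<^sup>2 * (norm (f x))\<^sup>2 - 2 * s * (norm (f x) * norm (g x)) + (norm (g x))\<^sup>2)" for s
    by (intro Bochner_Integration.integral_cong refl)
      (simp add: power2_diff power_mult_distrib algebra_simps)
  moreover have "\<dots> s = s\<^sup>2 * (N2 f)\<^sup>2 - 2 * s * ?C + (N2 g)\<^sup>2" for s
    using I by (simp add: N2_square)
  ultimately have q: "0 \<le> s\<^sup>2 * (N2 f)\<^sup>2 - 2 * s * ?C + (N2 g)\<^sup>2" for s
    by metis
  have "?C\<^sup>2 \<le> (N2 f * N2 g)\<^sup>2"
  \<comment> \<open>The quadratic is evaluated at its minimizer \<open>?C / (N2 f)\<^sup>2\<close>.
    If the leading coefficient is zero there is none, but then f vanishes almost everywhere and so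
    does the product.\<close>
  proof (cases "N2 f = 0")
    case True
    then have z: "AE x in lborel. f x = 0"
      using N2_zero_iff[OF f] by simp
    have "?C = (LINT x|(lborel :: (real^3) measure). 0)"
      using f g z by (intro integral_cong_AE) auto
    then show ?thesis by simp
  next
    case False
    then show ?thesis
      using q[of "?C / (N2 f)\<^sup>2"]
      by (auto simp: power2_eq_square field_simps zero_le_divide_iff mult_le_0_iff)
  qed
  then show ?thesis
    using N2_nonneg by (meson mult_nonneg_nonneg power2_le_imp_le)
qed

lemma L2_add:
  fixes f g :: "real ^ 3 \<Rightarrow> 'b::euclidean_space"
  assumes f: "f \<in> L2" and g: "g \<in> L2"
  shows "(\<lambda>x. f x + g x) \<in> L2" and N2_triangle: "N2 (\<lambda>x. f x + g x) \<le> N2 f + N2 g"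
proof -
  note I = L2_integrable[OF f] L2_integrable[OF g] norm_mult_integrable[OF f g]
  let ?h = "\<lambda>x. (norm (f x))\<^sup>2 + 2 * (norm (f x) * norm (g x)) + (norm (g x))\<^sup>2"
  have int: "integrable lborel ?h"
    using I by simp
  have le: "(norm (f x + g x))\<^sup>2 \<le> ?h x" for x
    using power_mono[OF norm_triangle_ineq[of "f x" "g x"] norm_ge_zero, of 2]
    by (simp add: power2_sum algebra_simps)
  show L: "(\<lambda>x. f x + g x) \<in> L2"
    unfolding L2_iff
  proof (intro conjI Bochner_Integration.integrable_bound[OF int])
    show "AE x in lborel. norm ((norm (f x + g x))\<^sup>2) \<le> norm (?h x)"
      using le by (intro AE_I2) (simp add: order_trans[OF le])
  qed (use f g in measurable)
  have "(LINT x|lborel. (norm (f x + g x))\<^sup>2) \<le> (LINT x|lborel. ?h x)"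
    using L2_integrable[OF L] int le by (intro integral_mono) auto
  also have "\<dots> \<le> (N2 f + N2 g)\<^sup>2"
    using I Cauchy_Schwarz_N2[OF f g] by (simp add: N2_square power2_sum)
  finally show "N2 (\<lambda>x. f x + g x) \<le> N2 f + N2 g"
    unfolding N2_def[of "\<lambda>x. f x + g x"] using N2_nonneg by (intro real_le_lsqrt) (auto intro: add_nonneg_nonneg)
qed

lemma L2_scaleR:
  fixes f :: "real ^ 3 \<Rightarrow> 'b::euclidean_space"
  shows "f \<in> L2 \<Longrightarrow> (\<lambda>x. c *\<^sub>R f x) \<in> L2"
  by (rule L2_dominated[of f _ "\<bar>c\<bar>"]) auto

lemma L2_uminus:
  fixes f :: "real ^ 3 \<Rightarrow> 'b::euclidean_space"
  shows "f \<in> L2 \<Longrightarrow> (\<lambda>x. - f x) \<in> L2"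
  using L2_scaleR[of f "-1"] by simp

lemma N2_uminus: "N2 (\<lambda>x. - f x) = N2 f"
  by (simp add: N2_def)

lemma L2_diff:
  fixes f :: "real ^ 3 \<Rightarrow> 'b::euclidean_space"
  shows "f \<in> L2 \<Longrightarrow> g \<in> L2 \<Longrightarrow> (\<lambda>x. f x - g x) \<in> L2"
  using L2_add[OF _ L2_uminus, of f g] by simp

lemma N2_commute: "N2 (\<lambda>x. f x - g x) = N2 (\<lambda>x. g x - f x)"
  by (simp add: N2_def norm_minus_commute)

lemma N2_triangle_diff:
  fixes f g h :: "real ^ 3 \<Rightarrow> 'b::euclidean_space"
  assumes "f \<in> L2" "g \<in> L2" "h \<in> L2"
  shows "N2 (\<lambda>x. f x - h x) \<le> N2 (\<lambda>x. f x - g x) + N2 (\<lambda>x. g x - h x)"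
  using N2_triangle[OF L2_diff[OF assms(1,2)] L2_diff[OF assms(2,3)]] by simp

lemma N2_le_diff:
  fixes f g :: "real ^ 3 \<Rightarrow> 'b::euclidean_space"
  assumes "f \<in> L2" "g \<in> L2"
  shows "N2 f \<le> N2 g + N2 (\<lambda>x. f x - g x)"
  using N2_triangle[OF assms(2) L2_diff[OF assms]] by simp

lemma L2_sum:
  fixes f :: "'i \<Rightarrow> real ^ 3 \<Rightarrow> 'b::euclidean_space"
  assumes "finite I" "\<And>i. i \<in> I \<Longrightarrow> f i \<in> L2"
  shows "(\<lambda>x. \<Sum>i\<in>I. f i x) \<in> L2"
  using assms by (induction I) (simp_all add: L2_0 L2_add)

section \<open>Convergence in the seminorm\<close>

lemma N2_tendsto_dominated:
  fixes s :: "nat \<Rightarrow> real ^ 3 \<Rightarrow> 'b::euclidean_space" and h :: "real ^ 3 \<Rightarrow> 'c::euclidean_space"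
  assumes [measurable]: "\<And>n. s n \<in> borel_measurable borel"
    and h: "h \<in> L2" and le: "\<And>n. AE x in lborel. norm (s n x) \<le> C * norm (h x)"
    and lim: "AE x in lborel. (\<lambda>n. s n x) \<longlonglongrightarrow> 0"
  shows "(\<lambda>n. N2 (s n)) \<longlonglongrightarrow> 0"
proof -
  have "(\<lambda>n. LINT x|lborel. (norm (s n x))\<^sup>2) \<longlonglongrightarrow> (LINT x|(lborel :: (real^3) measure). 0)"
  proof (rule integral_dominated_convergence)
    show "integrable lborel (\<lambda>x. C\<^sup>2 * (norm (h x))\<^sup>2)"
      using L2_integrable[OF h] by simp
    show "AE x in lborel. (\<lambda>n. (norm (s n x))\<^sup>2) \<longlonglongrightarrow> 0"
      using lim by eventually_elim (use tendsto_norm_zero tendsto_power[where n = 2] in fastforce)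
    show "AE x in lborel. norm ((norm (s n x))\<^sup>2) \<le> C\<^sup>2 * (norm (h x))\<^sup>2" for n
      using le[of n] by eventually_elim (use power_mono[OF _ norm_ge_zero, of _ _ 2] in
        \<open>fastforce simp: power_mult_distrib\<close>)
  qed auto
  then show ?thesis
    unfolding N2_def using tendsto_real_sqrt by fastforce
qed

text \<open>\<open>L2_lim\<close> speaks of squared distances; the distances themselves are what the
  triangle inequality handles.\<close>

lemma L2_lim_iff:
  "L2_lim F \<phi> g \<longleftrightarrow> (\<forall>\<^sub>F t in \<phi>. F t \<in> L2) \<and> g \<in> L2 \<and> ((\<lambda>t. N2 (\<lambda>x. F t x - g x)) \<longlongrightarrow> 0) \<phi>"
proof -
  have "((\<lambda>t. (N2 (\<lambda>x. F t x - g x))\<^sup>2) \<longlongrightarrow> 0) \<phi> \<longleftrightarrow> ((\<lambda>t. N2 (\<lambda>x. F t x - g x)) \<longlongrightarrow> 0) \<phi>"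
    using tendsto_null_power[of "\<lambda>t. N2 (\<lambda>x. F t x - g x)" \<phi> 2]
      tendsto_real_sqrt[of "\<lambda>t. (N2 (\<lambda>x. F t x - g x))\<^sup>2" 0 \<phi>] by (auto simp: N2_nonneg)
  then show ?thesis
    by (simp add: L2_lim_def N2_square)
qed

text \<open>The squared norms tend to 0 in L^1, where convergence always yields a subsequence
  converging almost everywhere.\<close>

lemma N2_tendsto_AE_subseq:
  assumes F: "\<And>n. F n \<in> L2" and lim: "(\<lambda>n. N2 (F n)) \<longlonglongrightarrow> 0"
  obtains r :: "nat \<Rightarrow> nat" where "strict_mono r" "AE x in lborel. (\<lambda>n. F (r n) x) \<longlonglongrightarrow> 0"
proof -
  have "(\<lambda>n. LINT x|lborel. norm ((norm (F n x))\<^sup>2)) \<longlonglongrightarrow> 0"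
    using tendsto_null_power[OF lim, of 2] by (simp add: N2_square)
  from tendsto_L1_AE_subseq[OF L2_integrable[OF F] this]
  obtain r where r: "strict_mono r" "AE x in lborel. (\<lambda>n. (norm (F (r n) x))\<^sup>2) \<longlonglongrightarrow> 0"
    by blast
  from r(2) have "AE x in lborel. (\<lambda>n. F (r n) x) \<longlonglongrightarrow> 0"
  proof eventually_elim
    case (elim x)
    from tendsto_real_sqrt[OF elim] show ?case
      by (simp add: tendsto_norm_zero_iff)
  qed
  with r(1) show ?thesis by (rule that)
qed

lemma L2_lim_unique_AE:
  assumes F: "L2_lim F \<phi> g" and G: "L2_lim F \<phi> h" and \<phi>: "\<phi> \<noteq> bot"
  shows "AE x in lborel. g x = h x"
proof -
  have "((\<lambda>t. N2 (\<lambda>x. F t x - g x) + N2 (\<lambda>x. F t x - h x)) \<longlongrightarrow> 0 + 0) \<phi>"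
    using F G unfolding L2_lim_iff by (intro tendsto_add) auto
  moreover have "\<forall>\<^sub>F t in \<phi>. N2 (\<lambda>x. g x - h x) \<le> N2 (\<lambda>x. F t x - g x) + N2 (\<lambda>x. F t x - h x)"
    using F G unfolding L2_lim_iff
    by (auto elim!: eventually_mono intro!: N2_triangle_diff simp: N2_commute[of "F _" g])
  ultimately have "N2 (\<lambda>x. g x - h x) \<le> 0"
    using \<phi> by (intro tendsto_lowerbound[of _ 0 \<phi>]) auto
  then have "N2 (\<lambda>x. g x - h x) = 0"
    using N2_nonneg[of "\<lambda>x. g x - h x"] by linarith
  then show ?thesis
    using F G N2_zero_iff[OF L2_diff[of g h]] by (auto simp: L2_lim_iff)
qed

section \<open>Completeness and density of test functions\<close>

text \<open>Completeness calls for a norm estimate of an almost everywhere limit before its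
  membership in L^2 is known; a uniform bound and Fatou's lemma give both at once.\<close>

lemma
  fixes s :: "nat \<Rightarrow> real ^ 3 \<Rightarrow> 'b::euclidean_space"
  assumes s: "\<And>n. s n \<in> L2" and C: "\<And>n. N2 (s n) \<le> C"
    and g[measurable]: "g \<in> borel_measurable borel"
    and lim: "AE x in lborel. (\<lambda>n. s n x) \<longlonglongrightarrow> g x"
  shows L2_Fatou: "g \<in> L2" and N2_Fatou: "N2 g \<le> C"
proof -
  have [measurable]: "\<And>n. s n \<in> borel_measurable borel"
    using s by auto
  have C0: "0 \<le> C"
    using C[of 0] N2_nonneg[of "s 0"] by linarith
  have "(\<integral>\<^sup>+x. ennreal ((norm (g x))\<^sup>2) \<partial>lborel)
      = (\<integral>\<^sup>+x. liminf (\<lambda>n. ennreal ((norm (s n x))\<^sup>2)) \<partial>lborel)"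
  proof (rule nn_integral_cong_AE, use lim in eventually_elim)
    fix x assume "(\<lambda>n. s n x) \<longlonglongrightarrow> g x"
    then have "(\<lambda>n. ennreal ((norm (s n x))\<^sup>2)) \<longlonglongrightarrow> ennreal ((norm (g x))\<^sup>2)"
      by (intro tendsto_intros) auto
    then show "ennreal ((norm (g x))\<^sup>2) = liminf (\<lambda>n. ennreal ((norm (s n x))\<^sup>2))"
      by (rule lim_imp_Liminf[symmetric, rotated]) simp
  qed
  also have "\<dots> \<le> liminf (\<lambda>n. \<integral>\<^sup>+x. ennreal ((norm (s n x))\<^sup>2) \<partial>lborel)"
    by (rule nn_integral_liminf) measurable
  also have "\<dots> \<le> limsup (\<lambda>n. \<integral>\<^sup>+x. ennreal ((norm (s n x))\<^sup>2) \<partial>lborel)"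
    by (rule Liminf_le_Limsup) simp
  also have "\<dots> \<le> ennreal (C\<^sup>2)"
  proof (rule Limsup_bounded, rule always_eventually, rule allI)
    fix n
    have "(\<integral>\<^sup>+x. ennreal ((norm (s n x))\<^sup>2) \<partial>lborel) = ennreal ((N2 (s n))\<^sup>2)"
      using L2_integrable[OF s[of n]] by (simp add: N2_square nn_integral_eq_integral)
    also have "\<dots> \<le> ennreal (C\<^sup>2)"
      using C[of n] N2_nonneg by (intro ennreal_leI power_mono) auto
    finally show "(\<integral>\<^sup>+x. ennreal ((norm (s n x))\<^sup>2) \<partial>lborel) \<le> ennreal (C\<^sup>2)" .
  qed
  finally have le: "(\<integral>\<^sup>+x. ennreal ((norm (g x))\<^sup>2) \<partial>lborel) \<le> ennreal (C\<^sup>2)" .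
  then have int: "integrable lborel (\<lambda>x. (norm (g x))\<^sup>2)"
    by (intro integrableI_bounded) (auto intro: le_less_trans)
  then show "g \<in> L2"
    by (simp add: L2_iff)
  have "(N2 g)\<^sup>2 \<le> C\<^sup>2"
    using le int by (simp add: N2_square nn_integral_eq_integral)
  then show "N2 g \<le> C"
    using C0 by (rule power2_le_imp_le)
qed

lemma L2_indicator:
  fixes c :: "'b::euclidean_space"
  assumes [measurable]: "A \<in> sets borel" and fin: "emeasure lborel A < \<infinity>"
  shows "(\<lambda>x :: real^3. indicator A x *\<^sub>R c) \<in> L2"
proof -
  have "(norm (indicator A x *\<^sub>R c))\<^sup>2 = indicator A x *\<^sub>R (norm c)\<^sup>2" for x :: "real^3"
    by (simp split: split_indicator)
  moreover have "integrable lborel (\<lambda>x. indicator A x *\<^sub>R (norm c)\<^sup>2)"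
    using fin by (intro integrable_indicator integrable_scaleR_left) auto
  ultimately show ?thesis
    by (simp add: L2_iff)
qed

text \<open>Riesz-Fischer: along a subsequence with gaps below 2^-k the telescoping series converges
  absolutely almost everywhere, which defines the limit; Fatou's lemma turns the pointwise limit
  into a norm estimate.\<close>

lemma L2_complete:
  fixes F :: "nat \<Rightarrow> real ^ 3 \<Rightarrow> cl3"
  assumes F: "\<And>n. F n \<in> L2"
    and cauchy: "\<And>e. 0 < e \<Longrightarrow> \<exists>M. \<forall>m\<ge>M. \<forall>n\<ge>M. N2 (\<lambda>x. F m x - F n x) < e"
  obtains g where "L2_lim F sequentially g"
proof -
  have [measurable]: "\<And>n. F n \<in> borel_measurable borel"
    using F by auto
  have "\<exists>M. \<forall>k. \<forall>m\<ge>M k. \<forall>n\<ge>M k. N2 (\<lambda>x. F m x - F n x) < (1/2)^k"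
    using cauchy by (intro choice allI) simp
  then obtain M where M: "\<And>k m n. m \<ge> M k \<Longrightarrow> n \<ge> M k \<Longrightarrow> N2 (\<lambda>x. F m x - F n x) < (1/2)^k"
    by blast
  \<comment> \<open>The partial sums dominate \<open>M k\<close> and are monotone whatever M is;
    repeated indices do no harm.\<close>
  define r where "r k = (\<Sum>i\<le>k. M i)" for k :: nat
  have r: "r k \<ge> M k" "r (Suc k) \<ge> r k" for k
    by (cases k; simp add: r_def)+
  then have rm: "mono r"
    by (simp add: mono_iff_le_Suc)
  define h where "h k x = F (r (Suc k)) x - F (r k) x" for k x
  have h: "h k \<in> L2" for k
    unfolding h_def using F by (intro L2_diff)
  have [measurable]: "\<And>k. h k \<in> borel_measurable borel"
    using h by auto
  have hN: "N2 (h k) \<le> (1/2)^k" for k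
    unfolding h_def using M[of k "r (Suc k)" "r k"] r[of k] by auto
  \<comment> \<open>On a ball the L^2 bounds become L^1 bounds by Cauchy-Schwarz against the
    indicator, so the series of norms has a finite integral there. Countably many balls keep the
    exceptional set null.\<close>
  have sb: "\<forall>R::nat. AE x in lborel. norm x \<le> real R \<longrightarrow> summable (\<lambda>k. norm (h k x))"
  proof
    fix R :: nat
    let ?B = "cball 0 (real R) :: (real^3) set"
    let ?i = "\<lambda>x. indicator ?B x *\<^sub>R (1::real)"
    have i: "?i \<in> L2"
      by (intro L2_indicator) (auto intro: emeasure_bounded_finite simp flip: infinity_ennreal_def)
    have le: "(\<integral>\<^sup>+x. ennreal (norm (h k x) * norm (?i x)) \<partial>lborel) \<le> ennreal (N2 ?i * (1/2)^k)" for k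
    proof -
      have "(\<integral>\<^sup>+x. ennreal (norm (h k x) * norm (?i x)) \<partial>lborel)
          = ennreal (LINT x|lborel. norm (h k x) * norm (?i x))"
        by (intro nn_integral_eq_integral norm_mult_integrable h i) auto
      also have "\<dots> \<le> ennreal (N2 ?i * (1/2)^k)"
        using order_trans[OF Cauchy_Schwarz_N2[OF h i] mult_right_mono[OF hN N2_nonneg]]
        by (intro ennreal_leI) (simp add: mult.commute)
      finally show ?thesis .
    qed
    have [measurable]: "?B \<in> sets borel"
      by simp
    have "(\<integral>\<^sup>+x. (\<Sum>k. ennreal (norm (h k x) * norm (?i x))) \<partial>lborel)
        = (\<Sum>k. \<integral>\<^sup>+x. ennreal (norm (h k x) * norm (?i x)) \<partial>lborel)"
      by (intro nn_integral_suminf) simp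
    also have "\<dots> \<le> (\<Sum>k. ennreal (N2 ?i * (1/2)^k))"
      by (intro suminf_le le) auto
    also have "\<dots> < \<infinity>"
      using N2_nonneg by (subst suminf_ennreal2) (auto intro!: summable_mult mult_nonneg_nonneg)
    finally have "AE x in lborel. (\<Sum>k. ennreal (norm (h k x) * norm (?i x))) \<noteq> \<infinity>"
      by (intro nn_integral_PInf_AE) auto
    then show "AE x in lborel. norm x \<le> real R \<longrightarrow> summable (\<lambda>k. norm (h k x))"
    proof eventually_elim
      case (elim x)
      then have "summable (\<lambda>k. norm (h k x) * norm (?i x))"
        by (intro summable_suminf_not_top) auto
      then show ?case by (auto simp: indicator_def split: if_splits)
    qed
  qed
  have conv: "AE x in lborel. convergent (\<lambda>k. F (r k) x)"
    using sb unfolding AE_all_countable[symmetric]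
  proof eventually_elim
    case (elim x)
    then have "summable (\<lambda>k. norm (h k x))"
      using real_arch_simple[of "norm x"] by blast
    then have "summable (\<lambda>k. h k x)"
      by (rule summable_norm_cancel)
    then have "convergent (\<lambda>k. F (r 0) x + (\<Sum>i<k. h i x))"
      by (intro convergent_add) (auto simp: summable_iff_convergent convergent_const)
    moreover have "F (r 0) x + (\<Sum>i<k. h i x) = F (r k) x" for k
      unfolding h_def by (induction k) (simp_all add: add.assoc[symmetric])
    ultimately show ?case by simp
  qed
  define g where "g x = lim (\<lambda>k. F (r k) x)" for x
  have [measurable]: "g \<in> borel_measurable borel"
    unfolding g_def by (rule borel_measurable_lim_metric) auto
  have lim: "AE x in lborel. (\<lambda>k. F (r k) x) \<longlonglongrightarrow> g x"
    using conv by eventually_elim (simp add: g_def convergent_LIMSEQ_iff)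
  \<comment> \<open>Fatou is applied to \<open>F m\<close> minus the subsequence from index k on,
    whose members all lie within 2^-k of \<open>F m\<close>.\<close>
  have est: "(\<lambda>x. F m x - g x) \<in> L2 \<and> N2 (\<lambda>x. F m x - g x) \<le> (1/2)^k" if "m \<ge> M k" for m k
  proof -
    have le: "N2 (\<lambda>x. F m x - F (r (j + k)) x) \<le> (1/2)^k" for j
    proof -
      have "r (j + k) \<ge> M k"
        using r(1)[of k] monoD[OF rm, of k "j + k"] by linarith
      then show ?thesis using M[of k m] that by fastforce
    qed
    have L: "AE x in lborel. (\<lambda>j. F m x - F (r (j + k)) x) \<longlonglongrightarrow> F m x - g x"
      using lim by eventually_elim (intro tendsto_diff tendsto_const LIMSEQ_ignore_initial_segment)
    show ?thesis
      using L2_Fatou[OF L2_diff[OF F F] le _ L] N2_Fatou[OF L2_diff[OF F F] le _ L] by auto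
  qed
  have g: "g \<in> L2"
    using L2_diff[OF F[of "M 0"] conjunct1[OF est[of 0 "M 0"]]] by simp
  have "(\<lambda>m. N2 (\<lambda>x. F m x - g x)) \<longlonglongrightarrow> 0"
  proof (rule LIMSEQ_I)
    fix e :: real assume "0 < e"
    then obtain k where k: "(1/2)^k < e"
      using real_arch_pow_inv[of e "1/2"] by auto
    show "\<exists>no. \<forall>n\<ge>no. norm (N2 (\<lambda>x. F n x - g x) - 0) < e"
    proof (intro exI[of _ "M k"] allI impI)
      fix n assume "M k \<le> n"
      then show "norm (N2 (\<lambda>x. F n x - g x) - 0) < e"
        using est[of k n] k N2_nonneg[of "\<lambda>x. F n x - g x"] by simp
    qed
  qed
  then have "L2_lim F sequentially g"
    using F g by (simp add: L2_lim_iff)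
  then show ?thesis by (rule that)
qed

section \<open>Density of continuous functions with compact support\<close>

definition test_fun :: "(real ^ 3 \<Rightarrow> 'b::euclidean_space) \<Rightarrow> bool" where
  "test_fun g \<longleftrightarrow> continuous_on UNIV g \<and> (\<exists>R. \<forall>x. R < norm x \<longrightarrow> g x = 0)"

lemma test_fun_bounded:
  assumes "test_fun g" obtains C where "0 \<le> C" "\<And>x. norm (g x) \<le> C"
proof -
  obtain R where R: "\<And>x. R < norm x \<Longrightarrow> g x = 0"
    using assms by (auto simp: test_fun_def)
  have "compact (g ` cball 0 R)"
    using assms by (intro compact_continuous_image) (auto simp: test_fun_def intro: continuous_on_subset)
  then obtain C where C: "0 < C" "\<And>y. y \<in> g ` cball 0 R \<Longrightarrow> norm y \<le> C"
    using compact_imp_bounded bounded_pos by metis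
  show ?thesis
  proof (rule that[of C])
    show "norm (g x) \<le> C" for x
      using C R[of x] by (cases "R < norm x") auto
  qed (use C in simp)
qed

lemma test_fun_L2:
  assumes "test_fun g" shows "g \<in> L2"
proof -
  obtain R where R: "\<And>x. R < norm x \<Longrightarrow> g x = 0"
    using assms by (auto simp: test_fun_def)
  obtain C where C: "0 \<le> C" "\<And>x. norm (g x) \<le> C"
    using test_fun_bounded[OF assms] by metis
  show ?thesis
  proof (rule L2_dominated)
    show "(\<lambda>x::real^3. indicator (cball 0 R) x *\<^sub>R (1::real)) \<in> L2"
      by (intro L2_indicator) (auto intro: emeasure_bounded_finite simp flip: infinity_ennreal_def)
    show "g \<in> borel_measurable borel"
      using assms by (intro borel_measurable_continuous_onI) (auto simp: test_fun_def)
    show "AE x in lborel. norm (g x) \<le> C * norm (indicator (cball 0 R) x *\<^sub>R (1::real))"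
      using C R by (intro AE_I2) (auto simp: indicator_def not_le)
  qed (use C in simp)
qed

lemma test_fun_add: "test_fun f \<Longrightarrow> test_fun g \<Longrightarrow> test_fun (\<lambda>x. f x + g x)"
proof -
  assume "test_fun f" "test_fun g"
  moreover from this obtain R S where "\<forall>x. R < norm x \<longrightarrow> f x = 0" "\<forall>x. S < norm x \<longrightarrow> g x = 0"
    by (auto simp: test_fun_def)
  then have "\<forall>x. max R S < norm x \<longrightarrow> f x + g x = 0"
    by auto
  ultimately show ?thesis
    unfolding test_fun_def by (blast intro: continuous_on_add)
qed

text \<open>Inner regularity replaces A by a compact K at small cost in measure; the indicator of K
  is the limit of tent functions of the distance to K, all supported in one ball.\<close>

lemma L2_dense_indicator:
  fixes c :: "'b::euclidean_space" and A :: "(real ^ 3) set"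
  assumes A: "A \<in> sets borel" and fin: "emeasure lborel A < \<infinity>" and e: "0 < e"
  shows "\<exists>g. test_fun g \<and> N2 (\<lambda>x. indicator A x *\<^sub>R c - g x) < e"
proof -
  \<comment> \<open>Chosen so that \<open>sqrt d * norm c\<close> is at most e / 2; the summand 1
    keeps d positive for c = 0.\<close>
  define d where "d = (e / 2 / (norm c + 1))\<^sup>2"
  have d: "0 < d"
    using e norm_ge_zero[of c] unfolding d_def
    by (intro zero_less_power divide_pos_pos) (auto intro: add_nonneg_pos)
  obtain K where K: "compact K" "K \<subseteq> A" "measure lborel (A - K) < d"
  \<comment> \<open>For a null set the number \<open>measure lborel A - d\<close> would become 0 as
    an \<open>ennreal\<close>, and the strict inequality below would fail.\<close>
  proof (cases "measure lborel A = 0")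
    case True
    then show ?thesis using that[of "{}"] d by simp
  next
    case False
    \<comment> \<open>Inner regularity is applied to a finite measure, hence the restriction of
      Lebesgue measure to A.\<close>
    let ?M = "density lborel (indicator A)"
    have M: "emeasure ?M K = emeasure lborel (A \<inter> K)" if "K \<in> sets borel" for K
      using A that by (simp add: emeasure_density nn_integral_indicator flip: indicator_inter_arith)
    have "emeasure ?M A = (SUP K \<in> {K. K \<subseteq> A \<and> compact K}. emeasure ?M K)"
      using A fin by (intro inner_regular) (simp_all add: M)
    then have "emeasure lborel A = (SUP K \<in> {K. K \<subseteq> A \<and> compact K}. emeasure ?M K)"
      using A by (simp add: M)
    moreover have "ennreal (measure lborel A - d) < emeasure lborel A"
      using fin False d zero_less_measure_iff[of lborel A]
      by (simp add: emeasure_eq_ennreal_measure less_top) (auto intro!: ennreal_lessI)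
    ultimately obtain K where K: "K \<subseteq> A" "compact K" "ennreal (measure lborel A - d) < emeasure ?M K"
      by (auto simp: less_SUP_iff)
    have KB: "K \<in> sets borel"
      using K(2) by (simp add: borel_compact)
    then have "ennreal (measure lborel A - d) < emeasure lborel K"
      using K M[of K] by (simp add: Int_absorb1)
    moreover have finK: "emeasure lborel K < \<infinity>"
      using A by (intro le_less_trans[OF emeasure_mono[OF K(1)] fin]) simp
    ultimately have "measure lborel A - d < measure lborel K"
      by (simp add: emeasure_eq_ennreal_measure ennreal_less_iff less_top) (meson ennreal_lessI not_less ennreal_leI)
    moreover have "measure lborel (A - K) = measure lborel A - measure lborel K"
      using fin K(1) A KB by (intro measure_Diff) auto
    ultimately show ?thesis
      using that K by auto
  qed
  have KB: "K \<in> sets borel"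
    using K(1) by (simp add: borel_compact)
  have finK: "emeasure lborel (A - K) < \<infinity>" "emeasure lborel K < \<infinity>"
    using A by (intro le_less_trans[OF emeasure_mono fin]; use K(2) in auto)+
  have "N2 (\<lambda>x. indicator A x *\<^sub>R c - indicator K x *\<^sub>R c) = N2 (\<lambda>x. indicator (A - K) x *\<^sub>R c)"
    using K(2) by (intro arg_cong[of _ _ N2] ext) (auto split: split_indicator)
  also have "\<dots> = sqrt (measure lborel (A - K)) * norm c"
  proof -
    have "(norm (indicator (A - K) x *\<^sub>R c))\<^sup>2 = indicator (A - K) x *\<^sub>R (norm c)\<^sup>2" for x
      by (simp split: split_indicator)
    then show ?thesis
      using finK A KB by (simp add: N2_def real_sqrt_mult)
  qed
  also have "\<dots> \<le> sqrt d * norm c"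
    using K(3) by (intro mult_right_mono) auto
  also have "\<dots> \<le> e / 2"
  proof -
    have pos: "0 < norm c + 1"
      using norm_ge_zero[of c] by linarith
    then have "norm c / (norm c + 1) \<le> 1"
      by simp
    from mult_left_mono[OF this, of "e / 2"] show ?thesis
      using e pos unfolding d_def real_sqrt_abs by simp
  qed
  finally have 1: "N2 (\<lambda>x. indicator A x *\<^sub>R c - indicator K x *\<^sub>R c) \<le> e / 2" .
  have ind: "(\<lambda>x. indicator A x *\<^sub>R c) \<in> L2" "(\<lambda>x. indicator K x *\<^sub>R c) \<in> L2"
    using A KB fin finK by (auto intro!: L2_indicator)
  show ?thesis
  \<comment> \<open>\<open>infdist\<close> to the empty set is 0, so the tent functions would not
    vanish far away.\<close>
  proof (cases "K = {}")
    case True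
    then have "N2 (\<lambda>x. indicator A x *\<^sub>R c - 0) < e"
      using 1 e by simp
    moreover have "test_fun (\<lambda>x. 0)"
      by (simp add: test_fun_def)
    ultimately show ?thesis by blast
  next
    case False
    obtain B where B: "\<And>x. x \<in> K \<Longrightarrow> norm x \<le> B"
      using K(1) compact_imp_bounded bounded_iff by metis
    \<comment> \<open>Equal to c on K, supported within distance 1 of K, and eventually 0 at each
      point off K as the slope n + 1 grows.\<close>
    define G where "G n x = max 0 (1 - (real n + 1) * infdist x K) *\<^sub>R c" for n x
    have G0: "G n x = 0" if "B + 1 < norm x" for n x
    proof -
      obtain y where y: "y \<in> K" "infdist x K = dist x y"
        using infdist_attains_inf[of K x] False K(1) by (auto simp: compact_imp_closed)
      have "norm x \<le> norm y + dist x y"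
        using norm_triangle_ineq[of y "x - y"] by (simp add: dist_norm)
      then have "1 \<le> infdist x K"
        using B[OF y(1)] y(2) that by linarith
      then have "1 \<le> (real n + 1) * infdist x K"
        using mult_mono[of 1 "real n + 1" 1 "infdist x K"] by simp
      then show ?thesis by (simp add: G_def)
    qed
    have test: "test_fun (G n)" for n
      unfolding test_fun_def
    proof (intro conjI exI[of _ "B + 1"])
      show "continuous_on UNIV (G n)"
        unfolding G_def by (intro continuous_intros)
    qed (use G0 in auto)
    have "(\<lambda>n. N2 (\<lambda>x. indicator K x *\<^sub>R c - G n x)) \<longlonglongrightarrow> 0"
    proof (rule N2_tendsto_dominated)
      show "(\<lambda>x. indicator K x *\<^sub>R c - G n x) \<in> borel_measurable borel" for n
        using test_fun_L2[OF test[of n]] KB by measurable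
      show "(\<lambda>x::real^3. indicator (cball 0 (B + 1)) x *\<^sub>R c) \<in> L2"
        by (intro L2_indicator) (auto intro: emeasure_bounded_finite simp flip: infinity_ennreal_def)
      have "norm (indicator K x *\<^sub>R c - G n x) \<le> 1 * norm (indicator (cball 0 (B + 1)) x *\<^sub>R c)" for n x
      proof (cases "norm x \<le> B + 1")
        case True
        have "indicator K x *\<^sub>R c - G n x = (indicator K x - max 0 (1 - (real n + 1) * infdist x K)) *\<^sub>R c"
          by (simp add: G_def scaleR_diff_left)
        moreover have "\<bar>indicator K x - max 0 (1 - (real n + 1) * infdist x K)\<bar> \<le> (1::real)"
          using infdist_nonneg[of x K] mult_nonneg_nonneg[of "real n + 1" "infdist x K"]
          by (auto simp: indicator_def)
        ultimately show ?thesis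
          using True by (simp add: mult_left_le_one_le)
      next
        case F: False
        then show ?thesis using G0[of x n] B[of x] by (auto simp: indicator_def)
      qed
      then show "AE x in lborel. norm (indicator K x *\<^sub>R c - G n x)
          \<le> 1 * norm (indicator (cball 0 (B + 1)) x *\<^sub>R c)" for n
        by simp
      have "(\<lambda>n. indicator K x *\<^sub>R c - G n x) \<longlonglongrightarrow> 0" for x
      proof (cases "x \<in> K")
        case True then show ?thesis by (simp add: G_def)
      next
        case F: False
        then have pos: "infdist x K > 0"
          using K(1) False by (simp add: compact_imp_closed infdist_pos_not_in_closed)
        obtain N where N: "1 / infdist x K < real N"
          using reals_Archimedean2 by blast
        have "G n x = 0" if "n \<ge> N" for n
        proof -
          have "1 / infdist x K \<le> real n + 1"
            using N that by simp
          then show ?thesis using pos by (simp add: G_def field_simps)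
        qed
        then have "\<forall>\<^sub>F n in sequentially. indicator K x *\<^sub>R c - G n x = 0"
          using F by (auto simp: eventually_sequentially)
        then show ?thesis by (simp add: tendsto_eventually)
      qed
      then show "AE x in lborel. (\<lambda>n. indicator K x *\<^sub>R c - G n x) \<longlonglongrightarrow> 0"
        by simp
    qed
    then obtain n where n: "N2 (\<lambda>x. indicator K x *\<^sub>R c - G n x) < e / 2"
      using order_tendstoD(2)[of _ 0 sequentially "e / 2"] e eventually_happens'[OF sequentially_bot]
      by fastforce
    have "N2 (\<lambda>x. indicator A x *\<^sub>R c - G n x) < e"
      using N2_triangle_diff[OF ind(1) ind(2) test_fun_L2[OF test[of n]]] 1 n by simp
    then show ?thesis using test by blast
  qed
qed

text \<open>Simple functions dominated by a multiple of f converge to it in L^2; being finite sums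
  of indicators, they are approximated summand by summand.\<close>

lemma L2_dense:
  fixes f :: "real ^ 3 \<Rightarrow> 'b::euclidean_space"
  assumes f: "f \<in> L2" and e: "0 < e"
  shows "\<exists>g. test_fun g \<and> N2 (\<lambda>x. f x - g x) < e"
proof -
  have [measurable]: "f \<in> borel_measurable borel"
    using f by auto
  obtain F where F: "\<And>i. simple_function lborel (F i)" "\<And>x. (\<lambda>i. F i x) \<longlonglongrightarrow> f x"
    "\<And>i x. dist (F i x) 0 \<le> 2 * dist (f x) 0"
    using borel_measurable_implies_sequence_metric[of f lborel 0] by auto
  have [measurable]: "F i \<in> borel_measurable borel" for i
    using borel_measurable_simple_function[OF F(1)] by simp
  have le: "norm (F i x) \<le> 2 * norm (f x)" for i x
    using F(3)[of i x] by simp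
  have FL: "F i \<in> L2" for i
    by (rule L2_dominated[OF f, of _ 2]) (use le in auto)
  have "(\<lambda>i. N2 (\<lambda>x. f x - F i x)) \<longlonglongrightarrow> 0"
  proof (rule N2_tendsto_dominated[OF _ f])
    show "AE x in lborel. norm (f x - F n x) \<le> 3 * norm (f x)" for n
      by (intro AE_I2 order_trans[OF norm_triangle_ineq4]) (use le[of n] in \<open>simp add: algebra_simps\<close>)
    show "AE x in lborel. (\<lambda>n. f x - F n x) \<longlonglongrightarrow> 0"
      using tendsto_diff[OF tendsto_const F(2)] by (intro AE_I2) (metis diff_self)
  qed simp
  then obtain i where i: "N2 (\<lambda>x. f x - F i x) < e / 2"
    using order_tendstoD(2)[of _ 0 sequentially "e / 2"] e eventually_happens'[OF sequentially_bot]
    by fastforce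
  let ?A = "\<lambda>y. F i -` {y}"
  have A: "?A y \<in> sets borel" for y
    using measurable_sets_borel[of "F i" borel "{y}"] by simp
  \<comment> \<open>Nonzero values are taken on sets of finite measure because \<open>F i\<close> is
    square integrable; the level set of 0 may have infinite measure but contributes nothing.\<close>
  have fin: "emeasure lborel (?A y) < \<infinity>" if "y \<noteq> 0" for y
  proof -
    have "(\<lambda>x. indicator (?A y) x *\<^sub>R (1::real)) \<in> L2"
      by (rule L2_dominated[OF FL[of i], of _ "1 / norm y"])
        (use that A in \<open>auto simp: indicator_def\<close>)
    from L2_integrable[OF this] have "integrable lborel (indicator (?A y) :: _ \<Rightarrow> real)"
      by (rule back_subst[where P = "integrable lborel"]) (auto simp: fun_eq_iff split: split_indicator)
    then show ?thesis
      using A by (simp add: integrable_indicator_iff)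
  qed
  define I where "I y x = indicator (?A y) x *\<^sub>R y" for y and x :: "real^3"
  define T where "T S x = (\<Sum>y\<in>S. I y x)" for S x
  have IL: "I y \<in> L2" for y
    unfolding I_def using L2_indicator[OF A fin, of y y] by (cases "y = 0") (simp_all add: L2_0)
  have TL: "T S \<in> L2" if "finite S" for S
    unfolding T_def using that IL by (rule L2_sum)
  have approx: "\<exists>g. test_fun g \<and> N2 (\<lambda>x. T S x - g x) < d" if "finite S" "0 < d" for S d
    using that
  proof (induction S arbitrary: d rule: finite_induct)
    case empty
    show ?case
      by (intro exI[of _ "\<lambda>x. 0"]) (use empty in \<open>simp add: T_def test_fun_def N2_0\<close>)
  next
    case (insert y S)
    obtain g where g: "test_fun g" "N2 (\<lambda>x. T S x - g x) < d / 2"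
      using insert.IH[OF half_gt_zero[OF insert.prems]] by blast
    have "\<exists>g. test_fun g \<and> N2 (\<lambda>x. I y x - g x) < d / 2"
    proof (cases "y = 0")
      case True
      then show ?thesis
        by (intro exI[of _ "\<lambda>x. 0"]) (use insert.prems in \<open>simp add: I_def test_fun_def N2_0\<close>)
    next
      case False
      then show ?thesis
        unfolding I_def using L2_dense_indicator[OF A fin half_gt_zero[OF insert.prems]] by blast
    qed
    then obtain h where h: "test_fun h" "N2 (\<lambda>x. I y x - h x) < d / 2"
      by blast
    have eq: "(\<lambda>x. T (insert y S) x - (h x + g x)) = (\<lambda>x. (I y x - h x) + (T S x - g x))"
      unfolding T_def by (simp only: sum.insert[OF insert.hyps] add_diff_add)
    have "N2 (\<lambda>x. T (insert y S) x - (h x + g x)) < d"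
      unfolding eq using g(2) h(2)
        N2_triangle[OF L2_diff[OF IL[of y] test_fun_L2[OF h(1)]]
          L2_diff[OF TL[OF insert.hyps(1)] test_fun_L2[OF g(1)]]]
      by linarith
    then show ?case
      by (intro exI[of _ "\<lambda>x. h x + g x"] conjI test_fun_add[OF h(1) g(1)])
  qed
  have rep: "F i = T (range (F i))"
    unfolding T_def I_def
    by (intro ext trans[OF simple_function_indicator_representation_banach[OF F(1)[of i]]])
      (simp_all only: space_lborel space_borel Int_UNIV_right UNIV_I)
  have "finite (range (F i))"
    using simple_functionD(1)[OF F(1)[of i]] by simp
  from approx[OF this half_gt_zero[OF e]]
  obtain g where g: "test_fun g" "N2 (\<lambda>x. F i x - g x) < e / 2"
    unfolding rep[symmetric] by blast
  have "N2 (\<lambda>x. f x - g x) < e"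
    using N2_triangle_diff[OF f FL[of i] test_fun_L2[OF g(1)]] i g(2) by simp
  then show ?thesis using g(1) by blast
qed

section \<open>Gaussian integrals\<close>

definition ek :: "real \<Rightarrow> complex" where
  "ek s = exp (- \<i> * 2 * pi * s)"

lemma ek_add: "ek (a + b) = ek a * ek b"
  by (simp add: ek_def algebra_simps flip: exp_add)

lemma ek_0[simp]: "ek 0 = 1"
  by (simp add: ek_def)

lemma norm_ek[simp]: "norm (ek s) = 1"
proof -
  have "ek s = exp (\<i> * complex_of_real (- 2 * pi * s))"
    by (simp add: ek_def algebra_simps)
  then show ?thesis by (simp only: norm_exp_i_times)
qed

lemma cnj_ek: "cnj (ek s) = ek (- s)"
  by (simp add: ek_def exp_cnj)

lemma continuous_ek[continuous_intros]:
  "continuous_on S f \<Longrightarrow> continuous_on S (\<lambda>x. ek (f x))"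
  unfolding ek_def by (intro continuous_intros)

lemma measurable_ek[measurable]: "ek \<in> borel_measurable borel"
  by (intro borel_measurable_continuous_onI continuous_intros)

text \<open>Up to a change of scale this is the characteristic function of the standard normal
  distribution.\<close>

lemma
  fixes t s :: real
  assumes t: "0 < t"
  shows gauss_line_integrable: "integrable lborel (\<lambda>x. exp (- pi * t * x\<^sup>2) * ek (x * s))"
    and gauss_line: "(LINT x|lborel. exp (- pi * t * x\<^sup>2) * ek (x * s)) = exp (- pi * s\<^sup>2 / t) / sqrt t"
proof -
  \<comment> \<open>The scale c turns x^2 / 2 into pi t x^2, and the frequency u = - 2 pi s / c
    turns \<open>iexp (u * (c * x))\<close> into \<open>ek (x * s)\<close>.\<close>
  let ?c = "sqrt (2 * pi * t)" and ?u = "- (2 * pi * s) / sqrt (2 * pi * t)"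
  let ?f = "\<lambda>x. std_normal_density x *\<^sub>R iexp (?u * x)"
  have c: "?c \<noteq> 0" using t by simp
  have eq: "?f (0 + ?c * x) = (1 / sqrt (2 * pi)) *\<^sub>R (exp (- pi * t * x\<^sup>2) * ek (x * s))" for x
  proof -
    have a: "std_normal_density (0 + ?c * x) = (1 / sqrt (2 * pi)) * exp (- pi * t * x\<^sup>2)"
      using t by (simp add: std_normal_density_def power_mult_distrib)
    have "?u * (0 + ?c * x) = - 2 * pi * (x * s)"
      using c by (simp add: field_simps)
    then have b: "iexp (?u * (0 + ?c * x)) = ek (x * s)"
      by (simp only: ek_def) (simp add: algebra_simps)
    show ?thesis
      unfolding a b by (simp add: scaleR_conv_of_real)
  qed
  have int: "integrable lborel ?f"
    by (rule Bochner_Integration.integrable_bound[OF integrable_normal_density[of 1 0]]) (auto simp: normal_density_nonneg)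
  have "integrable lborel (\<lambda>x. ?f (0 + ?c * x))"
  proof -
    have "has_bochner_integral lborel (\<lambda>x. ?f (0 + ?c * x)) (integral\<^sup>L lborel ?f /\<^sub>R \<bar>?c\<bar>)"
      using lborel_has_bochner_integral_real_affine_iff[OF c, of ?f "integral\<^sup>L lborel ?f" 0] int
      by (simp add: has_bochner_integral_integrable)
    then show ?thesis by (rule integrable.intros)
  qed
  then show "integrable lborel (\<lambda>x. exp (- pi * t * x\<^sup>2) * ek (x * s))"
    unfolding eq using integrable_scaleR_right[of "sqrt (2 * pi)" lborel
        "\<lambda>x. (1 / sqrt (2 * pi)) *\<^sub>R (exp (- pi * t * x\<^sup>2) * ek (x * s))"] by simp
  have "exp (- (?u\<^sup>2) / 2) = char std_normal_distribution ?u"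
    by (simp only: char_std_normal_distribution exp_of_real)
  also have "\<dots> = integral\<^sup>L lborel ?f"
    unfolding char_def by (subst integral_density) auto
  also have "\<dots> = \<bar>?c\<bar> *\<^sub>R (LINT x|lborel. ?f (0 + ?c * x))"
    by (rule lborel_integral_real_affine[OF c])
  also have "\<dots> = sqrt t *\<^sub>R (LINT x|lborel. exp (- pi * t * x\<^sup>2) * ek (x * s))"
    unfolding eq using t by (simp add: real_sqrt_mult)
  also have "exp (- (?u\<^sup>2) / 2) = exp (- pi * s\<^sup>2 / t)"
    using t by (simp add: power2_eq_square power_divide field_simps)
  finally show "(LINT x|lborel. exp (- pi * t * x\<^sup>2) * ek (x * s)) = exp (- pi * s\<^sup>2 / t) / sqrt t"
    using t by (simp add: field_simps scaleR_conv_of_real)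
qed

text \<open>The Gaussian times the exponential vanishes at both ends, so its derivative has integral
  zero. That derivative combines the moment with the integrand of \<open>gauss_line\<close>, which
  determines the moment.\<close>

lemma
  fixes t s :: real
  assumes t: "0 < t"
  shows gauss_line_moment_integrable: "integrable lborel (\<lambda>x. x * exp (- pi * t * x\<^sup>2) * ek (x * s))"
    and gauss_line_moment: "(LINT x|lborel. x * exp (- pi * t * x\<^sup>2) * ek (x * s))
      = - \<i> * s / t * (exp (- pi * s\<^sup>2 / t) / sqrt t)"
proof -
  let ?g = "\<lambda>x. exp (- pi * t * x\<^sup>2) * ek (x * s)"
  let ?h = "\<lambda>x. x * exp (- pi * t * x\<^sup>2) * ek (x * s)"
  have re: "integrable lborel (\<lambda>x. x * exp (- pi * t * x\<^sup>2))"
  proof -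
    let ?c = "sqrt (2 * pi * t)"
    have "integrable lborel (\<lambda>x. std_normal_density (0 + ?c * x) * (0 + ?c * x))"
      using t integrable_std_normal_moment[of 1]
      by (intro lborel_integrable_real_affine[where f = "\<lambda>x. std_normal_density x * x"]) auto
    moreover have "std_normal_density (0 + ?c * x) * (0 + ?c * x) = sqrt t * (x * exp (- pi * t * x\<^sup>2))" for x
      using t by (simp add: std_normal_density_def power_mult_distrib real_sqrt_mult)
    ultimately have "integrable lborel (\<lambda>x. sqrt t * (x * exp (- pi * t * x\<^sup>2)))"
      by (simp only:)
    then show ?thesis using t by simp
  qed
  show h: "integrable lborel ?h"
    by (rule Bochner_Integration.integrable_bound[OF re]) (auto simp: norm_mult)
  note g = gauss_line_integrable[OF t, of s]
  let ?F = "\<lambda>x. - 2 * pi * t * ?h x + (- 2 * pi * \<i> * s) * ?g x"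
  have F: "integrable lborel ?F"
    using g h by (intro Bochner_Integration.integrable_add integrable_mult_right) (auto simp: mult.assoc)
  have deriv: "(?g has_vector_derivative ?F x) (at x)" for x
  proof -
    have "((\<lambda>x. exp (- pi * t * x\<^sup>2)) has_real_derivative (- 2 * pi * t * x * exp (- pi * t * x\<^sup>2))) (at x)"
      by (auto intro!: derivative_eq_intros)
    then have 1: "((\<lambda>x. complex_of_real (exp (- pi * t * x\<^sup>2))) has_vector_derivative
        complex_of_real (- 2 * pi * t * x * exp (- pi * t * x\<^sup>2))) (at x)"
      by (intro has_vector_derivative_of_real) (simp add: has_real_derivative_iff_has_vector_derivative)
    have "((\<lambda>z. exp (- \<i> * 2 * pi * (z * s))) has_field_derivative
        - \<i> * 2 * pi * s * exp (- \<i> * 2 * pi * (complex_of_real x * s))) (at (complex_of_real x))"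
      by (auto intro!: derivative_eq_intros)
    from has_vector_derivative_real_field[OF this, of UNIV]
    have 2: "((\<lambda>x. ek (x * s)) has_vector_derivative - \<i> * 2 * pi * s * ek (x * s)) (at x)"
      by (simp add: ek_def)
    show ?thesis
      using has_vector_derivative_mult[OF 1 2] by (simp add: algebra_simps)
  qed
  have lim: "(?g \<longlongrightarrow> 0) at_top" "(?g \<longlongrightarrow> 0) at_bot"
  proof -
    have sq: "filterlim (\<lambda>x::real. x\<^sup>2) at_top at_bot"
      by (rule filterlim_pow_at_bot_even) (auto simp: filterlim_ident)
    have "filterlim (\<lambda>x::real. x\<^sup>2) at_top at_top"
      by (rule filterlim_pow_at_top) (auto simp: filterlim_ident)
    note sq = sq this
    have *: "(?g \<longlongrightarrow> 0) F" if "filterlim (\<lambda>x::real. x\<^sup>2) at_top F" for F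
    proof (rule tendsto_norm_zero_cancel)
      have "filterlim (\<lambda>x. - pi * t * x\<^sup>2) at_bot F"
        using t by (intro filterlim_tendsto_neg_mult_at_bot[OF tendsto_const _ that]) simp
      then have "((\<lambda>x. exp (- pi * t * x\<^sup>2)) \<longlongrightarrow> 0) F"
        by (rule filterlim_compose[OF exp_at_bot])
      then show "((\<lambda>x. norm (?g x)) \<longlongrightarrow> 0) F"
        by (simp add: norm_mult)
    qed
    show "(?g \<longlongrightarrow> 0) at_top" "(?g \<longlongrightarrow> 0) at_bot"
      by (rule *[OF sq(2)], rule *[OF sq(1)])
  qed
  have "(LBINT x=-\<infinity>..\<infinity>. ?F x) = 0 - 0"
  proof (rule interval_integral_FTC_integrable)
    show "(?g has_vector_derivative ?F x) (at x)" for x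
      by (rule deriv)
    show "isCont ?F x" for x
      unfolding ek_def by (intro continuous_intros)
    show "set_integrable lborel (einterval (- \<infinity>) \<infinity>) ?F"
      using F by (simp add: set_integrable_def)
  qed (use lim in \<open>simp_all add: ereal_tendsto_simps\<close>)
  then have "(LINT x|lborel. ?F x) = 0"
    by (simp add: interval_lebesgue_integral_def set_lebesgue_integral_def)
  moreover have "(LINT x|lborel. ?F x) = - 2 * pi * t * (LINT x|lborel. ?h x) + (- 2 * pi * \<i> * s) * (LINT x|lborel. ?g x)"
    using g h by (subst Bochner_Integration.integral_add) (auto simp: mult.assoc)
  ultimately have 0: "- 2 * pi * t * (LINT x|lborel. ?h x) + (- 2 * pi * \<i> * s) * (LINT x|lborel. ?g x) = 0"
    by (simp only:)
  have gen: "H = - (B / A) * G" if "A * H + B * G = 0" "A \<noteq> 0" for A B G H :: complex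
    using that by (simp add: field_simps eq_neg_iff_add_eq_0)
  have q: "- ((- 2 * pi * \<i> * s) / (- 2 * pi * t)) = - \<i> * s / t"
    using t by (simp add: field_simps)
  have "complex_of_real (- 2 * pi * t) \<noteq> 0"
    using t by simp
  from gen[OF 0 this] have "(LINT x|lborel. ?h x) = - \<i> * s / t * (LINT x|lborel. ?g x)"
    unfolding q .
  then show "(LINT x|lborel. ?h x) = - \<i> * s / t * (exp (- pi * s\<^sup>2 / t) / sqrt t)"
    by (simp only: gauss_line[OF t])
qed

text \<open>Lebesgue measure on \<open>real ^ 3\<close> is the image of a product measure indexed by
  the basis vectors, so the coordinates have to be matched with the basis through
  \<open>axis\<close>.\<close>

lemma
  fixes f :: "3 \<Rightarrow> real \<Rightarrow> complex"
  assumes f: "\<And>i. integrable lborel (f i)"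
  shows lborel_vec_integrable_prod: "integrable lborel (\<lambda>x :: real^3. \<Prod>i\<in>UNIV. f i (x $ i))"
    and lborel_vec_integral_prod: "(LINT x|(lborel :: (real^3) measure). (\<Prod>i\<in>UNIV. f i (x $ i))) = (\<Prod>i\<in>UNIV. (LINT y|lborel. f i y))"
proof -
  interpret product_sigma_finite "\<lambda>_ :: real^3. lborel :: real measure"
    by standard
  let ?B = "Basis :: (real^3) set"
  let ?P = "\<Pi>\<^sub>M b\<in>?B. (lborel :: real measure)"
  let ?T = "\<lambda>h :: real^3 \<Rightarrow> real. \<Sum>b\<in>?B. h b *\<^sub>R b"
  have [measurable]: "f i \<in> borel_measurable borel" for i
    using f[of i] by auto
  have B: "?B = (\<lambda>i. axis i 1) ` UNIV"
    by (auto simp: Basis_vec_def)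
  have inj: "inj (\<lambda>i::3. axis i (1::real))"
    by (auto simp: inj_on_def axis_eq_axis)
  have T: "?T h $ i = h (axis i 1)" for h i
    unfolding B sum.reindex[OF inj]
    by (simp add: axis_def if_distrib if_distribR cong: if_cong)
  have pr: "(\<Prod>b\<in>?B. f (axis_index b) (h b)) = (\<Prod>i\<in>UNIV. f i (?T h $ i))" for h
  proof -
    have "(\<Prod>b\<in>?B. f (axis_index b) (h b)) = (\<Prod>i\<in>UNIV. f i (h (axis i 1)))"
      unfolding B prod.reindex[OF inj] by simp
    then show ?thesis by (simp only: T)
  qed
  have [measurable]: "?T \<in> measurable ?P borel"
    by measurable
  have m: "(\<lambda>x :: real^3. \<Prod>i\<in>UNIV. f i (x $ i)) \<in> borel_measurable borel"
    by measurable
  have "integrable ?P (\<lambda>h. \<Prod>b\<in>?B. f (axis_index b) (h b))"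
    using f by (intro product_integrable_prod) auto
  then show "integrable lborel (\<lambda>x :: real^3. \<Prod>i\<in>UNIV. f i (x $ i))"
    unfolding pr by (subst lborel_eq) (simp add: integrable_distr_eq m)
  have "(LINT x|(lborel :: (real^3) measure). (\<Prod>i\<in>UNIV. f i (x $ i))) = (LINT h|?P. (\<Prod>b\<in>?B. f (axis_index b) (h b)))"
    unfolding pr by (subst lborel_eq) (simp add: integral_distr m)
  also have "\<dots> = (\<Prod>b\<in>?B. (LINT y|lborel. f (axis_index b) y))"
    using f by (intro product_integral_prod) auto
  also have "\<dots> = (\<Prod>i\<in>UNIV. (LINT y|lborel. f i y))"
    unfolding B prod.reindex[OF inj] by simp
  finally show "(LINT x|(lborel :: (real^3) measure). (\<Prod>i\<in>UNIV. f i (x $ i))) = (\<Prod>i\<in>UNIV. (LINT y|lborel. f i y))" .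
qed

section \<open>Gaussians in three variables\<close>

definition gauss :: "real \<Rightarrow> real ^ 3 \<Rightarrow> real" where
  "gauss t x = exp (- pi * t * (norm x)\<^sup>2)"

lemma gauss_ek_prod: "gauss t x * ek (x \<bullet> \<xi>) = (\<Prod>i\<in>UNIV. exp (- pi * t * (x $ i)\<^sup>2) * ek (x $ i * \<xi> $ i))"
proof -
  have "gauss t x = (\<Prod>i\<in>UNIV. exp (- pi * t * (x $ i)\<^sup>2))"
    by (simp add: gauss_def norm_vec_def L2_set_def sum_nonneg sum_distrib_left exp_sum)
  moreover have "ek (x \<bullet> \<xi>) = (\<Prod>i\<in>UNIV. ek (x $ i * \<xi> $ i))"
    by (simp add: inner_vec_def ek_def sum_distrib_left exp_sum)
  ultimately show ?thesis
    by (simp only: prod.distrib of_real_prod)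
qed

lemma
  assumes t: "0 < t"
  shows gauss_ek_integrable: "integrable lborel (\<lambda>x. gauss t x * ek (x \<bullet> \<xi>))"
    and gauss_ek_integral: "(LINT x|lborel. gauss t x * ek (x \<bullet> \<xi>)) = gauss (1 / t) \<xi> / sqrt t ^ 3"
proof -
  note I = gauss_line_integrable[OF t]
  show "integrable lborel (\<lambda>x. gauss t x * ek (x \<bullet> \<xi>))"
    unfolding gauss_ek_prod by (intro lborel_vec_integrable_prod I)
  have "(LINT x|lborel. gauss t x * ek (x \<bullet> \<xi>)) = (\<Prod>i\<in>UNIV. complex_of_real (exp (- pi * (\<xi> $ i)\<^sup>2 / t) / sqrt t))"
    unfolding gauss_ek_prod by (subst lborel_vec_integral_prod[OF I]) (simp only: gauss_line[OF t])
  also have "\<dots> = gauss (1 / t) \<xi> / sqrt t ^ 3"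
    by (simp add: prod_dividef gauss_def norm_vec_def L2_set_def sum_nonneg sum_distrib_left exp_sum
      sum_divide_distrib flip: of_real_prod)
  finally show "(LINT x|lborel. gauss t x * ek (x \<bullet> \<xi>)) = gauss (1 / t) \<xi> / sqrt t ^ 3" .
qed

lemma gauss_integrable: "0 < t \<Longrightarrow> integrable lborel (gauss t)"
  using gauss_ek_integrable[of t 0, THEN integrable_Re] by simp

lemma gauss_integral: "0 < t \<Longrightarrow> (LINT x|lborel. gauss t x) = 1 / sqrt t ^ 3"
  using arg_cong[OF gauss_ek_integral[of t 0], of Re] gauss_ek_integrable[of t 0]
  by (simp add: gauss_def flip: integral_Re)

text \<open>The integrand still factors over the coordinates: the factor j carries the first moment,
  the others are plain Gaussians.\<close>

lemma
  assumes t: "0 < t"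
  shows gauss_moment_ek_integrable: "integrable lborel (\<lambda>x. x $ j * gauss t x * ek (x \<bullet> \<xi>))"
    and gauss_moment_ek_integral: "(LINT x|lborel. x $ j * gauss t x * ek (x \<bullet> \<xi>))
      = - \<i> * \<xi> $ j / t * (gauss (1 / t) \<xi> / sqrt t ^ 3)"
proof -
  let ?f = "\<lambda>i y. complex_of_real ((if i = j then y else 1) * exp (- pi * t * y\<^sup>2)) * ek (y * \<xi> $ i)"
  have f: "integrable lborel (?f i)" for i
    using gauss_line_integrable[OF t] gauss_line_moment_integrable[OF t] by (cases "i = j") simp_all
  have fi: "(LINT y|lborel. ?f i y) = (if i = j then - \<i> * \<xi> $ j / t else 1) * (exp (- pi * (\<xi> $ i)\<^sup>2 / t) / sqrt t)" for i
    using gauss_line[OF t] gauss_line_moment[OF t] by (cases "i = j") simp_all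
  have eq: "x $ j * gauss t x * ek (x \<bullet> \<xi>) = (\<Prod>i\<in>UNIV. ?f i (x $ i))" for x
  proof -
    have "(\<Prod>i\<in>UNIV. ?f i (x $ i)) = (\<Prod>i\<in>UNIV. (if i = j then complex_of_real (x $ i) else 1) *
        (exp (- pi * t * (x $ i)\<^sup>2) * ek (x $ i * \<xi> $ i)))"
      by (intro prod.cong) auto
    also have "\<dots> = x $ j * (gauss t x * ek (x \<bullet> \<xi>))"
      unfolding gauss_ek_prod prod.distrib[of "\<lambda>i. if i = j then complex_of_real (x $ i) else 1"] by simp
    finally show ?thesis by (simp add: mult.assoc)
  qed
  show "integrable lborel (\<lambda>x. x $ j * gauss t x * ek (x \<bullet> \<xi>))"
    unfolding eq by (intro lborel_vec_integrable_prod f)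
  have "(LINT x|lborel. x $ j * gauss t x * ek (x \<bullet> \<xi>))
      = (\<Prod>i\<in>UNIV. (if i = j then - \<i> * \<xi> $ j / t else 1) * complex_of_real (exp (- pi * (\<xi> $ i)\<^sup>2 / t) / sqrt t))"
    unfolding eq by (subst lborel_vec_integral_prod[OF f]) (simp only: fi)
  also have "\<dots> = (- \<i> * \<xi> $ j / t) * (\<Prod>i\<in>UNIV. complex_of_real (exp (- pi * (\<xi> $ i)\<^sup>2 / t) / sqrt t))"
    unfolding prod.distrib by simp
  also have "(\<Prod>i\<in>UNIV. complex_of_real (exp (- pi * (\<xi> $ i)\<^sup>2 / t) / sqrt t)) = gauss (1 / t) \<xi> / sqrt t ^ 3"
    by (simp add: prod_dividef gauss_def norm_vec_def L2_set_def sum_nonneg sum_distrib_left exp_sum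
      sum_divide_distrib flip: of_real_prod)
  finally show "(LINT x|lborel. x $ j * gauss t x * ek (x \<bullet> \<xi>))
      = - \<i> * \<xi> $ j / t * (gauss (1 / t) \<xi> / sqrt t ^ 3)" .
qed

section \<open>Iterated integrals and translations\<close>

lemma norm_smult: "norm (c *s v) = norm c * norm (v :: cl3)"
  by (simp add: norm_vec_def L2_set_def norm_mult power_mult_distrib real_sqrt_mult
      flip: sum_distrib_left)

lemma smult_scaleR: "(r *\<^sub>R c) *s v = r *\<^sub>R (c *s v)" "c *s (r *\<^sub>R v) = r *\<^sub>R (c *s (v :: cl3))"
  by (simp_all add: vec_eq_iff)

lemma of_real_smult: "complex_of_real r *s v = r *\<^sub>R (v :: cl3)"
  by (simp add: vec_eq_iff complex_eq_iff)

lemma bounded_bilinear_smult: "bounded_bilinear (\<lambda>(c :: complex) (v :: cl3). c *s v)"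
proof
  show "\<exists>K. \<forall>(c :: complex) (v :: cl3). norm (c *s v) \<le> norm c * norm v * K"
    by (intro exI[of _ 1]) (simp add: norm_smult)
qed (simp_all add: vec_eq_iff complex_eq_iff algebra_simps)

text \<open>The real inner product is the real part of the Hermitian one, so a complex scalar
  crosses over as its conjugate.\<close>

lemma inner_smult: "(c *s v) \<bullet> w = v \<bullet> (cnj c *s (w :: cl3))"
  by (simp add: inner_vec_def inner_complex_def algebra_simps)

lemma bounded_bilinear_cl_mult: "bounded_bilinear (\<odot>)"
proof -
  have "bilinear (\<odot>)"
    unfolding bilinear_def
    by (auto intro!: linearI simp: cl_bilinear simp flip: of_real_smult)
  then show ?thesis
    by (simp add: bilinear_conv_bounded_bilinear)
qed

lemma measurable_smult[measurable]:
  fixes f :: "'a \<Rightarrow> complex" and g :: "'a \<Rightarrow> cl3"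
  assumes "f \<in> borel_measurable M" "g \<in> borel_measurable M"
  shows "(\<lambda>x. f x *s g x) \<in> borel_measurable M"
  by (intro borel_measurable_continuous_Pair[OF assms]
      bounded_bilinear.continuous_on[OF bounded_bilinear_smult] continuous_intros)

lemma measurable_cl_mult[measurable]:
  fixes f g :: "'a \<Rightarrow> cl3"
  assumes "f \<in> borel_measurable M" "g \<in> borel_measurable M"
  shows "(\<lambda>x. f x \<odot> g x) \<in> borel_measurable M"
  by (intro borel_measurable_continuous_Pair[OF assms]
      bounded_bilinear.continuous_on[OF bounded_bilinear_cl_mult] continuous_intros)

text \<open>Absolute convergence is checked with the x-integral innermost, the order in which the
  estimates below are available.\<close>

lemma
  fixes \<Phi> :: "'a::euclidean_space \<Rightarrow> 'c::euclidean_space \<Rightarrow> 'b::{banach, second_countable_topology}"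
  assumes m: "(\<lambda>(x, y). \<Phi> x y) \<in> borel_measurable (lborel \<Otimes>\<^sub>M lborel)"
    and 1: "AE y in lborel. integrable lborel (\<lambda>x. \<Phi> x y)"
    and 2: "integrable lborel (\<lambda>y. LINT x|lborel. norm (\<Phi> x y))"
  shows Fubini_swap: "(LINT x|lborel. (LINT y|lborel. \<Phi> x y)) = (LINT y|lborel. (LINT x|lborel. \<Phi> x y))"
    and Fubini_integrable_iterated: "integrable lborel (\<lambda>x. LINT y|lborel. \<Phi> x y)"
    and Fubini_AE_integrable: "AE x in lborel. integrable lborel (\<lambda>y. \<Phi> x y)"
proof -
  have m': "(\<lambda>(y, x). \<Phi> x y) \<in> borel_measurable (lborel \<Otimes>\<^sub>M lborel)"
    using measurable_pair_swap[OF m] by (simp add: case_prod_beta)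
  have int: "integrable (lborel \<Otimes>\<^sub>M lborel) (\<lambda>(y, x). \<Phi> x y)"
    by (rule lborel_pair.Fubini_integrable) (use m' 1 2 in auto)
  show "(LINT x|lborel. (LINT y|lborel. \<Phi> x y)) = (LINT y|lborel. (LINT x|lborel. \<Phi> x y))"
    using lborel_pair.Fubini_integral[OF int] .
  show "integrable lborel (\<lambda>x. LINT y|lborel. \<Phi> x y)"
    using lborel_pair.integrable_snd[OF int] .
  show "AE x in lborel. integrable lborel (\<lambda>y. \<Phi> x y)"
    using lborel_pair.AE_integrable_snd[OF int] .
qed

lemma
  fixes f :: "real^3 \<Rightarrow> 'b::{banach, second_countable_topology}"
  assumes c: "c \<noteq> 0"
  shows lborel_integrable_affine3: "integrable lborel f \<Longrightarrow> integrable lborel (\<lambda>x. f (t + c *\<^sub>R x))"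
    and lborel_integral_affine3: "integrable lborel f \<Longrightarrow> (LINT x|lborel. f (t + c *\<^sub>R x)) = (1 / \<bar>c\<bar>^3) *\<^sub>R (LINT x|lborel. f x)"
proof -
  let ?T = "\<lambda>x::real^3. t + c *\<^sub>R x"
  assume f: "integrable lborel f"
  then have [measurable]: "f \<in> borel_measurable borel"
    by auto
  have L: "lborel = density (distr lborel borel ?T) (\<lambda>_. ennreal (\<bar>c\<bar>^3))"
    using lborel_affine[OF c, of t] by simp
  have "integrable (density (distr lborel borel ?T) (\<lambda>_. ennreal (\<bar>c\<bar>^3))) f"
    using f L by simp
  then have "integrable lborel (\<lambda>x. (\<bar>c\<bar>^3) *\<^sub>R f (?T x))"
    by (subst (asm) integrable_density) (auto simp: integrable_distr_eq)
  from integrable_scaleR_right[OF this, of "1 / \<bar>c\<bar>^3"]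
  show "integrable lborel (\<lambda>x. f (?T x))"
    using c by simp
  have "(LINT x|lborel. f x) = integral\<^sup>L (density (distr lborel borel ?T) (\<lambda>_. ennreal (\<bar>c\<bar>^3))) f"
    by (subst L) simp
  also have "\<dots> = (\<bar>c\<bar>^3) *\<^sub>R (LINT x|lborel. f (?T x))"
    by (subst integral_density) (auto simp: integral_distr)
  finally show "(LINT x|lborel. f (?T x)) = (1 / \<bar>c\<bar>^3) *\<^sub>R (LINT x|lborel. f x)"
    using c by simp
qed

lemma
  fixes f :: "real^3 \<Rightarrow> 'b::{banach, second_countable_topology}"
  assumes "integrable lborel f"
  shows lborel_integrable_shift: "integrable lborel (\<lambda>x. f (x + a))" "integrable lborel (\<lambda>x. f (x - a))"
    "integrable lborel (\<lambda>x. f (a - x))"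
    and lborel_integral_shift: "(LINT x|lborel. f (x + a)) = (LINT x|lborel. f x)"
    "(LINT x|lborel. f (x - a)) = (LINT x|lborel. f x)"
    "(LINT x|lborel. f (a - x)) = (LINT x|lborel. f x)"
  using lborel_integrable_affine3[OF _ assms, of 1 a] lborel_integrable_affine3[OF _ assms, of 1 "-a"]
    lborel_integrable_affine3[OF _ assms, of "-1" a]
    lborel_integral_affine3[OF _ assms, of 1 a] lborel_integral_affine3[OF _ assms, of 1 "-a"]
    lborel_integral_affine3[OF _ assms, of "-1" a]
  by (simp_all add: add.commute)

lemma
  fixes f :: "real ^ 3 \<Rightarrow> 'b::euclidean_space"
  assumes f: "f \<in> L2"
  shows L2_shift: "(\<lambda>x. f (x + a)) \<in> L2" "(\<lambda>x. f (x - a)) \<in> L2" "(\<lambda>x. f (a - x)) \<in> L2"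
    and N2_shift: "N2 (\<lambda>x. f (x + a)) = N2 f" "N2 (\<lambda>x. f (x - a)) = N2 f" "N2 (\<lambda>x. f (a - x)) = N2 f"
proof -
  have [measurable]: "f \<in> borel_measurable borel"
    using f by auto
  show "(\<lambda>x. f (x + a)) \<in> L2" "(\<lambda>x. f (x - a)) \<in> L2" "(\<lambda>x. f (a - x)) \<in> L2"
    using lborel_integrable_shift[OF L2_integrable[OF f], of a] by (simp_all add: L2_iff)
  show "N2 (\<lambda>x. f (x + a)) = N2 f" "N2 (\<lambda>x. f (x - a)) = N2 f" "N2 (\<lambda>x. f (a - x)) = N2 f"
    using lborel_integral_shift[OF L2_integrable[OF f], of a] by (simp_all add: N2_def)
qed

section \<open>Continuity of translations and autocorrelation\<close>

lemma test_fun_shift_continuous: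
  fixes g :: "real ^ 3 \<Rightarrow> 'b::euclidean_space"
  assumes g: "test_fun g" and z: "z \<longlonglongrightarrow> 0"
  shows "(\<lambda>n. N2 (\<lambda>x. g (x + z n) - g x)) \<longlonglongrightarrow> 0"
proof -
  obtain R where R: "\<And>x. R < norm x \<Longrightarrow> g x = 0" and cont: "continuous_on UNIV g"
    using g by (auto simp: test_fun_def)
  obtain C where C: "0 \<le> C" "\<And>x. norm (g x) \<le> C"
    using test_fun_bounded[OF g] by metis
  obtain B where B: "0 < B" "\<And>n. norm (z n) \<le> B"
    using z convergent_imp_Bseq[of z] by (auto simp: convergent_def Bseq_def)
  have [measurable]: "g \<in> borel_measurable borel"
    using test_fun_L2[OF g] by auto
  show ?thesis
  proof (rule N2_tendsto_dominated)
    show "(\<lambda>x::real^3. indicator (cball 0 (R + B)) x *\<^sub>R (2 * C)) \<in> L2"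
      by (intro L2_indicator) (auto intro: emeasure_bounded_finite simp flip: infinity_ennreal_def)
    have "norm (g (x + z n) - g x) \<le> 1 * norm (indicator (cball 0 (R + B)) x *\<^sub>R (2 * C))" for x n
    proof (cases "norm x \<le> R + B")
      case True
      have "norm (g (x + z n) - g x) \<le> 2 * C"
        using norm_triangle_ineq4[of "g (x + z n)" "g x"] C(2)[of x] C(2)[of "x + z n"] by linarith
      then show ?thesis using True C(1) by (simp add: indicator_def)
    next
      case False
      have "R < norm x" "R < norm (x + z n)"
        using False B(1) B(2)[of n] norm_triangle_ineq4[of "x + z n" "z n"] by auto
      then show ?thesis using R[of x] R[of "x + z n"] by simp
    qed
    then show "AE x in lborel. norm (g (x + z n) - g x) \<le> 1 * norm (indicator (cball 0 (R + B)) x *\<^sub>R (2 * C))" for n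
      by (intro AE_I2)
    have "(\<lambda>n. g (x + z n) - g x) \<longlonglongrightarrow> g x - g x" for x
    proof (intro tendsto_diff tendsto_const)
      have "(\<lambda>n. x + z n) \<longlonglongrightarrow> x"
        using tendsto_add[OF tendsto_const z, of x] by simp
      then show "(\<lambda>n. g (x + z n)) \<longlonglongrightarrow> g x"
        using cont by (intro isCont_tendsto_compose[of x g]) (auto simp: continuous_on_eq_continuous_at)
    qed
    then show "AE x in lborel. (\<lambda>n. g (x + z n) - g x) \<longlonglongrightarrow> 0"
      by simp
  qed measurable
qed

text \<open>Density carries the result over from test functions: since translations are isometries,
  the approximation error is the same before and after the shift.\<close>

lemma L2_shift_continuous:
  fixes f :: "real ^ 3 \<Rightarrow> 'b::euclidean_space"
  assumes f: "f \<in> L2" and z: "z \<longlonglongrightarrow> 0"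
  shows "(\<lambda>n. N2 (\<lambda>x. f (x + z n) - f x)) \<longlonglongrightarrow> 0"
proof (rule LIMSEQ_I)
  fix e :: real assume e: "0 < e"
  then obtain g where g: "test_fun g" "N2 (\<lambda>x. f x - g x) < e / 3"
    using L2_dense[OF f, of "e / 3"] by auto
  have gL: "g \<in> L2"
    using test_fun_L2[OF g(1)] .
  obtain N where N: "\<And>n. n \<ge> N \<Longrightarrow> norm (N2 (\<lambda>x. g (x + z n) - g x)) < e / 3"
    using LIMSEQ_D[OF test_fun_shift_continuous[OF g(1) z], of "e / 3"] e by auto
  show "\<exists>no. \<forall>n\<ge>no. norm (N2 (\<lambda>x. f (x + z n) - f x) - 0) < e"
  proof (intro exI[of _ N] allI impI)
    fix n assume n: "N \<le> n"
    have 1: "N2 (\<lambda>x. f (x + z n) - g (x + z n)) = N2 (\<lambda>x. f x - g x)"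
      using N2_shift(1)[OF L2_diff[OF f gL], of "z n"] .
    have "N2 (\<lambda>x. f (x + z n) - f x) \<le> N2 (\<lambda>x. f (x + z n) - g (x + z n)) + N2 (\<lambda>x. g (x + z n) - f x)"
      by (intro N2_triangle_diff L2_shift f gL)
    also have "N2 (\<lambda>x. g (x + z n) - f x) \<le> N2 (\<lambda>x. g (x + z n) - g x) + N2 (\<lambda>x. g x - f x)"
      by (intro N2_triangle_diff L2_shift f gL)
    finally have "N2 (\<lambda>x. f (x + z n) - f x) < e"
      using 1 g(2) N[OF n] N2_commute[of f g] by simp
    then show "norm (N2 (\<lambda>x. f (x + z n) - f x) - 0) < e"
      using N2_nonneg[of "\<lambda>x. f (x + z n) - f x"] by simp
  qed
qed

lemma inner_L2_integrable:
  fixes f g :: "real ^ 3 \<Rightarrow> 'b::euclidean_space"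
  assumes "f \<in> L2" "g \<in> L2"
  shows "integrable lborel (\<lambda>x. f x \<bullet> g x)"
proof (rule Bochner_Integration.integrable_bound[OF norm_mult_integrable[OF assms]])
  have [measurable]: "f \<in> borel_measurable borel" "g \<in> borel_measurable borel"
    using assms by auto
  show "(\<lambda>x. f x \<bullet> g x) \<in> borel_measurable lborel" by measurable
qed (simp add: Cauchy_Schwarz_ineq2)

lemma inner_L2_le:
  fixes f g :: "real ^ 3 \<Rightarrow> 'b::euclidean_space"
  assumes "f \<in> L2" "g \<in> L2"
  shows "\<bar>LINT x|lborel. f x \<bullet> g x\<bar> \<le> N2 f * N2 g" "(LINT x|lborel. \<bar>f x \<bullet> g x\<bar>) \<le> N2 f * N2 g"
proof -
  show 2: "(LINT x|lborel. \<bar>f x \<bullet> g x\<bar>) \<le> N2 f * N2 g"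
    by (rule order_trans[OF integral_mono Cauchy_Schwarz_N2[OF assms]])
      (simp_all add: Cauchy_Schwarz_ineq2 norm_mult_integrable assms inner_L2_integrable)
  show "\<bar>LINT x|lborel. f x \<bullet> g x\<bar> \<le> N2 f * N2 g"
    using integral_abs_bound[of lborel "\<lambda>x. f x \<bullet> g x"] 2 by linarith
qed

text \<open>At shift 0 the autocorrelation is the squared norm, and Cauchy-Schwarz bounds the error
  by the continuity of translations. This evaluates the limit in Plancherel's theorem.\<close>

lemma autocorrelation_tendsto:
  fixes f :: "real ^ 3 \<Rightarrow> 'b::euclidean_space"
  assumes f: "f \<in> L2" and z: "z \<longlonglongrightarrow> 0"
  shows "(\<lambda>n. LINT y|lborel. f (y + z n) \<bullet> f y) \<longlonglongrightarrow> (N2 f)\<^sup>2"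
proof -
  have "(\<lambda>n. (LINT y|lborel. f (y + z n) \<bullet> f y) - (N2 f)\<^sup>2) \<longlonglongrightarrow> 0"
  proof (rule Lim_null_comparison)
    show "(\<lambda>n. N2 (\<lambda>x. f (x + z n) - f x) * N2 f) \<longlonglongrightarrow> 0"
      using tendsto_mult_right[OF L2_shift_continuous[OF f z], of "N2 f"] by simp
    have "\<bar>(LINT y|lborel. f (y + z n) \<bullet> f y) - (N2 f)\<^sup>2\<bar> \<le> N2 (\<lambda>x. f (x + z n) - f x) * N2 f" for n
    proof -
      have "(LINT y|lborel. (f (y + z n) - f y) \<bullet> f y) = (LINT y|lborel. f (y + z n) \<bullet> f y) - (N2 f)\<^sup>2"
        unfolding N2_square inner_diff_left dot_square_norm[symmetric]
        by (intro Bochner_Integration.integral_diff inner_L2_integrable L2_shift f)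
      then show ?thesis
        using inner_L2_le(1)[OF L2_diff[OF L2_shift(1)[OF f, of "z n"] f] f] by simp
    qed
    then show "\<forall>\<^sub>F n in sequentially. norm ((LINT y|lborel. f (y + z n) \<bullet> f y) - (N2 f)\<^sup>2)
        \<le> N2 (\<lambda>x. f (x + z n) - f x) * N2 f"
      by simp
  qed
  from tendsto_add[OF this tendsto_const[of "(N2 f)\<^sup>2"]] show ?thesis by simp
qed

section \<open>The Fourier transform and Plancherel's theorem\<close>

definition ft :: "(real ^ 3 \<Rightarrow> cl3) \<Rightarrow> real ^ 3 \<Rightarrow> cl3" where
  "ft f \<xi> = (LINT x|lborel. ek (x \<bullet> \<xi>) *s f x)"

lemma ft_integrable:
  fixes f :: "real ^ 3 \<Rightarrow> cl3"
  assumes f: "integrable lborel f"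
  shows "integrable lborel (\<lambda>x. ek (x \<bullet> \<xi>) *s f x)"
proof -
  have [measurable]: "f \<in> borel_measurable borel"
    using f by auto
  show ?thesis
    by (rule Bochner_Integration.integrable_bound[OF f]) (simp_all add: norm_smult)
qed

lemma norm_ft_le:
  assumes f: "integrable lborel f"
  shows "norm (ft f \<xi>) \<le> (LINT x|lborel. norm (f x))"
  unfolding ft_def using integral_norm_bound[of lborel "\<lambda>x. ek (x \<bullet> \<xi>) *s f x"]
  by (simp add: norm_smult)

lemma measurable_ft[measurable]:
  assumes [measurable]: "f \<in> borel_measurable borel"
  shows "ft f \<in> borel_measurable borel"
  unfolding ft_def by measurable

text \<open>The transform of \<open>gauss t\<close>: a Gaussian of mass 1 that concentrates at the
  origin as t \<rightarrow> 0.\<close>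

definition gauss_hat :: "real \<Rightarrow> real ^ 3 \<Rightarrow> real" where
  "gauss_hat t z = gauss (1 / t) z / sqrt t ^ 3"

lemma measurable_gauss[measurable]: "gauss t \<in> borel_measurable borel" "gauss_hat t \<in> borel_measurable borel"
  unfolding gauss_def[abs_def] gauss_hat_def by measurable

lemma gauss_nonneg[simp]: "0 \<le> gauss t x" and gauss_le_1: "0 \<le> t \<Longrightarrow> gauss t x \<le> 1"
  by (simp_all add: gauss_def)

lemma gauss_hat_integrable: "0 < t \<Longrightarrow> integrable lborel (gauss_hat t)"
  unfolding gauss_hat_def by (intro integrable_divide gauss_integrable) auto

lemma gauss_hat_nonneg: "0 < t \<Longrightarrow> 0 \<le> gauss_hat t x"
  by (simp add: gauss_hat_def)

lemma gauss_hat_bound: "0 < t \<Longrightarrow> gauss_hat t x \<le> 1 / sqrt t ^ 3"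
  using gauss_le_1[of "1/t" x] by (simp add: gauss_hat_def divide_right_mono)

text \<open>Both sides are integrated against \<open>gauss t\<close> to make the double integrals absolutely convergent.\<close>
lemma gauss_ft_square:
  assumes f: "integrable lborel f" and fL: "f \<in> L2" and t: "0 < t"
  shows "(LINT \<xi>|lborel. gauss t \<xi> * (norm (ft f \<xi>))\<^sup>2)
    = (LINT z|lborel. gauss_hat t z * (LINT y|lborel. f (y + z) \<bullet> f y))"
proof -
  have [measurable]: "f \<in> borel_measurable borel"
    using f by auto
  let ?n = "LINT x|lborel. norm (f x)"
  have nf: "integrable lborel (\<lambda>x. norm (f x))"
    using f by simp
  have g: "integrable lborel (gauss t)"
    using gauss_integrable[OF t] .
  have "(LINT \<xi>|lborel. gauss t \<xi> * (norm (ft f \<xi>))\<^sup>2)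
      = (LINT \<xi>|lborel. (LINT y|lborel. (gauss t \<xi> *\<^sub>R ft f \<xi>) \<bullet> (ek (y \<bullet> \<xi>) *s f y)))"
  proof (rule Bochner_Integration.integral_cong[OF refl])
    fix \<xi>
    have "(LINT y|lborel. (gauss t \<xi> *\<^sub>R ft f \<xi>) \<bullet> (ek (y \<bullet> \<xi>) *s f y)) = (gauss t \<xi> *\<^sub>R ft f \<xi>) \<bullet> ft f \<xi>"
      unfolding ft_def[of f \<xi>] by (intro integral_inner_right ft_integrable f)
    then show "gauss t \<xi> * (norm (ft f \<xi>))\<^sup>2 = (LINT y|lborel. (gauss t \<xi> *\<^sub>R ft f \<xi>) \<bullet> (ek (y \<bullet> \<xi>) *s f y))"
      by (simp only: inner_scaleR_left dot_square_norm)
  qed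
  \<comment> \<open>The transform \<open>ft f\<close> is bounded by the L^1 norm \<open>?n\<close>
    of f, so the Gaussian weight supplies integrability in \<xi> and f supplies it in y.\<close>
  also have "\<dots> = (LINT y|lborel. (LINT \<xi>|lborel. (gauss t \<xi> *\<^sub>R ft f \<xi>) \<bullet> (ek (y \<bullet> \<xi>) *s f y)))"
  proof (rule Fubini_swap)
    have le: "\<bar>(gauss t \<xi> *\<^sub>R ft f \<xi>) \<bullet> (ek (y \<bullet> \<xi>) *s f y)\<bar> \<le> gauss t \<xi> * (?n * norm (f y))" for \<xi> y
    proof -
      have "\<bar>(gauss t \<xi> *\<^sub>R ft f \<xi>) \<bullet> (ek (y \<bullet> \<xi>) *s f y)\<bar> \<le> norm (gauss t \<xi> *\<^sub>R ft f \<xi>) * norm (ek (y \<bullet> \<xi>) *s f y)"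
        by (rule Cauchy_Schwarz_ineq2)
      also have "\<dots> = gauss t \<xi> * (norm (ft f \<xi>) * norm (f y))"
        by (simp add: norm_smult)
      also have "\<dots> \<le> gauss t \<xi> * (?n * norm (f y))"
        by (intro mult_left_mono mult_right_mono norm_ft_le f) auto
      finally show ?thesis .
    qed
    show "(\<lambda>(\<xi>, y). (gauss t \<xi> *\<^sub>R ft f \<xi>) \<bullet> (ek (y \<bullet> \<xi>) *s f y)) \<in> borel_measurable (lborel \<Otimes>\<^sub>M lborel)"
      by measurable
    have int: "integrable lborel (\<lambda>\<xi>. (gauss t \<xi> *\<^sub>R ft f \<xi>) \<bullet> (ek (y \<bullet> \<xi>) *s f y))" for y
    proof (rule Bochner_Integration.integrable_bound)
      show "integrable lborel (\<lambda>\<xi>. gauss t \<xi> * (?n * norm (f y)))"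
        using g by (rule integrable_mult_left)
      show "AE \<xi> in lborel. norm ((gauss t \<xi> *\<^sub>R ft f \<xi>) \<bullet> (ek (y \<bullet> \<xi>) *s f y)) \<le> norm (gauss t \<xi> * (?n * norm (f y)))"
        by (intro AE_I2) (simp only: real_norm_def, rule order_trans[OF le abs_ge_self])
    qed measurable
    then show "AE y in lborel. integrable lborel (\<lambda>\<xi>. (gauss t \<xi> *\<^sub>R ft f \<xi>) \<bullet> (ek (y \<bullet> \<xi>) *s f y))"
      by simp
    show "integrable lborel (\<lambda>y. LINT \<xi>|lborel. norm ((gauss t \<xi> *\<^sub>R ft f \<xi>) \<bullet> (ek (y \<bullet> \<xi>) *s f y)))"
    proof (rule Bochner_Integration.integrable_bound)
      show "integrable lborel (\<lambda>y. integral\<^sup>L lborel (gauss t) * ?n * norm (f y))"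
        using nf by (rule integrable_mult_right)
      have "(LINT \<xi>|lborel. norm ((gauss t \<xi> *\<^sub>R ft f \<xi>) \<bullet> (ek (y \<bullet> \<xi>) *s f y)))
          \<le> (LINT \<xi>|lborel. gauss t \<xi> * (?n * norm (f y)))" for y
        unfolding real_norm_def by (intro integral_mono integrable_abs int le integrable_mult_left g)
      then show "AE y in lborel. norm (LINT \<xi>|lborel. norm ((gauss t \<xi> *\<^sub>R ft f \<xi>) \<bullet> (ek (y \<bullet> \<xi>) *s f y)))
          \<le> norm (integral\<^sup>L lborel (gauss t) * ?n * norm (f y))"
        by (intro AE_I2) (simp add: abs_of_nonneg order_trans[OF _ abs_ge_self] mult.assoc)
    qed measurable
  qed
  also have "\<dots> = (LINT y|lborel. (LINT x|lborel. gauss_hat t (x - y) *\<^sub>R f x) \<bullet> f y)"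
  proof (rule Bochner_Integration.integral_cong[OF refl])
    fix y
    have gft: "integrable lborel (\<lambda>\<xi>. gauss t \<xi> *\<^sub>R (ek (- (y \<bullet> \<xi>)) *s ft f \<xi>))"
    proof (rule Bochner_Integration.integrable_bound)
      show "integrable lborel (\<lambda>\<xi>. gauss t \<xi> * ?n)"
        using g by (rule integrable_mult_left)
      show "AE \<xi> in lborel. norm (gauss t \<xi> *\<^sub>R (ek (- (y \<bullet> \<xi>)) *s ft f \<xi>)) \<le> norm (gauss t \<xi> * ?n)"
        by (intro AE_I2) (simp add: norm_smult mult_left_mono norm_ft_le[OF f])
    qed measurable
    have "(LINT \<xi>|lborel. (gauss t \<xi> *\<^sub>R ft f \<xi>) \<bullet> (ek (y \<bullet> \<xi>) *s f y))
        = (LINT \<xi>|lborel. (gauss t \<xi> *\<^sub>R (ek (- (y \<bullet> \<xi>)) *s ft f \<xi>)) \<bullet> f y)"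
      by (intro Bochner_Integration.integral_cong refl) (simp add: inner_smult cnj_ek)
    also have "\<dots> = (LINT \<xi>|lborel. gauss t \<xi> *\<^sub>R (ek (- (y \<bullet> \<xi>)) *s ft f \<xi>)) \<bullet> f y"
      by (intro integral_inner_left gft)
    \<comment> \<open>The inner transform is opened so that the \<xi>-integral acts on the Gaussian
      alone and produces \<open>gauss_hat\<close> at x - y.\<close>
    also have "(LINT \<xi>|lborel. gauss t \<xi> *\<^sub>R (ek (- (y \<bullet> \<xi>)) *s ft f \<xi>))
        = (LINT \<xi>|lborel. (LINT x|lborel. (gauss t \<xi> * ek (\<xi> \<bullet> (x - y))) *s f x))"
    proof (rule Bochner_Integration.integral_cong[OF refl])
      fix \<xi>
      have "gauss t \<xi> *\<^sub>R (ek (- (y \<bullet> \<xi>)) *s ft f \<xi>) = (LINT x|lborel. (gauss t \<xi> *\<^sub>R ek (- (y \<bullet> \<xi>))) *s (ek (x \<bullet> \<xi>) *s f x))"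
        unfolding ft_def smult_scaleR(1)[symmetric]
        by (intro integral_bounded_linear[symmetric] bounded_bilinear.bounded_linear_right[OF bounded_bilinear_smult] ft_integrable f)
      also have "\<dots> = (LINT x|lborel. (gauss t \<xi> * ek (\<xi> \<bullet> (x - y))) *s f x)"
        by (intro Bochner_Integration.integral_cong refl)
          (simp add: scaleR_conv_of_real vector_smult_assoc inner_diff_right inner_commute mult.assoc flip: ek_add)
      finally show "gauss t \<xi> *\<^sub>R (ek (- (y \<bullet> \<xi>)) *s ft f \<xi>) = (LINT x|lborel. (gauss t \<xi> * ek (\<xi> \<bullet> (x - y))) *s f x)" .
    qed
    also have "\<dots> = (LINT x|lborel. (LINT \<xi>|lborel. (gauss t \<xi> * ek (\<xi> \<bullet> (x - y))) *s f x))"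
    proof (rule Fubini_swap)
      have n: "norm ((gauss t \<xi> * ek (\<xi> \<bullet> (x - y))) *s f x) = gauss t \<xi> * norm (f x)" for \<xi> x
        by (simp add: norm_smult norm_mult)
      show "(\<lambda>(\<xi>, x). (gauss t \<xi> * ek (\<xi> \<bullet> (x - y))) *s f x) \<in> borel_measurable (lborel \<Otimes>\<^sub>M lborel)"
        by measurable
      have "integrable lborel (\<lambda>\<xi>. (gauss t \<xi> * ek (\<xi> \<bullet> (x - y))) *s f x)" for x
        by (intro integrable_bounded_linear[OF bounded_bilinear.bounded_linear_left[OF bounded_bilinear_smult]]
            gauss_ek_integrable[OF t])
      then show "AE x in lborel. integrable lborel (\<lambda>\<xi>. (gauss t \<xi> * ek (\<xi> \<bullet> (x - y))) *s f x)"
        by simp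
      show "integrable lborel (\<lambda>x. LINT \<xi>|lborel. norm ((gauss t \<xi> * ek (\<xi> \<bullet> (x - y))) *s f x))"
        unfolding n using nf by simp
    qed
    also have "\<dots> = (LINT x|lborel. gauss_hat t (x - y) *\<^sub>R f x)"
    proof (rule Bochner_Integration.integral_cong[OF refl])
      fix x
      have "(LINT \<xi>|lborel. (gauss t \<xi> * ek (\<xi> \<bullet> (x - y))) *s f x) = (LINT \<xi>|lborel. gauss t \<xi> * ek (\<xi> \<bullet> (x - y))) *s f x"
        by (intro integral_bounded_linear bounded_bilinear.bounded_linear_left[OF bounded_bilinear_smult] gauss_ek_integrable t)
      also have "\<dots> = gauss_hat t (x - y) *\<^sub>R f x"
        unfolding gauss_ek_integral[OF t] gauss_hat_def of_real_smult[symmetric] by simp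
      finally show "(LINT \<xi>|lborel. (gauss t \<xi> * ek (\<xi> \<bullet> (x - y))) *s f x) = gauss_hat t (x - y) *\<^sub>R f x" .
    qed
    finally show "(LINT \<xi>|lborel. (gauss t \<xi> *\<^sub>R ft f \<xi>) \<bullet> (ek (y \<bullet> \<xi>) *s f y))
        = (LINT x|lborel. gauss_hat t (x - y) *\<^sub>R f x) \<bullet> f y" .
  qed
  also have "\<dots> = (LINT y|lborel. (LINT z|lborel. gauss_hat t z * (f (y + z) \<bullet> f y)))"
  proof (rule Bochner_Integration.integral_cong[OF refl])
    fix y
    have int: "integrable lborel (\<lambda>x. gauss_hat t (x - y) *\<^sub>R f x)"
    proof (rule Bochner_Integration.integrable_bound)
      show "integrable lborel (\<lambda>x. (1 / sqrt t ^ 3) * norm (f x))"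
        using nf by (rule integrable_mult_right)
      show "AE x in lborel. norm (gauss_hat t (x - y) *\<^sub>R f x) \<le> norm ((1 / sqrt t ^ 3) * norm (f x))"
        using t gauss_hat_bound[OF t] gauss_hat_nonneg[OF t]
        by (intro AE_I2) (simp add: abs_mult mult_right_mono del: times_divide_eq_left mult_1_left)
    qed measurable
    from lborel_integral_shift(1)[OF int, of y] lborel_integrable_shift(1)[OF int, of y]
    have "(LINT x|lborel. gauss_hat t (x - y) *\<^sub>R f x) = (LINT z|lborel. gauss_hat t z *\<^sub>R f (z + y))"
      "integrable lborel (\<lambda>z. gauss_hat t z *\<^sub>R f (z + y))"
      by simp_all
    then show "(LINT x|lborel. gauss_hat t (x - y) *\<^sub>R f x) \<bullet> f y = (LINT z|lborel. gauss_hat t z * (f (y + z) \<bullet> f y))"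
      by (simp add: integral_inner_left[symmetric] add.commute del: integral_inner_left)
  qed
  also have "\<dots> = (LINT z|lborel. (LINT y|lborel. gauss_hat t z * (f (y + z) \<bullet> f y)))"
  proof (rule Fubini_swap)
    show "(\<lambda>(y, z). gauss_hat t z * (f (y + z) \<bullet> f y)) \<in> borel_measurable (lborel \<Otimes>\<^sub>M lborel)"
      by measurable
    have int: "integrable lborel (\<lambda>y. f (y + z) \<bullet> f y)" for z
      by (intro inner_L2_integrable L2_shift fL)
    then show "AE z in lborel. integrable lborel (\<lambda>y. gauss_hat t z * (f (y + z) \<bullet> f y))"
      by simp
    show "integrable lborel (\<lambda>z. LINT y|lborel. norm (gauss_hat t z * (f (y + z) \<bullet> f y)))"
    proof (rule Bochner_Integration.integrable_bound)
      show "integrable lborel (\<lambda>z. gauss_hat t z * (N2 f * N2 f))"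
        using gauss_hat_integrable[OF t] by (rule integrable_mult_left)
      have "(LINT y|lborel. norm (gauss_hat t z * (f (y + z) \<bullet> f y))) \<le> gauss_hat t z * (N2 f * N2 f)" for z
        using inner_L2_le(2)[OF L2_shift(1)[OF fL, of z] fL] gauss_hat_nonneg[OF t, of z]
        by (simp add: abs_mult N2_shift[OF fL] mult_left_mono)
      then show "AE z in lborel. norm (LINT y|lborel. norm (gauss_hat t z * (f (y + z) \<bullet> f y))) \<le> norm (gauss_hat t z * (N2 f * N2 f))"
        by (intro AE_I2) (simp only: real_norm_def abs_of_nonneg[OF Bochner_Integration.integral_nonneg[OF abs_ge_zero]]
            order_trans[OF _ abs_ge_self])
    qed measurable
  qed
  finally show ?thesis by simp
qed

lemma L2_lim_N2:
  assumes "L2_lim F \<phi> g"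
  shows "((\<lambda>t. N2 (F t)) \<longlongrightarrow> N2 g) \<phi>"
proof -
  have "((\<lambda>t. N2 (F t) - N2 g) \<longlongrightarrow> 0) \<phi>"
  proof (rule Lim_null_comparison)
    show "((\<lambda>t. N2 (\<lambda>x. F t x - g x)) \<longlongrightarrow> 0) \<phi>"
      using assms by (simp add: L2_lim_iff)
    show "\<forall>\<^sub>F t in \<phi>. norm (N2 (F t) - N2 g) \<le> N2 (\<lambda>x. F t x - g x)"
      using assms unfolding L2_lim_iff
    proof (elim conjE, elim eventually_mono)
      fix t assume "F t \<in> L2" "g \<in> L2"
      then show "norm (N2 (F t) - N2 g) \<le> N2 (\<lambda>x. F t x - g x)"
        using N2_le_diff[of "F t" g] N2_le_diff[of g "F t"] N2_commute[of "F t" g] by auto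
    qed
  qed
  from tendsto_add[OF this tendsto_const[of "N2 g"]] show ?thesis by simp
qed

text \<open>Plancherel: let t \<rightarrow> 0 in \<open>gauss_ft_square\<close>. The left side
  increases to the squared norm of the transform; the right side averages the autocorrelation
  against a Gaussian of mass 1 shrinking to the origin.\<close>

lemma
  assumes f: "integrable lborel f" and fL: "f \<in> L2"
  shows ft_L2: "ft f \<in> L2" and N2_ft: "N2 (ft f) = N2 f"
proof -
  have [measurable]: "f \<in> borel_measurable borel"
    using f by auto
  define A where "A z = (LINT y|lborel. f (y + z) \<bullet> f y)" for z
  have [measurable]: "A \<in> borel_measurable borel"
    unfolding A_def by measurable
  have A: "\<bar>A z\<bar> \<le> (N2 f)\<^sup>2" for z
    unfolding A_def using inner_L2_le(1)[OF L2_shift(1)[OF fL, of z] fL]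
    by (simp add: N2_shift[OF fL] power2_eq_square)
  define t where "t n = 1 / (real n + 1)" for n
  have t: "0 < t n" for n
    by (simp add: t_def)
  define u where "u n \<xi> = gauss (t n) \<xi> * (norm (ft f \<xi>))\<^sup>2" for n \<xi>
  have tz: "(\<lambda>n. t n) \<longlonglongrightarrow> 0"
    using LIMSEQ_inverse_real_of_nat by (simp add: t_def inverse_eq_divide add.commute)
  have int: "integrable lborel (u n)" for n
  proof (rule Bochner_Integration.integrable_bound)
    show "integrable lborel (\<lambda>\<xi>. gauss (t n) \<xi> * (LINT x|lborel. norm (f x))\<^sup>2)"
      using gauss_integrable[OF t] by (rule integrable_mult_left)
    show "AE \<xi> in lborel. norm (u n \<xi>) \<le> norm (gauss (t n) \<xi> * (LINT x|lborel. norm (f x))\<^sup>2)"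
      by (intro AE_I2) (simp add: u_def abs_mult mult_left_mono power_mono norm_ft_le[OF f])
  qed (simp add: u_def[abs_def])
  \<comment> \<open>The dilation z = \<open>sqrt (t n)\<close> x moves t from the Gaussian into the
    argument of A, which leaves a fixed majorant for dominated convergence.\<close>
  have ui: "integral\<^sup>L lborel (u n) = (LINT x|lborel. gauss 1 x * A (sqrt (t n) *\<^sub>R x))" for n
  proof -
    have s: "sqrt (t n) \<noteq> 0"
      using t[of n] by simp
    have "integrable lborel (\<lambda>z. gauss_hat (t n) z * A z)"
    proof (rule Bochner_Integration.integrable_bound)
      show "integrable lborel (\<lambda>z. gauss_hat (t n) z * (N2 f)\<^sup>2)"
        using gauss_hat_integrable[OF t] by (rule integrable_mult_left)
      show "AE z in lborel. norm (gauss_hat (t n) z * A z) \<le> norm (gauss_hat (t n) z * (N2 f)\<^sup>2)"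
        by (intro AE_I2) (simp add: abs_mult mult_left_mono A)
    qed simp
    from lborel_integral_affine3[OF s this, of 0]
    have "(LINT x|lborel. gauss_hat (t n) (sqrt (t n) *\<^sub>R x) * A (sqrt (t n) *\<^sub>R x))
        = 1 / sqrt (t n) ^ 3 * (LINT z|lborel. gauss_hat (t n) z * A z)"
      using t[of n] by simp
    moreover have "gauss_hat (t n) (sqrt (t n) *\<^sub>R x) = 1 / sqrt (t n) ^ 3 * gauss 1 x" for x
      using t[of n] by (simp add: gauss_hat_def gauss_def power_mult_distrib)
    ultimately have "1 / sqrt (t n) ^ 3 * (LINT x|lborel. gauss 1 x * A (sqrt (t n) *\<^sub>R x))
        = 1 / sqrt (t n) ^ 3 * (LINT z|lborel. gauss_hat (t n) z * A z)"
      by (simp only: mult.assoc integral_mult_right_zero)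
    then have "(LINT z|lborel. gauss_hat (t n) z * A z) = (LINT x|lborel. gauss 1 x * A (sqrt (t n) *\<^sub>R x))"
      using s by simp
    then show ?thesis
      using gauss_ft_square[OF f fL t[of n]] unfolding u_def[abs_def] A_def by simp
  qed
  have "(\<lambda>n. LINT x|lborel. gauss 1 x * A (sqrt (t n) *\<^sub>R x)) \<longlonglongrightarrow> (LINT x|lborel. gauss 1 x * (N2 f)\<^sup>2)"
  proof (rule integral_dominated_convergence)
    show "integrable lborel (\<lambda>x. gauss 1 x * (N2 f)\<^sup>2)"
      using gauss_integrable[of 1] by (intro integrable_mult_left) simp
    show "AE x in lborel. norm (gauss 1 x * A (sqrt (t n) *\<^sub>R x)) \<le> gauss 1 x * (N2 f)\<^sup>2" for n
      by (intro AE_I2) (simp add: abs_mult mult_left_mono A)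
    have "(\<lambda>n. A (sqrt (t n) *\<^sub>R x)) \<longlonglongrightarrow> (N2 f)\<^sup>2" for x
      unfolding A_def using tendsto_scaleR[OF tendsto_real_sqrt[OF tz] tendsto_const[of x]]
      by (intro autocorrelation_tendsto fL) simp
    then show "AE x in lborel. (\<lambda>n. gauss 1 x * A (sqrt (t n) *\<^sub>R x)) \<longlonglongrightarrow> gauss 1 x * (N2 f)\<^sup>2"
      by (intro AE_I2 tendsto_mult tendsto_const)
  qed simp_all
  then have lim: "(\<lambda>n. integral\<^sup>L lborel (u n)) \<longlonglongrightarrow> (N2 f)\<^sup>2"
    unfolding ui using gauss_integral[of 1] by simp
  \<comment> \<open>Integrability of \<open>(norm (ft f \<xi>))\<^sup>2\<close> is itself to be
    proved, so this side calls for monotone convergence along the decreasing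
    \<open>t n\<close>.\<close>
  have mono: "mono (\<lambda>n. u n \<xi>)" for \<xi>
  proof (rule incseq_SucI)
    fix n
    have "t (Suc n) \<le> t n"
      by (simp add: t_def field_simps)
    then have "gauss (t n) \<xi> \<le> gauss (t (Suc n)) \<xi>"
      by (simp add: gauss_def mult_right_mono)
    then show "u n \<xi> \<le> u (Suc n) \<xi>"
      by (simp add: u_def mult_right_mono)
  qed
  have pt: "(\<lambda>n. u n \<xi>) \<longlonglongrightarrow> (norm (ft f \<xi>))\<^sup>2" for \<xi>
  proof -
    have "(\<lambda>n. exp (- pi * t n * (norm \<xi>)\<^sup>2)) \<longlonglongrightarrow> exp (- pi * 0 * (norm \<xi>)\<^sup>2)"
      by (intro tendsto_intros tz)
    from tendsto_mult[OF this tendsto_const[of "(norm (ft f \<xi>))\<^sup>2"]] show ?thesis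
      by (simp add: u_def gauss_def)
  qed
  have "has_bochner_integral lborel (\<lambda>\<xi>. (norm (ft f \<xi>))\<^sup>2) ((N2 f)\<^sup>2)"
    unfolding has_bochner_integral_iff
    using integrable_monotone_convergence[OF int _ _ lim, of "\<lambda>\<xi>. (norm (ft f \<xi>))\<^sup>2"]
      integral_monotone_convergence[OF int _ _ lim, of "\<lambda>\<xi>. (norm (ft f \<xi>))\<^sup>2"] mono pt by simp
  then show "ft f \<in> L2" "N2 (ft f) = N2 f"
    by (auto simp: L2_iff has_bochner_integral_iff N2_def[of "ft f"] abs_of_nonneg[OF N2_nonneg])
qed

lemma
  assumes "integrable lborel f" "integrable lborel g"
  shows ft_add: "ft (\<lambda>x. f x + g x) \<xi> = ft f \<xi> + ft g \<xi>"
    and ft_diff: "ft (\<lambda>x. f x - g x) \<xi> = ft f \<xi> - ft g \<xi>"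
  using Bochner_Integration.integral_add[OF ft_integrable[OF assms(1)] ft_integrable[OF assms(2)], of \<xi> \<xi>]
    Bochner_Integration.integral_diff[OF ft_integrable[OF assms(1)] ft_integrable[OF assms(2)], of \<xi> \<xi>]
  by (simp_all add: ft_def vector_add_ldistrib vector_ssub_ldistrib)

lemma ft_linear:
  assumes T: "bounded_linear T" and c: "\<And>c v. T (c *s v) = c *s T v" and f: "integrable lborel f"
  shows "ft (\<lambda>x. T (f x)) \<xi> = T (ft f \<xi>)"
  unfolding ft_def c[symmetric] by (rule integral_bounded_linear[OF T ft_integrable[OF f]])

section \<open>Extension of the transform to \<open>L2\<close> by cutting to balls\<close>

definition ball_cut :: "real \<Rightarrow> (real ^ 3 \<Rightarrow> cl3) \<Rightarrow> real ^ 3 \<Rightarrow> cl3" where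
  "ball_cut R f x = indicator (cball 0 R) x *\<^sub>R f x"

lemma measurable_cball[measurable]: "cball (x :: real ^ 3) R \<in> sets borel"
  by simp

lemma fourier_trunc_ball_cut: "fourier_trunc R f = ft (ball_cut R f)"
  by (simp add: fun_eq_iff fourier_trunc_def ft_def ball_cut_def set_lebesgue_integral_def ek_def smult_scaleR)

lemma
  assumes f: "f \<in> L2"
  shows ball_cut_L2: "ball_cut R f \<in> L2" and ball_cut_integrable: "integrable lborel (ball_cut R f)"
proof -
  have [measurable]: "f \<in> borel_measurable borel"
    using f by auto
  have m: "ball_cut R f \<in> borel_measurable borel"
    unfolding ball_cut_def by measurable
  show "ball_cut R f \<in> L2"
    by (rule L2_dominated[OF f m, of 1]) (simp_all add: ball_cut_def indicator_def)
  have i: "(\<lambda>x::real^3. indicator (cball 0 R) x *\<^sub>R (1::real)) \<in> L2"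
    by (intro L2_indicator) (auto intro: emeasure_bounded_finite simp flip: infinity_ennreal_def)
  show "integrable lborel (ball_cut R f)"
    by (rule Bochner_Integration.integrable_bound[OF norm_mult_integrable[OF i f]])
      (use m in \<open>simp_all add: ball_cut_def\<close>)
qed

lemma ball_cut_tendsto:
  assumes f: "f \<in> L2"
  shows "((\<lambda>R. N2 (\<lambda>x. ball_cut R f x - f x)) \<longlongrightarrow> 0) at_top"
proof (rule tendsto_at_topI_sequentially)
  fix X :: "nat \<Rightarrow> real" assume X: "filterlim X at_top sequentially"
  show "(\<lambda>n. N2 (\<lambda>x. ball_cut (X n) f x - f x)) \<longlonglongrightarrow> 0"
  proof (rule N2_tendsto_dominated[OF _ f])
    show "(\<lambda>x. ball_cut (X n) f x - f x) \<in> borel_measurable borel" for n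
      using L2_diff[OF ball_cut_L2[OF f] f] by auto
    show "AE x in lborel. norm (ball_cut (X n) f x - f x) \<le> 1 * norm (f x)" for n
      by (intro AE_I2) (simp add: ball_cut_def indicator_def)
    have "(\<lambda>n. ball_cut (X n) f x - f x) \<longlonglongrightarrow> 0" for x
    proof (rule tendsto_eventually)
      have "\<forall>\<^sub>F n in sequentially. norm x \<le> X n"
        using X by (simp add: filterlim_at_top)
      then show "\<forall>\<^sub>F n in sequentially. ball_cut (X n) f x - f x = 0"
        by eventually_elim (simp add: ball_cut_def)
    qed
    then show "AE x in lborel. (\<lambda>n. ball_cut (X n) f x - f x) \<longlonglongrightarrow> 0"
      by simp
  qed
qed

lemma N2_ft_diff:
  assumes "integrable lborel f" "f \<in> L2" "integrable lborel g" "g \<in> L2"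
  shows "N2 (\<lambda>\<xi>. ft f \<xi> - ft g \<xi>) = N2 (\<lambda>x. f x - g x)"
  unfolding ft_diff[OF assms(1,3), symmetric]
  by (rule N2_ft) (intro Bochner_Integration.integrable_diff L2_diff assms)+

lemma has_fourier_iff:
  "has_fourier f g \<longleftrightarrow> f \<in> L2 \<and> g \<in> L2 \<and> ((\<lambda>R. N2 (\<lambda>\<xi>. ft (ball_cut R f) \<xi> - g \<xi>)) \<longlongrightarrow> 0) at_top"
  unfolding has_fourier_def L2_lim_iff fourier_trunc_ball_cut
  by (auto intro: ft_L2 ball_cut_integrable ball_cut_L2 always_eventually)

lemma has_fourier_L2: "has_fourier f g \<Longrightarrow> f \<in> L2" "has_fourier f g \<Longrightarrow> g \<in> L2"
  by (simp_all add: has_fourier_iff)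

text \<open>By Plancherel the transforms of the cuts at integer radii form a Cauchy sequence; real
  radii are then compared with integer ones.\<close>

lemma has_fourier_exists:
  assumes f: "f \<in> L2" obtains g where "has_fourier f g"
proof -
  note ct = ball_cut_L2[OF f] ball_cut_integrable[OF f]
  let ?F = "\<lambda>n. ft (ball_cut (real n) f)"
  have c: "(\<lambda>n. N2 (\<lambda>x. ball_cut (real n) f x - f x)) \<longlonglongrightarrow> 0"
    using filterlim_compose[OF ball_cut_tendsto[OF f] filterlim_real_sequentially] .
  have F: "?F n \<in> L2" for n
    by (intro ft_L2 ct)
  obtain g where g: "L2_lim ?F sequentially g"
  proof (rule L2_complete[OF F])
    fix e :: real assume e: "0 < e"
    obtain M where M: "\<And>n. n \<ge> M \<Longrightarrow> norm (N2 (\<lambda>x. ball_cut (real n) f x - f x)) < e / 2"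
      using LIMSEQ_D[OF c, of "e / 2"] e by auto
    show "\<exists>M. \<forall>m\<ge>M. \<forall>n\<ge>M. N2 (\<lambda>x. ?F m x - ?F n x) < e"
    proof (intro exI[of _ M] allI impI)
      fix m n assume mn: "M \<le> m" "M \<le> n"
      have "N2 (\<lambda>x. ?F m x - ?F n x) = N2 (\<lambda>x. ball_cut (real m) f x - ball_cut (real n) f x)"
        by (intro N2_ft_diff ct)
      also have "\<dots> \<le> N2 (\<lambda>x. ball_cut (real m) f x - f x) + N2 (\<lambda>x. f x - ball_cut (real n) f x)"
        by (intro N2_triangle_diff ct f)
      also have "\<dots> < e"
        using M[OF mn(1)] M[OF mn(2)] N2_commute[of f "ball_cut (real n) f"] by simp
      finally show "N2 (\<lambda>x. ?F m x - ?F n x) < e" .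
    qed
  qed blast
  then have gL: "g \<in> L2" and gl: "(\<lambda>n. N2 (\<lambda>x. ?F n x - g x)) \<longlonglongrightarrow> 0"
    by (simp_all add: L2_lim_iff)
  \<comment> \<open>For fixed real R the comparison with the n-th integer cut leaves two error terms
    that vanish as n \<rightarrow> \<infinity>.\<close>
  have "N2 (\<lambda>\<xi>. ft (ball_cut R f) \<xi> - g \<xi>) \<le> N2 (\<lambda>x. ball_cut R f x - f x)" for R
  proof (rule tendsto_lowerbound)
    show "(\<lambda>n. N2 (\<lambda>x. ball_cut R f x - f x) + N2 (\<lambda>x. ball_cut (real n) f x - f x) + N2 (\<lambda>x. ?F n x - g x))
        \<longlonglongrightarrow> N2 (\<lambda>x. ball_cut R f x - f x)"
      using tendsto_add[OF tendsto_add[OF tendsto_const[of "N2 (\<lambda>x. ball_cut R f x - f x)"] c] gl] by simp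
    have "N2 (\<lambda>\<xi>. ft (ball_cut R f) \<xi> - g \<xi>)
        \<le> N2 (\<lambda>x. ball_cut R f x - f x) + N2 (\<lambda>x. ball_cut (real n) f x - f x) + N2 (\<lambda>x. ?F n x - g x)" for n
    proof -
      have "N2 (\<lambda>\<xi>. ft (ball_cut R f) \<xi> - g \<xi>) \<le> N2 (\<lambda>\<xi>. ft (ball_cut R f) \<xi> - ?F n \<xi>) + N2 (\<lambda>x. ?F n x - g x)"
        by (intro N2_triangle_diff ft_L2 ct gL)
      also have "N2 (\<lambda>\<xi>. ft (ball_cut R f) \<xi> - ?F n \<xi>) = N2 (\<lambda>x. ball_cut R f x - ball_cut (real n) f x)"
        by (intro N2_ft_diff ct)
      also have "\<dots> \<le> N2 (\<lambda>x. ball_cut R f x - f x) + N2 (\<lambda>x. f x - ball_cut (real n) f x)"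
        by (intro N2_triangle_diff ct f)
      finally show ?thesis
        using N2_commute[of f "ball_cut (real n) f"] by simp
    qed
    then show "\<forall>\<^sub>F n in sequentially. N2 (\<lambda>\<xi>. ft (ball_cut R f) \<xi> - g \<xi>)
        \<le> N2 (\<lambda>x. ball_cut R f x - f x) + N2 (\<lambda>x. ball_cut (real n) f x - f x) + N2 (\<lambda>x. ?F n x - g x)"
      by simp
  qed simp
  then have "((\<lambda>R. N2 (\<lambda>\<xi>. ft (ball_cut R f) \<xi> - g \<xi>)) \<longlongrightarrow> 0) at_top"
    by (intro Lim_null_comparison[OF _ ball_cut_tendsto[OF f]])
      (simp add: abs_of_nonneg[OF N2_nonneg] always_eventually)
  then show ?thesis
    using that f gL by (simp add: has_fourier_iff)
qed

lemma has_fourier_unique: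
  assumes "has_fourier f g" "has_fourier f h"
  shows "AE x in lborel. g x = h x"
  using assms unfolding has_fourier_def by (intro L2_lim_unique_AE[of _ at_top g h]) auto

lemma has_fourier_cong_right:
  assumes "has_fourier f g" "h \<in> borel_measurable borel" "AE x in lborel. g x = h x"
  shows "has_fourier f h"
proof -
  have g: "g \<in> L2" and f: "f \<in> L2"
    using assms has_fourier_L2 by auto
  have h: "h \<in> L2"
    using L2_cong_AE[OF g assms(2,3)] .
  have "N2 (\<lambda>\<xi>. ft (ball_cut R f) \<xi> - h \<xi>) = N2 (\<lambda>\<xi>. ft (ball_cut R f) \<xi> - g \<xi>)" for R
  proof (rule N2_cong_AE)
    show "AE x in lborel. ft (ball_cut R f) x - h x = ft (ball_cut R f) x - g x"
      using assms(3) by eventually_elim simp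
  qed (use L2_diff[OF ft_L2[OF ball_cut_integrable[OF f] ball_cut_L2[OF f]]] g h in auto)
  then show ?thesis
    using assms(1) h by (simp add: has_fourier_iff)
qed

lemma has_fourier_cong_left:
  assumes "has_fourier f g" "h \<in> borel_measurable borel" "AE x in lborel. f x = h x"
  shows "has_fourier h g"
proof -
  have f: "f \<in> L2"
    using assms has_fourier_L2 by auto
  have h: "h \<in> L2"
    using L2_cong_AE[OF f assms(2,3)] .
  have [measurable]: "f \<in> borel_measurable borel" "h \<in> borel_measurable borel"
    using f assms(2) by auto
  have "ft (ball_cut R h) = ft (ball_cut R f)" for R
    unfolding ft_def ball_cut_def
  proof (rule ext, rule integral_cong_AE)
    fix \<xi>
    show "AE x in lborel. ek (x \<bullet> \<xi>) *s (indicator (cball 0 R) x *\<^sub>R h x) = ek (x \<bullet> \<xi>) *s (indicator (cball 0 R) x *\<^sub>R f x)"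
      using assms(3) by eventually_elim simp
  qed measurable
  then show ?thesis
    using assms(1) h by (simp add: has_fourier_iff)
qed

lemma has_fourier_N2:
  assumes "has_fourier f g" shows "N2 g = N2 f"
proof (rule tendsto_unique[of at_top])
  have f: "f \<in> L2"
    using assms has_fourier_L2 by auto
  have "((\<lambda>R. N2 (fourier_trunc R f)) \<longlongrightarrow> N2 g) at_top"
    using assms by (intro L2_lim_N2) (simp add: has_fourier_def)
  then show "((\<lambda>R. N2 (ball_cut R f)) \<longlongrightarrow> N2 g) at_top"
    by (simp add: fourier_trunc_ball_cut N2_ft ball_cut_integrable ball_cut_L2 f)
  show "((\<lambda>R. N2 (ball_cut R f)) \<longlongrightarrow> N2 f) at_top"
    using ball_cut_tendsto[OF f] by (intro L2_lim_N2) (simp add: L2_lim_iff ball_cut_L2 f)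
qed simp

lemma has_fourier_linear:
  assumes T: "bounded_linear T" and c: "\<And>c v. T (c *s v) = c *s T v" and fg: "has_fourier f g"
  shows "has_fourier (\<lambda>x. T (f x)) (\<lambda>x. T (g x))"
proof -
  have f: "f \<in> L2" and g: "g \<in> L2"
    using fg has_fourier_L2 by auto
  obtain K where K: "0 \<le> K" "\<And>v. norm (T v) \<le> norm v * K"
    using bounded_linear.nonneg_bounded[OF T] by auto
  have [measurable]: "T \<in> borel_measurable borel"
    using T by (intro borel_measurable_continuous_onI linear_continuous_on)
  have TL: "(\<lambda>x. T (h x)) \<in> L2" and TN: "N2 (\<lambda>x. T (h x)) \<le> K * N2 h" if h: "h \<in> L2" for h :: "real^3 \<Rightarrow> cl3"
  proof -
    have m: "(\<lambda>x. T (h x)) \<in> borel_measurable borel"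
      using h by measurable
    show "(\<lambda>x. T (h x)) \<in> L2" "N2 (\<lambda>x. T (h x)) \<le> K * N2 h"
      using L2_dominated[OF h m K(1)] N2_dominated[OF h m K(1)] K(2) by (simp_all add: mult.commute)
  qed
  have "ft (ball_cut R (\<lambda>x. T (f x))) \<xi> = T (ft (ball_cut R f) \<xi>)" for R \<xi>
  proof -
    have "ball_cut R (\<lambda>x. T (f x)) = (\<lambda>x. T (ball_cut R f x))"
      using T by (simp add: ball_cut_def fun_eq_iff linear_cmul bounded_linear.linear)
    then show ?thesis
      using ft_linear[OF T c ball_cut_integrable[OF f]] by simp
  qed
  then have eq: "ft (ball_cut R (\<lambda>x. T (f x))) \<xi> - T (g \<xi>) = T (ft (ball_cut R f) \<xi> - g \<xi>)" for R \<xi>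
    using T by (simp add: linear_diff bounded_linear.linear)
  have "((\<lambda>R. N2 (\<lambda>\<xi>. ft (ball_cut R (\<lambda>x. T (f x))) \<xi> - T (g \<xi>))) \<longlongrightarrow> 0) at_top"
  proof (rule Lim_null_comparison)
    show "((\<lambda>R. K * N2 (\<lambda>\<xi>. ft (ball_cut R f) \<xi> - g \<xi>)) \<longlongrightarrow> 0) at_top"
      using fg by (intro tendsto_mult_right_zero) (simp add: has_fourier_iff)
    show "\<forall>\<^sub>F R in at_top. norm (N2 (\<lambda>\<xi>. ft (ball_cut R (\<lambda>x. T (f x))) \<xi> - T (g \<xi>))) \<le> K * N2 (\<lambda>\<xi>. ft (ball_cut R f) \<xi> - g \<xi>)"
      unfolding eq using TN[OF L2_diff[OF ft_L2[OF ball_cut_integrable[OF f] ball_cut_L2[OF f]] g]]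
      by (simp add: abs_of_nonneg[OF N2_nonneg] always_eventually)
  qed
  then show ?thesis
    using TL f g by (simp add: has_fourier_iff)
qed

lemma has_fourier_add:
  assumes "has_fourier f g" "has_fourier f' g'"
  shows "has_fourier (\<lambda>x. f x + f' x) (\<lambda>x. g x + g' x)"
proof -
  have L: "f \<in> L2" "g \<in> L2" "f' \<in> L2" "g' \<in> L2"
    using assms has_fourier_L2 by auto
  note ct = ft_L2[OF ball_cut_integrable ball_cut_L2] ball_cut_integrable
  have "ball_cut R (\<lambda>x. f x + f' x) = (\<lambda>x. ball_cut R f x + ball_cut R f' x)" for R
    by (simp add: ball_cut_def fun_eq_iff scaleR_add_right)
  then have eq: "ft (ball_cut R (\<lambda>x. f x + f' x)) \<xi> - (g \<xi> + g' \<xi>)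
      = (ft (ball_cut R f) \<xi> - g \<xi>) + (ft (ball_cut R f') \<xi> - g' \<xi>)" for R \<xi>
    by (simp add: ft_add ball_cut_integrable L)
  have "((\<lambda>R. N2 (\<lambda>\<xi>. ft (ball_cut R (\<lambda>x. f x + f' x)) \<xi> - (g \<xi> + g' \<xi>))) \<longlongrightarrow> 0) at_top"
  proof (rule Lim_null_comparison)
    show "((\<lambda>R. N2 (\<lambda>\<xi>. ft (ball_cut R f) \<xi> - g \<xi>) + N2 (\<lambda>\<xi>. ft (ball_cut R f') \<xi> - g' \<xi>)) \<longlongrightarrow> 0) at_top"
      using assms by (intro tendsto_add_zero) (simp_all add: has_fourier_iff)
    show "\<forall>\<^sub>F R in at_top. norm (N2 (\<lambda>\<xi>. ft (ball_cut R (\<lambda>x. f x + f' x)) \<xi> - (g \<xi> + g' \<xi>)))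
        \<le> N2 (\<lambda>\<xi>. ft (ball_cut R f) \<xi> - g \<xi>) + N2 (\<lambda>\<xi>. ft (ball_cut R f') \<xi> - g' \<xi>)"
      unfolding eq using N2_triangle[OF L2_diff[OF ct(1) L(2)] L2_diff[OF ct(1) L(4)]] L
      by (simp add: abs_of_nonneg[OF N2_nonneg] always_eventually)
  qed
  then show ?thesis
    using L by (simp add: has_fourier_iff L2_add)
qed

lemma has_fourier_smult: "has_fourier f g \<Longrightarrow> has_fourier (\<lambda>x. c *s f x) (\<lambda>x. c *s g x)"
  by (rule has_fourier_linear[OF bounded_bilinear.bounded_linear_right[OF bounded_bilinear_smult]])
    (simp_all add: vector_smult_assoc mult.commute)

lemma has_fourier_cl_mult: "has_fourier f g \<Longrightarrow> has_fourier (\<lambda>x. a \<odot> f x) (\<lambda>x. a \<odot> g x)"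
  by (rule has_fourier_linear[OF bounded_bilinear.bounded_linear_right[OF bounded_bilinear_cl_mult]])
    (simp_all add: cl_bilinear)

lemma has_fourier_diff:
  assumes "has_fourier f g" "has_fourier f' g'"
  shows "has_fourier (\<lambda>x. f x - f' x) (\<lambda>x. g x - g' x)"
  using has_fourier_add[OF assms(1) has_fourier_smult[OF assms(2), of "-1"]] by simp

lemma has_fourier_0: "has_fourier (\<lambda>x. 0) (\<lambda>x. 0)"
proof -
  have "ball_cut R (\<lambda>x. 0) = (\<lambda>x. 0)" for R
    by (simp add: ball_cut_def fun_eq_iff)
  then show ?thesis
    by (simp add: has_fourier_iff L2_0 N2_0 ft_def)
qed

text \<open>The cuts converge to f in L^2 and Plancherel transfers this to their transforms, so the
  integral and the limit definition agree.\<close>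

lemma has_fourier_integrable:
  assumes f: "integrable lborel f" and fL: "f \<in> L2"
  shows "has_fourier f (ft f)"
  using ball_cut_tendsto[OF fL]
  by (simp add: has_fourier_iff fL ft_L2[OF f fL] N2_ft_diff[OF ball_cut_integrable[OF fL] ball_cut_L2[OF fL] f fL])

section \<open>Fourier inversion\<close>

lemma integral_inner_tendsto:
  fixes F G :: "nat \<Rightarrow> real ^ 3 \<Rightarrow> cl3"
  assumes F: "L2_lim F sequentially f" "\<And>n. F n \<in> L2" and G: "L2_lim G sequentially g" "\<And>n. G n \<in> L2"
  shows "(\<lambda>n. LINT x|lborel. F n x \<bullet> G n x) \<longlonglongrightarrow> (LINT x|lborel. f x \<bullet> g x)"
proof -
  have L: "f \<in> L2" "g \<in> L2"
    using F G by (simp_all add: L2_lim_iff)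
  have "(\<lambda>n. (LINT x|lborel. F n x \<bullet> G n x) - (LINT x|lborel. f x \<bullet> g x)) \<longlonglongrightarrow> 0"
  proof (rule Lim_null_comparison)
    have "(\<lambda>n. N2 (\<lambda>x. F n x - f x) * N2 (G n) + N2 f * N2 (\<lambda>x. G n x - g x)) \<longlonglongrightarrow> 0 * N2 g + N2 f * 0"
      using F(1) G(1) L2_lim_N2[OF G(1)]
      by (intro tendsto_add tendsto_mult tendsto_const) (simp_all add: L2_lim_iff)
    then show "(\<lambda>n. N2 (\<lambda>x. F n x - f x) * N2 (G n) + N2 f * N2 (\<lambda>x. G n x - g x)) \<longlonglongrightarrow> 0"
      by simp
    have "norm ((LINT x|lborel. F n x \<bullet> G n x) - (LINT x|lborel. f x \<bullet> g x))
        \<le> N2 (\<lambda>x. F n x - f x) * N2 (G n) + N2 f * N2 (\<lambda>x. G n x - g x)" for n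
    proof -
      have "(LINT x|lborel. (F n x - f x) \<bullet> G n x) = (LINT x|lborel. F n x \<bullet> G n x) - (LINT x|lborel. f x \<bullet> G n x)"
        unfolding inner_diff_left by (intro Bochner_Integration.integral_diff inner_L2_integrable F G L)
      moreover have "(LINT x|lborel. f x \<bullet> (G n x - g x)) = (LINT x|lborel. f x \<bullet> G n x) - (LINT x|lborel. f x \<bullet> g x)"
        unfolding inner_diff_right by (intro Bochner_Integration.integral_diff inner_L2_integrable F G L)
      ultimately show ?thesis
        using inner_L2_le(1)[OF L2_diff[OF F(2) L(1)] G(2), of n n] inner_L2_le(1)[OF L(1) L2_diff[OF G(2) L(2)], of n]
        by simp
    qed
    then show "\<forall>\<^sub>F n in sequentially. norm ((LINT x|lborel. F n x \<bullet> G n x) - (LINT x|lborel. f x \<bullet> g x))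
        \<le> N2 (\<lambda>x. F n x - f x) * N2 (G n) + N2 f * N2 (\<lambda>x. G n x - g x)"
      by (rule always_eventually[OF allI])
  qed
  from tendsto_add[OF this tendsto_const[of "LINT x|lborel. f x \<bullet> g x"]] show ?thesis by simp
qed

lemma ball_cut_L2_lim:
  assumes f: "f \<in> L2"
  shows "L2_lim (\<lambda>n. ball_cut (real n) f) sequentially f"
  using filterlim_compose[OF ball_cut_tendsto[OF f] filterlim_real_sequentially]
  by (simp add: L2_lim_iff f ball_cut_L2[OF f])

lemma has_fourier_L2_lim:
  assumes "has_fourier f g"
  shows "L2_lim (\<lambda>n. ft (ball_cut (real n) f)) sequentially g"
proof -
  have f: "f \<in> L2" "g \<in> L2" "((\<lambda>R. N2 (\<lambda>\<xi>. ft (ball_cut R f) \<xi> - g \<xi>)) \<longlongrightarrow> 0) at_top"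
    using assms by (simp_all add: has_fourier_iff)
  show ?thesis
    using filterlim_compose[OF f(3) filterlim_real_sequentially]
    by (simp add: L2_lim_iff f ft_L2[OF ball_cut_integrable ball_cut_L2])
qed

text \<open>Polarization: \<open>N2\<close> is preserved for the sum as well as for the summands,
  which fixes the real inner product.\<close>

lemma has_fourier_parseval:
  assumes fg: "has_fourier f g" and hk: "has_fourier h k"
  shows "(LINT x|lborel. g x \<bullet> k x) = (LINT x|lborel. f x \<bullet> h x)"
proof -
  have expand: "(N2 (\<lambda>x. a x + b x))\<^sup>2 = (N2 a)\<^sup>2 + 2 * (LINT x|lborel. a x \<bullet> b x) + (N2 b)\<^sup>2"
    if "a \<in> L2" "b \<in> L2" for a b :: "real ^ 3 \<Rightarrow> cl3"
  proof -
    have "(norm (a x + b x))\<^sup>2 = (norm (a x))\<^sup>2 + 2 * (a x \<bullet> b x) + (norm (b x))\<^sup>2" for x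
      by (simp add: power2_norm_eq_inner inner_add_left inner_add_right inner_commute)
    then show ?thesis
      unfolding N2_square
      by (simp add: L2_integrable inner_L2_integrable that)
  qed
  show ?thesis
    using expand[of g k] expand[of f h] has_fourier_N2[OF has_fourier_add[OF fg hk]]
      has_fourier_N2[OF fg] has_fourier_N2[OF hk] has_fourier_L2[OF fg] has_fourier_L2[OF hk] by simp
qed

text \<open>Fubini; moving \<open>ek\<close> across the real inner product conjugates it, which is
  where the reflection comes from.\<close>

lemma ft_multiplication_formula:
  assumes f: "integrable lborel f" and h: "integrable lborel h"
  shows "(LINT \<xi>|lborel. ft f \<xi> \<bullet> h \<xi>) = (LINT x|lborel. f x \<bullet> ft h (- x))"
proof -
  have [measurable]: "f \<in> borel_measurable borel" "h \<in> borel_measurable borel"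
    using f h by auto
  let ?n = "LINT x|lborel. norm (f x)"
  have "(LINT \<xi>|lborel. ft f \<xi> \<bullet> h \<xi>) = (LINT \<xi>|lborel. (LINT x|lborel. (ek (x \<bullet> \<xi>) *s f x) \<bullet> h \<xi>))"
    unfolding ft_def by (intro Bochner_Integration.integral_cong refl integral_inner_left[symmetric] ft_integrable f)
  also have "\<dots> = (LINT x|lborel. (LINT \<xi>|lborel. (ek (x \<bullet> \<xi>) *s f x) \<bullet> h \<xi>))"
  proof (rule Fubini_swap[symmetric])
    have le: "\<bar>(ek (x \<bullet> \<xi>) *s f x) \<bullet> h \<xi>\<bar> \<le> norm (h \<xi>) * norm (f x)" for x \<xi>
      using Cauchy_Schwarz_ineq2[of "ek (x \<bullet> \<xi>) *s f x" "h \<xi>"] by (simp add: norm_smult mult.commute)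
    show "(\<lambda>(x, \<xi>). (ek (x \<bullet> \<xi>) *s f x) \<bullet> h \<xi>) \<in> borel_measurable (lborel \<Otimes>\<^sub>M lborel)"
      by measurable
    have int: "integrable lborel (\<lambda>x. (ek (x \<bullet> \<xi>) *s f x) \<bullet> h \<xi>)" for \<xi>
      by (intro integrable_inner_left ft_integrable f)
    then show "AE \<xi> in lborel. integrable lborel (\<lambda>x. (ek (x \<bullet> \<xi>) *s f x) \<bullet> h \<xi>)"
      by simp
    show "integrable lborel (\<lambda>\<xi>. LINT x|lborel. norm ((ek (x \<bullet> \<xi>) *s f x) \<bullet> h \<xi>))"
    proof (rule Bochner_Integration.integrable_bound)
      show "integrable lborel (\<lambda>\<xi>. norm (h \<xi>) * ?n)"
        using h by (intro integrable_mult_left) simp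
      have "(LINT x|lborel. norm ((ek (x \<bullet> \<xi>) *s f x) \<bullet> h \<xi>)) \<le> (LINT x|lborel. norm (h \<xi>) * norm (f x))" for \<xi>
        unfolding real_norm_def using f by (intro integral_mono integrable_abs int le integrable_mult_right) simp
      then show "AE \<xi> in lborel. norm (LINT x|lborel. norm ((ek (x \<bullet> \<xi>) *s f x) \<bullet> h \<xi>)) \<le> norm (norm (h \<xi>) * ?n)"
        by (intro AE_I2) simp
    qed measurable
  qed
  also have "\<dots> = (LINT x|lborel. f x \<bullet> ft h (- x))"
  proof (rule Bochner_Integration.integral_cong[OF refl])
    fix x
    have "(LINT \<xi>|lborel. (ek (x \<bullet> \<xi>) *s f x) \<bullet> h \<xi>) = (LINT \<xi>|lborel. f x \<bullet> (ek (\<xi> \<bullet> - x) *s h \<xi>))"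
      by (intro Bochner_Integration.integral_cong refl) (simp only: inner_smult cnj_ek inner_minus_right inner_commute[of x])
    also have "\<dots> = f x \<bullet> ft h (- x)"
      unfolding ft_def by (intro integral_inner_right ft_integrable h)
    finally show "(LINT \<xi>|lborel. (ek (x \<bullet> \<xi>) *s f x) \<bullet> h \<xi>) = f x \<bullet> ft h (- x)" .
  qed
  finally show ?thesis .
qed

lemma has_fourier_reflect:
  assumes fg: "has_fourier f g"
  shows "has_fourier (\<lambda>x. f (- x)) (\<lambda>x. g (- x))"
proof -
  have L: "f \<in> L2" "g \<in> L2" and lim: "((\<lambda>R. N2 (\<lambda>\<xi>. ft (ball_cut R f) \<xi> - g \<xi>)) \<longlongrightarrow> 0) at_top"
    using fg by (simp_all add: has_fourier_iff)
  have "ft (ball_cut R (\<lambda>x. f (- x))) \<xi> = ft (ball_cut R f) (- \<xi>)" for R \<xi>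
  proof -
    have "ball_cut R (\<lambda>x. f (- x)) x = ball_cut R f (- x)" for x
      by (simp add: ball_cut_def indicator_def)
    then show ?thesis
      unfolding ft_def
      using lborel_integral_shift(3)[OF ft_integrable[OF ball_cut_integrable[OF L(1)], of "- \<xi>"], where a = 0]
      by simp
  qed
  then have "N2 (\<lambda>\<xi>. ft (ball_cut R (\<lambda>x. f (- x))) \<xi> - g (- \<xi>)) = N2 (\<lambda>\<xi>. ft (ball_cut R f) \<xi> - g \<xi>)" for R
    using N2_shift(3)[OF L2_diff[OF ft_L2[OF ball_cut_integrable ball_cut_L2] L(2)], OF L(1) L(1), where a = 0] by simp
  then show ?thesis
    using lim L2_shift(3)[OF L(1), of 0] L2_shift(3)[OF L(2), of 0] by (simp add: has_fourier_iff)
qed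

text \<open>Both sides are continuous in L^2, so the formula passes from the cuts to f and
  h.\<close>

lemma has_fourier_multiplication_formula:
  assumes fg: "has_fourier f g" and hk: "has_fourier h k"
  shows "(LINT x|lborel. g x \<bullet> h x) = (LINT x|lborel. f x \<bullet> k (- x))"
proof (rule LIMSEQ_unique)
  have L: "f \<in> L2" "g \<in> L2" "h \<in> L2" "k \<in> L2"
    using fg hk has_fourier_L2 by auto
  show "(\<lambda>n. LINT x|lborel. ft (ball_cut (real n) f) x \<bullet> ball_cut (real n) h x) \<longlonglongrightarrow> (LINT x|lborel. g x \<bullet> h x)"
    by (intro integral_inner_tendsto has_fourier_L2_lim fg ball_cut_L2_lim ft_L2 ball_cut_integrable ball_cut_L2 L)
  have K: "L2_lim (\<lambda>n x. ft (ball_cut (real n) h) (- x)) sequentially (\<lambda>x. k (- x))"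
  proof -
    have "N2 (\<lambda>x. ft (ball_cut (real n) h) (- x) - k (- x)) = N2 (\<lambda>x. ft (ball_cut (real n) h) x - k x)" for n
      using N2_shift(3)[OF L2_diff[OF ft_L2[OF ball_cut_integrable ball_cut_L2] L(4)], OF L(3) L(3), where a = 0] by simp
    moreover have "(\<lambda>x. ft (ball_cut (real n) h) (- x)) \<in> L2" for n
      using L2_shift(3)[OF ft_L2[OF ball_cut_integrable ball_cut_L2], OF L(3) L(3), where a = 0] by simp
    ultimately show ?thesis
      using has_fourier_L2_lim[OF hk] L2_shift(3)[OF L(4), of 0] by (simp add: L2_lim_iff)
  qed
  have "(\<lambda>n. LINT x|lborel. ball_cut (real n) f x \<bullet> ft (ball_cut (real n) h) (- x)) \<longlonglongrightarrow> (LINT x|lborel. f x \<bullet> k (- x))"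
  proof (rule integral_inner_tendsto[OF ball_cut_L2_lim[OF L(1)] ball_cut_L2[OF L(1)] K])
    show "(\<lambda>x. ft (ball_cut (real n) h) (- x)) \<in> L2" for n
      using L2_shift(3)[OF ft_L2[OF ball_cut_integrable ball_cut_L2], OF L(3) L(3), where a = 0] by simp
  qed
  then show "(\<lambda>n. LINT x|lborel. ft (ball_cut (real n) f) x \<bullet> ball_cut (real n) h x) \<longlonglongrightarrow> (LINT x|lborel. f x \<bullet> k (- x))"
    by (simp add: ft_multiplication_formula ball_cut_integrable L)
qed

text \<open>Parseval says \<open>F\<^sup>* F = 1\<close>; the multiplication formula identifies \<open>F\<^sup>*\<close> as \<open>F\<close> composed with
  the reflection, which commutes with \<open>F\<close>.\<close>
lemma has_fourier_inversion:
  assumes fg: "has_fourier f g"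
  shows "has_fourier g (\<lambda>x. f (- x))"
proof -
  have L: "f \<in> L2" "g \<in> L2"
    using fg has_fourier_L2 by auto
  have f': "(\<lambda>x. f (- x)) \<in> L2"
    using L2_shift(3)[OF L(1), of 0] by simp
  obtain k where k: "has_fourier g k"
    using has_fourier_exists[OF L(2)] .
  have kL: "k \<in> L2"
    using has_fourier_L2(2)[OF k] .
  \<comment> \<open>Testing k and the reflection of f against their own difference d gives the same
    value, so d has norm zero.\<close>
  define d where "d x = k x - f (- x)" for x
  have dL: "d \<in> L2"
    unfolding d_def by (intro L2_diff kL f')
  obtain l where l: "has_fourier d l"
    using has_fourier_exists[OF dL] .
  have "(LINT x|lborel. k x \<bullet> d x) = (LINT x|lborel. g x \<bullet> l (- x))"
    using has_fourier_multiplication_formula[OF k l] .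
  also have "\<dots> = (LINT x|lborel. f x \<bullet> d (- x))"
    using has_fourier_parseval[OF fg has_fourier_reflect[OF l]] .
  also have "\<dots> = (LINT x|lborel. f (- x) \<bullet> d x)"
    using lborel_integral_shift(3)[OF inner_L2_integrable[OF f' dL], of 0] by simp
  finally have "(LINT x|lborel. d x \<bullet> d x) = 0"
  proof -
    assume eq: "(LINT x|lborel. k x \<bullet> d x) = (LINT x|lborel. f (- x) \<bullet> d x)"
    have "d x \<bullet> d x = k x \<bullet> d x - f (- x) \<bullet> d x" for x
      by (simp add: d_def inner_diff_left)
    then have "(LINT x|lborel. d x \<bullet> d x) = (LINT x|lborel. k x \<bullet> d x) - (LINT x|lborel. f (- x) \<bullet> d x)"
      using inner_L2_integrable[OF kL dL] inner_L2_integrable[OF f' dL]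
      by (simp only: Bochner_Integration.integral_diff)
    then show ?thesis using eq by simp
  qed
  then have "N2 d = 0"
    by (simp add: N2_def power2_norm_eq_inner)
  then have "AE x in lborel. k x = f (- x)"
    using N2_zero_iff[OF dL] by (simp add: d_def)
  then show ?thesis
    using has_fourier_cong_right[OF k] f' by auto
qed

lemma has_fourier_surj:
  assumes g: "g \<in> L2" obtains f where "has_fourier f g"
proof -
  obtain h where h: "has_fourier g h"
    using has_fourier_exists[OF g] .
  from has_fourier_reflect[OF has_fourier_inversion[OF h]] show ?thesis
    using that by simp
qed

text \<open>Plancherel makes the \<open>u n\<close> converge in L^2 to the preimage of w; a
  subsequence converging almost everywhere identifies that preimage with the pointwise limit. The
  use is for convolutions, which converge at every point but whose L^2 limits are known only through
  their transforms.\<close>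

lemma has_fourier_pointwise_limit:
  assumes F: "\<And>n::nat. has_fourier (u n) (v n)" and v: "w \<in> L2"
    and lim: "(\<lambda>n. N2 (\<lambda>\<xi>. v n \<xi> - w \<xi>)) \<longlonglongrightarrow> 0"
    and pt: "\<And>x. (\<lambda>n. u n x) \<longlonglongrightarrow> a x" and m: "a \<in> borel_measurable borel"
  shows "has_fourier a w"
proof -
  obtain h where h: "has_fourier h w"
    using has_fourier_surj[OF v] .
  have hL: "h \<in> L2"
    using has_fourier_L2(1)[OF h] .
  have uL: "u n \<in> L2" for n
    using has_fourier_L2(1)[OF F] .
  have "N2 (\<lambda>x. u n x - h x) = N2 (\<lambda>\<xi>. v n \<xi> - w \<xi>)" for n
    by (rule has_fourier_N2[symmetric]) (intro has_fourier_diff F h)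
  then have "(\<lambda>n. N2 (\<lambda>x. u n x - h x)) \<longlonglongrightarrow> 0"
    using lim by simp
  then obtain r :: "nat \<Rightarrow> nat" where r: "strict_mono r" "AE x in lborel. (\<lambda>n. u (r n) x - h x) \<longlonglongrightarrow> 0"
    using N2_tendsto_AE_subseq[of "\<lambda>n x. u n x - h x"] L2_diff[OF uL hL] by blast
  from r(2) have "AE x in lborel. h x = a x"
  proof eventually_elim
    case (elim x)
    have "(\<lambda>n. u (r n) x - h x) \<longlonglongrightarrow> a x - h x"
      using LIMSEQ_subseq_LIMSEQ[OF pt r(1), of x] by (intro tendsto_diff tendsto_const) (simp add: o_def)
    then show ?case
      using LIMSEQ_unique[OF elim] by fastforce
  qed
  then show ?thesis
    using has_fourier_cong_left[OF h m] by simp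
qed

section \<open>Fourier multipliers\<close>

text \<open>Submultiplicativity of the Euclidean norm on coefficients is claimed only up to this
  constant.\<close>

definition cl_bound :: real where
  "cl_bound = (SOME K. 0 < K \<and> (\<forall>a b. norm (a \<odot> b) \<le> norm a * norm b * K))"

lemma cl_bound_pos: "0 < cl_bound" and norm_cl_mult: "norm (a \<odot> b) \<le> cl_bound * (norm a * norm b)"
proof -
  obtain K where "0 < K \<and> (\<forall>a b. norm (a \<odot> b) \<le> norm a * norm b * K)"
    using bounded_bilinear.pos_bounded[OF bounded_bilinear_cl_mult] by blast
  then have "0 < cl_bound \<and> (\<forall>a b. norm (a \<odot> b) \<le> norm a * norm b * cl_bound)"
    unfolding cl_bound_def by (rule someI)
  then show "0 < cl_bound" "norm (a \<odot> b) \<le> cl_bound * (norm a * norm b)"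
    by (simp_all add: mult.commute mult.left_commute)
qed

definition conv :: "(real ^ 3 \<Rightarrow> cl3) \<Rightarrow> (real ^ 3 \<Rightarrow> cl3) \<Rightarrow> real ^ 3 \<Rightarrow> cl3" where
  "conv k f x = (LINT y|lborel. k (x - y) \<odot> f y)"

lemma measurable_conv[measurable]:
  assumes [measurable]: "k \<in> borel_measurable borel" "f \<in> borel_measurable borel"
  shows "conv k f \<in> borel_measurable borel"
  unfolding conv_def by measurable

lemma
  assumes k: "k \<in> L2" and f: "f \<in> L2"
  shows conv_integrable: "integrable lborel (\<lambda>y. k (x - y) \<odot> f y)"
    and norm_conv_le: "norm (conv k f x) \<le> cl_bound * (N2 k * N2 f)"
proof -
  have [measurable]: "k \<in> borel_measurable borel" "f \<in> borel_measurable borel"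
    using k f by auto
  have i: "integrable lborel (\<lambda>y. cl_bound * (norm (k (x - y)) * norm (f y)))"
    by (intro integrable_mult_right norm_mult_integrable L2_shift(3) k f)
  show c: "integrable lborel (\<lambda>y. k (x - y) \<odot> f y)"
    by (rule Bochner_Integration.integrable_bound[OF i])
      (use norm_cl_mult cl_bound_pos in \<open>simp_all add: abs_mult\<close>)
  have "norm (conv k f x) \<le> (LINT y|lborel. norm (k (x - y) \<odot> f y))"
    unfolding conv_def by (rule integral_norm_bound)
  also have "\<dots> \<le> (LINT y|lborel. cl_bound * (norm (k (x - y)) * norm (f y)))"
    by (intro integral_mono i norm_cl_mult integrable_norm c)
  also have "\<dots> \<le> cl_bound * (N2 k * N2 f)"
    using Cauchy_Schwarz_N2[OF L2_shift(3)[OF k, of x] f] cl_bound_pos by (simp add: N2_shift[OF k])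
  finally show "norm (conv k f x) \<le> cl_bound * (N2 k * N2 f)" .
qed

text \<open>Only square integrability is asked of k, because the truncated Hilbert kernel is not
  integrable. The convolution with a function in L^2 still converges at every point, by
  Cauchy-Schwarz, and boundedness of m keeps the product in L^2.\<close>

definition is_multiplier :: "(real ^ 3 \<Rightarrow> cl3) \<Rightarrow> (real ^ 3 \<Rightarrow> cl3) \<Rightarrow> bool" where
  "is_multiplier k m \<longleftrightarrow> k \<in> L2 \<and> m \<in> borel_measurable borel \<and> (\<exists>C. \<forall>\<xi>. norm (m \<xi>) \<le> C) \<and>
     (\<forall>f g. has_fourier f g \<longrightarrow> has_fourier (conv k f) (\<lambda>\<xi>. m \<xi> \<odot> g \<xi>))"

lemma is_multiplierD:
  assumes "is_multiplier k m"
  shows "k \<in> L2" "m \<in> borel_measurable borel" "\<exists>C. \<forall>\<xi>. norm (m \<xi>) \<le> C"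
    "has_fourier f g \<Longrightarrow> has_fourier (conv k f) (\<lambda>\<xi>. m \<xi> \<odot> g \<xi>)"
  using assms by (simp_all add: is_multiplier_def)

lemma
  assumes m[measurable]: "m \<in> borel_measurable borel" and C: "\<And>\<xi>. norm (m \<xi>) \<le> C" and g: "g \<in> L2"
  shows L2_cl_mult: "(\<lambda>\<xi>. m \<xi> \<odot> g \<xi>) \<in> L2" and N2_cl_mult: "N2 (\<lambda>\<xi>. m \<xi> \<odot> g \<xi>) \<le> cl_bound * C * N2 g"
proof -
  have [measurable]: "g \<in> borel_measurable borel"
    using g by auto
  have 0: "0 \<le> cl_bound * C"
    using cl_bound_pos order_trans[OF norm_ge_zero C[of 0]] by simp
  have "norm (m \<xi> \<odot> g \<xi>) \<le> cl_bound * C * norm (g \<xi>)" for \<xi>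
  proof -
    have "norm (m \<xi> \<odot> g \<xi>) \<le> cl_bound * (norm (m \<xi>) * norm (g \<xi>))"
      by (rule norm_cl_mult)
    also have "\<dots> \<le> cl_bound * (C * norm (g \<xi>))"
      using cl_bound_pos by (intro mult_left_mono mult_right_mono C) auto
    finally show ?thesis by (simp add: mult.assoc)
  qed
  then have le: "AE \<xi> in lborel. norm (m \<xi> \<odot> g \<xi>) \<le> cl_bound * C * norm (g \<xi>)"
    by (intro AE_I2)
  have mm: "(\<lambda>\<xi>. m \<xi> \<odot> g \<xi>) \<in> borel_measurable borel"
    by measurable
  show "(\<lambda>\<xi>. m \<xi> \<odot> g \<xi>) \<in> L2" "N2 (\<lambda>\<xi>. m \<xi> \<odot> g \<xi>) \<le> cl_bound * C * N2 g"
    by (rule L2_dominated[OF g mm 0 le] N2_dominated[OF g mm 0 le])+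
qed

lemma N2_cl_mult_tendsto:
  fixes m :: "nat \<Rightarrow> real ^ 3 \<Rightarrow> cl3"
  assumes [measurable]: "\<And>n. m n \<in> borel_measurable borel" "m' \<in> borel_measurable borel"
    and C: "\<And>n \<xi>. norm (m n \<xi>) \<le> C" "\<And>\<xi>. norm (m' \<xi>) \<le> C" and lim: "\<And>\<xi>. (\<lambda>n. m n \<xi>) \<longlonglongrightarrow> m' \<xi>"
    and g: "g \<in> L2"
  shows "(\<lambda>n. N2 (\<lambda>\<xi>. m n \<xi> \<odot> g \<xi> - m' \<xi> \<odot> g \<xi>)) \<longlonglongrightarrow> 0"
proof (rule N2_tendsto_dominated[OF _ g])
  have [measurable]: "g \<in> borel_measurable borel"
    using g by auto
  show "(\<lambda>\<xi>. m n \<xi> \<odot> g \<xi> - m' \<xi> \<odot> g \<xi>) \<in> borel_measurable borel" for n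
    by measurable
  have "norm (m n \<xi> \<odot> g \<xi> - m' \<xi> \<odot> g \<xi>) \<le> cl_bound * (2 * C) * norm (g \<xi>)" for n \<xi>
  proof -
    have "norm (m n \<xi> \<odot> g \<xi> - m' \<xi> \<odot> g \<xi>) \<le> cl_bound * (norm (m n \<xi> - m' \<xi>) * norm (g \<xi>))"
      unfolding cl_bilinear(3)[symmetric] by (rule norm_cl_mult)
    also have "norm (m n \<xi> - m' \<xi>) \<le> 2 * C"
      using norm_triangle_ineq4[of "m n \<xi>" "m' \<xi>"] C(1)[of n \<xi>] C(2)[of \<xi>] by linarith
    finally show ?thesis
      using cl_bound_pos by (simp add: mult_left_mono mult_right_mono mult.assoc)
  qed
  then show "AE \<xi> in lborel. norm (m n \<xi> \<odot> g \<xi> - m' \<xi> \<odot> g \<xi>) \<le> cl_bound * (2 * C) * norm (g \<xi>)" for n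
    by (intro AE_I2)
  have "(\<lambda>n. m n \<xi> \<odot> g \<xi> - m' \<xi> \<odot> g \<xi>) \<longlonglongrightarrow> m' \<xi> \<odot> g \<xi> - m' \<xi> \<odot> g \<xi>" for \<xi>
    by (intro tendsto_diff bounded_bilinear.tendsto[OF bounded_bilinear_cl_mult] lim tendsto_const)
  then show "AE \<xi> in lborel. (\<lambda>n. m n \<xi> \<odot> g \<xi> - m' \<xi> \<odot> g \<xi>) \<longlonglongrightarrow> 0"
    by simp
qed

text \<open>The exponential at x splits into those at x - y and at y, so after Fubini a translation
  of the x-integral separates the two transforms, with the order of the Clifford factors
  kept.\<close>

lemma
  assumes k: "integrable lborel k" and f: "integrable lborel f"
  shows conv_L1: "integrable lborel (conv k f)" and ft_conv: "ft (conv k f) \<xi> = ft k \<xi> \<odot> ft f \<xi>"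
proof -
  have [measurable]: "k \<in> borel_measurable borel" "f \<in> borel_measurable borel"
    using k f by auto
  let ?\<Phi> = "\<lambda>\<xi> x y. ek (x \<bullet> \<xi>) *s (k (x - y) \<odot> f y)"
  have eq: "?\<Phi> \<xi> x y = (ek ((x - y) \<bullet> \<xi>) *s k (x - y)) \<odot> (ek (y \<bullet> \<xi>) *s f y)" for \<xi> x y
    by (simp add: cl_bilinear vector_smult_assoc inner_diff_left flip: ek_add)
  have m: "(\<lambda>(x, y). ?\<Phi> \<xi> x y) \<in> borel_measurable (lborel \<Otimes>\<^sub>M lborel)" for \<xi>
    by measurable
  note ks = lborel_integrable_shift(2)[OF ft_integrable[OF k]] lborel_integral_shift(2)[OF ft_integrable[OF k]]
  note bl = bounded_bilinear.bounded_linear_left[OF bounded_bilinear_cl_mult]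
  have i: "integrable lborel (\<lambda>x. ?\<Phi> \<xi> x y)" for \<xi> y
    unfolding eq by (intro integrable_bounded_linear[OF bl] ks)
  have kn: "integrable lborel (\<lambda>x. norm (k (x - y)))" "(LINT x|lborel. norm (k (x - y))) = (LINT x|lborel. norm (k x))" for y
    using lborel_integrable_shift(2)[OF integrable_norm[OF k]] lborel_integral_shift(2)[OF integrable_norm[OF k]] by auto
  have n: "integrable lborel (\<lambda>y. LINT x|lborel. norm (?\<Phi> \<xi> x y))" for \<xi>
  proof (rule Bochner_Integration.integrable_bound)
    show "integrable lborel (\<lambda>y. cl_bound * (LINT x|lborel. norm (k x)) * norm (f y))"
      using f by (intro integrable_mult_right) simp
    have "(LINT x|lborel. norm (?\<Phi> \<xi> x y)) \<le> (LINT x|lborel. cl_bound * norm (f y) * norm (k (x - y)))" for y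
      by (intro integral_mono integrable_norm i integrable_mult_right kn(1))
        (use norm_cl_mult[of "k _" "f y"] in \<open>simp add: norm_smult mult_ac\<close>)
    then have "(LINT x|lborel. norm (?\<Phi> \<xi> x y)) \<le> cl_bound * (LINT x|lborel. norm (k x)) * norm (f y)" for y
      by (simp add: kn(2) mult_ac)
    then show "AE y in lborel. norm (LINT x|lborel. norm (?\<Phi> \<xi> x y)) \<le> norm (cl_bound * (LINT x|lborel. norm (k x)) * norm (f y))"
      using cl_bound_pos by (intro AE_I2) (simp add: abs_mult)
  qed measurable
  have i': "AE y in lborel. integrable lborel (\<lambda>x. ?\<Phi> \<xi> x y)" for \<xi>
    using i by simp
  show "integrable lborel (conv k f)"
    using Fubini_integrable_iterated[OF m i' n, of 0] by (simp add: conv_def[abs_def])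
  have "ft (conv k f) \<xi> = (LINT x|lborel. (LINT y|lborel. ?\<Phi> \<xi> x y))"
    unfolding ft_def
  proof (rule integral_cong_AE)
    have "AE x in lborel. integrable lborel (\<lambda>y. ?\<Phi> 0 x y)"
      using Fubini_AE_integrable[OF m i' n] .
    then show "AE x in lborel. ek (x \<bullet> \<xi>) *s conv k f x = (LINT y|lborel. ?\<Phi> \<xi> x y)"
    proof eventually_elim
      case (elim x)
      then have "integrable lborel (\<lambda>y. k (x - y) \<odot> f y)"
        by simp
      then show ?case
        unfolding conv_def
        by (rule integral_bounded_linear[OF bounded_bilinear.bounded_linear_right[OF bounded_bilinear_smult], symmetric])
    qed
  qed measurable
  also have "\<dots> = (LINT y|lborel. (LINT x|lborel. ?\<Phi> \<xi> x y))"
    by (rule Fubini_swap[OF m i' n])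
  also have "\<dots> = (LINT y|lborel. ft k \<xi> \<odot> (ek (y \<bullet> \<xi>) *s f y))"
    unfolding eq integral_bounded_linear[OF bl ks(1)] ks(2) by (simp add: ft_def)
  also have "\<dots> = ft k \<xi> \<odot> ft f \<xi>"
    unfolding ft_def[of f]
    by (intro integral_bounded_linear bounded_bilinear.bounded_linear_right[OF bounded_bilinear_cl_mult] ft_integrable f)
  finally show "ft (conv k f) \<xi> = ft k \<xi> \<odot> ft f \<xi>" .
qed

text \<open>The convolution theorem applies to the cuts of f. As the cuts grow, the convolutions
  converge at every point because k is in L^2, and the transforms converge in L^2 because
  \<open>ft k\<close> is bounded.\<close>

lemma is_multiplier_ft:
  assumes k: "integrable lborel k" and kL: "k \<in> L2"
  shows "is_multiplier k (ft k)"
  unfolding is_multiplier_def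
proof (intro conjI exI allI impI)
  have [measurable]: "k \<in> borel_measurable borel"
    using k by auto
  show km: "ft k \<in> borel_measurable borel"
    by measurable
  show C: "norm (ft k \<xi>) \<le> (LINT x|lborel. norm (k x))" for \<xi>
    by (rule norm_ft_le[OF k])
  fix f g assume fg: "has_fourier f g"
  have f: "f \<in> L2" and g: "g \<in> L2"
    using has_fourier_L2[OF fg] by simp_all
  have [measurable]: "f \<in> borel_measurable borel"
    by (rule L2_measurable[OF f])
  let ?f = "\<lambda>n. ball_cut (real n) f"
  note ct = ball_cut_integrable[OF f] ball_cut_L2[OF f]
  show "has_fourier (conv k f) (\<lambda>\<xi>. ft k \<xi> \<odot> g \<xi>)"
  proof (rule has_fourier_pointwise_limit)
    show "has_fourier (conv k (?f n)) (\<lambda>\<xi>. ft k \<xi> \<odot> ft (?f n) \<xi>)" for n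
    proof -
      have c1: "integrable lborel (conv k (?f n))"
        by (rule conv_L1[OF k ct(1)])
      let ?B = "cl_bound * (N2 k * N2 (?f n))"
      \<comment> \<open>A bounded integrable function is square integrable: the square is at most
        the bound \<open>?B\<close> times the norm.\<close>
      have "conv k (?f n) \<in> L2"
        unfolding L2_iff
      proof (rule conjI)
        show cm: "conv k (?f n) \<in> borel_measurable borel"
          using borel_measurable_integrable[OF c1] by simp
        show "integrable lborel (\<lambda>x. (norm (conv k (?f n) x))\<^sup>2)"
        proof (rule Bochner_Integration.integrable_bound)
          show "integrable lborel (\<lambda>x. ?B * norm (conv k (?f n) x))"
            by (intro integrable_mult_right integrable_norm c1)
          show "(\<lambda>x. (norm (conv k (?f n) x))\<^sup>2) \<in> borel_measurable lborel"
            using cm by simp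
          show "AE x in lborel. norm ((norm (conv k (?f n) x))\<^sup>2) \<le> norm (?B * norm (conv k (?f n) x))"
          proof (rule AE_I2)
            fix x
            have "norm (conv k (?f n) x) * norm (conv k (?f n) x) \<le> ?B * norm (conv k (?f n) x)"
              by (intro mult_right_mono norm_conv_le kL ct(2)) simp
            then show "norm ((norm (conv k (?f n) x))\<^sup>2) \<le> norm (?B * norm (conv k (?f n) x))"
              by (simp add: power2_eq_square)
          qed
        qed
      qed
      note hf = has_fourier_integrable[OF c1 this]
      have "ft (conv k (?f n)) = (\<lambda>\<xi>. ft k \<xi> \<odot> ft (?f n) \<xi>)"
        by (intro ext ft_conv k ct(1))
      from hf[unfolded this] show ?thesis .
    qed
    show "(\<lambda>\<xi>. ft k \<xi> \<odot> g \<xi>) \<in> L2"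
      by (rule L2_cl_mult[OF km C g])
    have l: "(\<lambda>n. N2 (\<lambda>\<xi>. ft (?f n) \<xi> - g \<xi>)) \<longlonglongrightarrow> 0"
      using has_fourier_L2_lim[OF fg] by (simp add: L2_lim_iff)
    show "(\<lambda>n. N2 (\<lambda>\<xi>. ft k \<xi> \<odot> ft (?f n) \<xi> - ft k \<xi> \<odot> g \<xi>)) \<longlonglongrightarrow> 0"
    proof (rule Lim_null_comparison)
      show "(\<lambda>n. cl_bound * (LINT x|lborel. norm (k x)) * N2 (\<lambda>\<xi>. ft (?f n) \<xi> - g \<xi>)) \<longlonglongrightarrow> 0"
        by (rule tendsto_mult_right_zero[OF l])
      show "\<forall>\<^sub>F n in sequentially. norm (N2 (\<lambda>\<xi>. ft k \<xi> \<odot> ft (?f n) \<xi> - ft k \<xi> \<odot> g \<xi>))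
          \<le> cl_bound * (LINT x|lborel. norm (k x)) * N2 (\<lambda>\<xi>. ft (?f n) \<xi> - g \<xi>)"
        unfolding cl_bilinear(4)[symmetric] real_norm_def abs_of_nonneg[OF N2_nonneg]
        by (intro always_eventually allI N2_cl_mult[OF km C L2_diff[OF ft_L2[OF ct] g]])
    qed
    show "(\<lambda>n. conv k (?f n) x) \<longlonglongrightarrow> conv k f x" for x
    proof (rule LIM_zero_cancel, rule Lim_null_comparison)
      have "(\<lambda>n. N2 (\<lambda>x. ?f n x - f x)) \<longlonglongrightarrow> 0"
        using ball_cut_L2_lim[OF f] by (simp add: L2_lim_iff)
      then show "(\<lambda>n. cl_bound * (N2 k * N2 (\<lambda>x. ?f n x - f x))) \<longlonglongrightarrow> 0"
        by (intro tendsto_mult_right_zero)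
      have "conv k (?f n) x - conv k f x = conv k (\<lambda>x. ?f n x - f x) x" for n
        unfolding conv_def cl_bilinear
        by (rule Bochner_Integration.integral_diff[symmetric]; rule conv_integrable[OF kL])
          (rule ct(2) f)+
      then show "\<forall>\<^sub>F n in sequentially. norm (conv k (?f n) x - conv k f x) \<le> cl_bound * (N2 k * N2 (\<lambda>x. ?f n x - f x))"
        using norm_conv_le[OF kL L2_diff[OF ct(2) f]] by (simp add: always_eventually)
    qed
    show "conv k f \<in> borel_measurable borel"
      by measurable
  qed
qed (rule kL)

lemma is_multiplier_add:
  assumes "is_multiplier k m" "is_multiplier k' m'"
  shows "is_multiplier (\<lambda>x. k x + k' x) (\<lambda>\<xi>. m \<xi> + m' \<xi>)"
  unfolding is_multiplier_def
proof (intro conjI allI impI)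
  note D = is_multiplierD[OF assms(1)] is_multiplierD[OF assms(2)]
  show "(\<lambda>x. k x + k' x) \<in> L2"
    by (intro L2_add D)
  show "(\<lambda>\<xi>. m \<xi> + m' \<xi>) \<in> borel_measurable borel"
    using D(2,6) by measurable
  obtain C C' where "\<And>\<xi>. norm (m \<xi>) \<le> C" "\<And>\<xi>. norm (m' \<xi>) \<le> C'"
    using D(3,7) by blast
  then have "norm (m \<xi> + m' \<xi>) \<le> C + C'" for \<xi>
    by (rule norm_triangle_mono)
  then show "\<exists>C. \<forall>\<xi>. norm (m \<xi> + m' \<xi>) \<le> C"
    by blast
  fix f g assume fg: "has_fourier f g"
  have f: "f \<in> L2"
    using has_fourier_L2(1)[OF fg] .
  have "conv (\<lambda>x. k x + k' x) f = (\<lambda>x. conv k f x + conv k' f x)"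
    unfolding conv_def cl_bilinear
    by (intro ext Bochner_Integration.integral_add conv_integrable D f)
  then show "has_fourier (conv (\<lambda>x. k x + k' x) f) (\<lambda>\<xi>. (m \<xi> + m' \<xi>) \<odot> g \<xi>)"
    using has_fourier_add[OF D(4)[OF fg] D(8)[OF fg]] by (simp add: cl_bilinear)
qed

text \<open>A common majorant of the kernels in L^2 gives pointwise convergence of the convolutions,
  a common bound of the multipliers gives convergence of the transforms in L^2. This is the passage
  to kernels that are not integrable.\<close>

lemma is_multiplier_limit:
  fixes k :: "nat \<Rightarrow> real ^ 3 \<Rightarrow> cl3" and h :: "real ^ 3 \<Rightarrow> real"
  assumes km: "\<And>n. is_multiplier (k n) (m n)"
    and dom: "\<And>n z. norm (k n z) \<le> norm (h z)" and h: "h \<in> L2"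
    and k: "\<And>z. (\<lambda>n. k n z) \<longlonglongrightarrow> k' z"
    and C: "\<And>n \<xi>. norm (m n \<xi>) \<le> C" and m: "\<And>\<xi>. (\<lambda>n. m n \<xi>) \<longlonglongrightarrow> m' \<xi>"
  shows "is_multiplier k' m'"
  unfolding is_multiplier_def
proof (intro conjI allI impI exI)
  note D = is_multiplierD[OF km]
  have [measurable]: "k n \<in> borel_measurable borel" "m n \<in> borel_measurable borel" for n
    by (rule L2_measurable[OF D(1)], rule D(2))
  have [measurable]: "k' \<in> borel_measurable borel"
    by (rule borel_measurable_LIMSEQ_metric[where f = k]) (simp_all add: k)
  show [measurable]: "m' \<in> borel_measurable borel"
    by (rule borel_measurable_LIMSEQ_metric[where f = m]) (simp_all add: m)
  have dom': "norm (k' z) \<le> norm (h z)" for z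
    by (rule tendsto_upperbound[OF tendsto_norm[OF k[of z]] always_eventually[OF allI[OF dom]]]) simp
  show k'L: "k' \<in> L2"
    by (rule L2_dominated[OF h, of _ 1]) (simp_all add: dom'[unfolded real_norm_def])
  show C': "norm (m' \<xi>) \<le> C" for \<xi>
    by (rule tendsto_upperbound[OF tendsto_norm[OF m[of \<xi>]]]) (simp_all add: C)
  fix f g assume fg: "has_fourier f g"
  have f: "f \<in> L2" and g: "g \<in> L2"
    using has_fourier_L2[OF fg] by simp_all
  have [measurable]: "f \<in> borel_measurable borel" "h \<in> borel_measurable borel"
    by (rule L2_measurable[OF f], rule L2_measurable[OF h])
  show "has_fourier (conv k' f) (\<lambda>\<xi>. m' \<xi> \<odot> g \<xi>)"
  proof (rule has_fourier_pointwise_limit)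
    show "has_fourier (conv (k n) f) (\<lambda>\<xi>. m n \<xi> \<odot> g \<xi>)" for n
      by (rule D(4)[OF fg])
    show "(\<lambda>\<xi>. m' \<xi> \<odot> g \<xi>) \<in> L2"
      by (rule L2_cl_mult[OF _ C' g]) measurable
    show "(\<lambda>n. N2 (\<lambda>\<xi>. m n \<xi> \<odot> g \<xi> - m' \<xi> \<odot> g \<xi>)) \<longlonglongrightarrow> 0"
      by (rule N2_cl_mult_tendsto[OF _ _ C C' m g]) measurable
    show "(\<lambda>n. conv (k n) f x) \<longlonglongrightarrow> conv k' f x" for x
      unfolding conv_def
    proof (rule integral_dominated_convergence)
      show "integrable lborel (\<lambda>y. cl_bound * (norm (h (x - y)) * norm (f y)))"
        by (intro integrable_mult_right norm_mult_integrable L2_shift(3) h f)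
      show "AE y in lborel. norm (k n (x - y) \<odot> f y) \<le> cl_bound * (norm (h (x - y)) * norm (f y))" for n
        using cl_bound_pos by (intro AE_I2 order_trans[OF norm_cl_mult] mult_left_mono mult_right_mono dom) auto
      show "AE y in lborel. (\<lambda>n. k n (x - y) \<odot> f y) \<longlonglongrightarrow> k' (x - y) \<odot> f y"
        by (intro AE_I2 bounded_bilinear.tendsto[OF bounded_bilinear_cl_mult] k tendsto_const)
    qed measurable
    show "conv k' f \<in> borel_measurable borel"
      by measurable
  qed
qed

text \<open>The multipliers converge boundedly, so dominated convergence on the transform side and
  Plancherel give convergence in L^2 without any estimate of the kernels. This is how the principal
  value is reached.\<close>

lemma is_multiplier_L2_lim:
  fixes k :: "real \<Rightarrow> real ^ 3 \<Rightarrow> cl3"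
  assumes km: "\<And>\<epsilon>. 0 < \<epsilon> \<Longrightarrow> is_multiplier (k \<epsilon>) (m \<epsilon>)"
    and C: "\<And>\<epsilon> \<xi>. 0 < \<epsilon> \<Longrightarrow> norm (m \<epsilon> \<xi>) \<le> C" and m: "\<And>\<xi>. ((\<lambda>\<epsilon>. m \<epsilon> \<xi>) \<longlongrightarrow> m' \<xi>) (at_right 0)"
    and fg: "has_fourier f g" and h: "has_fourier h (\<lambda>\<xi>. m' \<xi> \<odot> g \<xi>)" and m'[measurable]: "m' \<in> borel_measurable borel"
  shows "L2_lim (\<lambda>\<epsilon>. conv (k \<epsilon>) f) (at_right 0) h"
proof -
  have g: "g \<in> L2"
    using has_fourier_L2(2)[OF fg] .
  have C': "norm (m' \<xi>) \<le> C" for \<xi>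
    by (rule tendsto_upperbound[OF tendsto_norm[OF m[of \<xi>]]])
      (auto simp: eventually_at_right_less intro: eventually_mono[OF eventually_at_right_less] C)
  have F: "has_fourier (conv (k \<epsilon>) f) (\<lambda>\<xi>. m \<epsilon> \<xi> \<odot> g \<xi>)" if "0 < \<epsilon>" for \<epsilon>
    using is_multiplierD(4)[OF km[OF that] fg] .
  have "((\<lambda>\<epsilon>. N2 (\<lambda>x. conv (k \<epsilon>) f x - h x)) \<longlongrightarrow> 0) (at_right 0)"
  proof (rule tendsto_at_right_sequentially[OF zero_less_one])
    fix S :: "nat \<Rightarrow> real" assume S: "\<And>n. 0 < S n" "S \<longlonglongrightarrow> 0"
    have S': "filterlim S (at_right 0) sequentially"
    proof -
      have "S n \<noteq> 0" for n
        using S(1)[of n] by simp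
      then show ?thesis
        using S by (simp add: filterlim_at always_eventually)
    qed
    have [measurable]: "m (S n) \<in> borel_measurable borel" for n
      using is_multiplierD(2)[OF km[OF S(1)]] .
    have "(\<lambda>n. N2 (\<lambda>\<xi>. m (S n) \<xi> \<odot> g \<xi> - m' \<xi> \<odot> g \<xi>)) \<longlonglongrightarrow> 0"
      by (rule N2_cl_mult_tendsto[OF _ _ C[OF S(1)] C' filterlim_compose[OF m S'] g]) measurable
    then show "(\<lambda>n. N2 (\<lambda>x. conv (k (S n)) f x - h x)) \<longlonglongrightarrow> 0"
      using has_fourier_N2[OF has_fourier_diff[OF F[OF S(1)] h]] by simp
  qed
  moreover have "\<forall>\<^sub>F \<epsilon> in at_right 0. conv (k \<epsilon>) f \<in> L2"
    using eventually_at_right_less[of "0::real"] by eventually_elim (rule has_fourier_L2(1)[OF F])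
  ultimately show ?thesis
    using has_fourier_L2(1)[OF h] by (simp add: L2_lim_iff)
qed

section \<open>A Gaussian superposition for the Hilbert kernel\<close>

text \<open>The error function at \<open>sqrt pi * u\<close>. As the increment of one antiderivative
  between -u and u it is differentiable everywhere and, for u \<ge> 0, the integral over
  \<open>{-u..u}\<close>.\<close>

definition erf_pi :: "real \<Rightarrow> real" where
  "erf_pi u = (LBINT x=0..u. exp (- pi * x\<^sup>2)) - (LBINT x=0..-u. exp (- pi * x\<^sup>2))"

lemma exp_pi_antideriv:
  "((\<lambda>u. LBINT x=0..u. exp (- pi * x\<^sup>2)) has_real_derivative exp (- pi * u\<^sup>2)) (at u)"
proof -
  \<comment> \<open>An interval that contains 0 and has u in its interior, so that the derivative
    within it is a full derivative.\<close>
  let ?a = "- \<bar>u\<bar> - 1" and ?b = "\<bar>u\<bar> + 1"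
  have "((\<lambda>u. LBINT x=ereal 0..u. exp (- pi * x\<^sup>2)) has_vector_derivative exp (- pi * u\<^sup>2)) (at u within {?a..?b})"
    by (rule interval_integral_FTC2) (auto intro!: continuous_intros)
  moreover have "at u within {?a..?b} = at u"
    by (rule at_within_interior) auto
  ultimately show ?thesis
    by (simp add: has_real_derivative_iff_has_vector_derivative zero_ereal_def)
qed

lemma erf_pi_deriv[derivative_intros]:
  "(f has_real_derivative D) (at x) \<Longrightarrow> ((\<lambda>x. erf_pi (f x)) has_real_derivative 2 * exp (- pi * (f x)\<^sup>2) * D) (at x)"
proof -
  have "(erf_pi has_real_derivative 2 * exp (- pi * u\<^sup>2)) (at u)" for u
    unfolding erf_pi_def[abs_def]
    using DERIV_diff[OF exp_pi_antideriv DERIV_chain2[OF exp_pi_antideriv[of "- u"] DERIV_minus[OF DERIV_ident]]] by simp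
  then show "(f has_real_derivative D) (at x) \<Longrightarrow> ((\<lambda>x. erf_pi (f x)) has_real_derivative 2 * exp (- pi * (f x)\<^sup>2) * D) (at x)"
    by (rule DERIV_chain2)
qed

lemma erf_pi_0[simp]: "erf_pi 0 = 0"
  by (simp add: erf_pi_def)

lemma erf_pi_isCont: "isCont erf_pi u"
  using erf_pi_deriv[OF DERIV_ident] by (rule DERIV_isCont)

lemma exp_pi_integrable: "integrable lborel (\<lambda>x::real. exp (- pi * x\<^sup>2))"
  and exp_pi_integral: "(LINT x|lborel. exp (- pi * x\<^sup>2)) = (1::real)"
proof -
  have i: "integrable lborel (\<lambda>x. complex_of_real (exp (- pi * x\<^sup>2)))"
    using gauss_line_integrable[of 1 0] by simp
  from integrable_Re[OF this] show "integrable lborel (\<lambda>x::real. exp (- pi * x\<^sup>2))"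
    by simp
  have "(LINT x|lborel. complex_of_real (exp (- pi * x\<^sup>2))) = 1"
    using gauss_line[of 1 0] by simp
  then have "complex_of_real (LINT x|lborel. exp (- pi * x\<^sup>2)) = 1"
    by (simp only: integral_complex_of_real)
  then show "(LINT x|lborel. exp (- pi * x\<^sup>2)) = (1::real)"
    by (simp only: of_real_eq_1_iff)
qed

lemma erf_pi_eq: "0 \<le> u \<Longrightarrow> erf_pi u = (LINT x|lborel. indicator {-u..u} x *\<^sub>R exp (- pi * x\<^sup>2))"
  unfolding erf_pi_def
  by (rule integral_FTC_atLeastAtMost[symmetric], simp, rule has_vector_derivative_at_within,
      rule exp_pi_antideriv[unfolded has_real_derivative_iff_has_vector_derivative], intro continuous_intros)

lemma erf_pi_bounds: "0 \<le> u \<Longrightarrow> 0 \<le> erf_pi u" "0 \<le> u \<Longrightarrow> erf_pi u \<le> 1"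
proof -
  assume u: "0 \<le> u"
  show "0 \<le> erf_pi u"
    unfolding erf_pi_eq[OF u] by (intro Bochner_Integration.integral_nonneg) simp
  have "erf_pi u \<le> (LINT x|lborel. exp (- pi * x\<^sup>2))"
    unfolding erf_pi_eq[OF u]
    by (intro integral_mono exp_pi_integrable integrable_mult_indicator) (auto simp: indicator_def)
  then show "erf_pi u \<le> 1"
    by (simp only: exp_pi_integral)
qed

lemma erf_pi_tendsto_1: "(erf_pi \<longlongrightarrow> 1) at_top"
proof -
  have "((\<lambda>u. LINT x|lborel. indicator {-u..u} x *\<^sub>R exp (- pi * x\<^sup>2)) \<longlongrightarrow> (LINT x|lborel. exp (- pi * x\<^sup>2))) at_top"
  proof (rule integral_dominated_convergence_at_top[OF _ _ exp_pi_integrable])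
    have "((\<lambda>u. indicator {-u..u} x *\<^sub>R exp (- pi * x\<^sup>2)) \<longlongrightarrow> exp (- pi * x\<^sup>2)) at_top" for x :: real
    proof (rule tendsto_eventually)
      show "\<forall>\<^sub>F u in at_top. indicator {-u..u} x *\<^sub>R exp (- pi * x\<^sup>2) = exp (- pi * x\<^sup>2)"
        using eventually_ge_at_top[of "\<bar>x\<bar>"] by eventually_elim (auto simp: indicator_def)
    qed
    then show "AE x in lborel. ((\<lambda>u. indicator {-u..u} x *\<^sub>R exp (- pi * x\<^sup>2)) \<longlongrightarrow> exp (- pi * x\<^sup>2)) at_top"
      by simp
    show "\<forall>\<^sub>F u in at_top. AE x in lborel. norm (indicator {-u..u} x *\<^sub>R exp (- pi * x\<^sup>2)) \<le> exp (- pi * x\<^sup>2)"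
      by (intro always_eventually allI AE_I2) (auto simp: indicator_def)
  qed measurable
  then have "((\<lambda>u. LINT x|lborel. indicator {-u..u} x *\<^sub>R exp (- pi * x\<^sup>2)) \<longlongrightarrow> 1) at_top"
    by (simp only: exp_pi_integral)
  then show ?thesis
    by (rule Lim_transform_eventually) (use eventually_ge_at_top[of 0] in \<open>eventually_elim, simp add: erf_pi_eq\<close>)
qed

text \<open>The superposition over \<open>{a..b}\<close> with q in place of |z|^2. For a = 0 and b
  \<rightarrow> \<infinity> it tends to 1 / (pi q)^2 when q > 0.\<close>

definition radial_part :: "real \<Rightarrow> real \<Rightarrow> real \<Rightarrow> real" where
  "radial_part a b q = (LINT t|lborel. indicator {a..b} t *\<^sub>R (t * exp (- pi * t * q)))"

lemma radial_part_eq: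
  assumes q: "0 < q" and ab: "a \<le> b"
  shows "radial_part a b q = (a / (pi * q) + 1 / (pi * q)\<^sup>2) * exp (- pi * a * q) - (b / (pi * q) + 1 / (pi * q)\<^sup>2) * exp (- pi * b * q)"
proof -
  let ?F = "\<lambda>t. - (t / (pi * q) + 1 / (pi * q)\<^sup>2) * exp (- pi * t * q)"
  have d: "(?F has_real_derivative t * exp (- pi * t * q)) (at t)" for t
    using q by (auto intro!: derivative_eq_intros simp: field_simps power2_eq_square)
  have "radial_part a b q = ?F b - ?F a"
    unfolding radial_part_def
    by (rule integral_FTC_atLeastAtMost[OF ab], rule has_vector_derivative_at_within,
        rule d[unfolded has_real_derivative_iff_has_vector_derivative], intro continuous_intros)
  then show ?thesis
    by (simp only: mult_minus_left diff_minus_eq_add uminus_add_conv_diff)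
qed

lemma radial_part_integrable: "integrable lborel (\<lambda>t. indicator {a..b} t *\<^sub>R (t * exp (- pi * t * q)))"
  by (intro borel_integrable_compact) (auto intro!: continuous_intros)

lemma radial_part_nonneg: "0 \<le> a \<Longrightarrow> 0 \<le> radial_part a b q"
  unfolding radial_part_def by (intro Bochner_Integration.integral_nonneg) (auto simp: indicator_def)

lemma radial_part_mono: "0 \<le> a \<Longrightarrow> radial_part a b q \<le> radial_part 0 b q"
  unfolding radial_part_def by (intro integral_mono radial_part_integrable) (auto simp: indicator_def)

text \<open>This bound serves near the origin, \<open>radial_part_le'\<close> away from it.\<close>

lemma radial_part_le:
  assumes b: "0 \<le> b" and q: "0 \<le> q" shows "radial_part 0 b q \<le> b\<^sup>2"
proof -
  have "radial_part 0 b q \<le> (LINT t|lborel. indicator {0..b} t *\<^sub>R b)"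
    unfolding radial_part_def
  proof (intro integral_mono radial_part_integrable)
    show "integrable lborel (\<lambda>t. indicator {0..b} t *\<^sub>R b)"
      by (intro integrable_scaleR_left integrable_real_indicator) (auto simp: ennreal_less_top b)
    fix t
    have "t * exp (- pi * t * q) \<le> b" if "0 \<le> t" "t \<le> b"
      using mult_mono[of t b "exp (- pi * t * q)" 1] that q b by simp
    then show "indicator {0..b} t *\<^sub>R (t * exp (- pi * t * q)) \<le> indicator {0..b} t *\<^sub>R b"
      by (auto simp: indicator_def)
  qed
  also have "\<dots> = b\<^sup>2"
    using b by (simp add: power2_eq_square)
  finally show ?thesis .
qed

lemma radial_part_le': "0 < q \<Longrightarrow> 0 \<le> b \<Longrightarrow> radial_part 0 b q \<le> 1 / (pi * q)\<^sup>2"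
  by (simp add: radial_part_eq)

text \<open>The factor reflects the substitution of t / e^2 for t in the integral, although it is
  read off the closed form here. It is what makes \<open>kernel_diff\<close> a family of
  dilations.\<close>

lemma radial_part_scale:
  assumes e: "0 < e" and q: "0 < q"
  shows "radial_part 0 (1 / e\<^sup>2) q = (1 / e^4) * radial_part 0 1 (q / e\<^sup>2)"
proof -
  have "e^4 = e\<^sup>2 * e\<^sup>2"
    by (simp add: power2_eq_square power4_eq_xxxx)
  then show ?thesis
    using assms by (simp add: radial_part_eq field_simps power2_eq_square)
qed

text \<open>Comparable with the minimum of 1 and |z|^-3: square integrable, and up to a constant a
  majorant of the Gaussian kernels, a = 0 included.\<close>

definition kernel_bound :: "real ^ 3 \<Rightarrow> real" where
  "kernel_bound z = 1 / sqrt (1 + (norm z)\<^sup>2) ^ 3"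

lemma kernel_bound_pos: "0 < kernel_bound z"
  by (simp add: kernel_bound_def add_pos_nonneg)

lemma measurable_kernel_bound[measurable]: "kernel_bound \<in> borel_measurable borel"
  unfolding kernel_bound_def[abs_def] by measurable

text \<open>The square is a product of three factors 1 / (1 + |z|^2), and these are at most 1 / (1 +
  z_i^2) for the three coordinates; Fubini then reduces the claim to the derivative of
  arctan.\<close>

lemma kernel_bound_L2: "kernel_bound \<in> L2"
proof -
  have "integrable lborel (\<lambda>x::real. inverse (1 + x\<^sup>2))"
  proof -
    have "set_integrable lborel (einterval (-\<infinity>) \<infinity>) (\<lambda>x::real. inverse (1 + x\<^sup>2))"
    proof (rule interval_integral_FTC_nonneg(1)[where F = arctan and A = "- (pi / 2)" and B = "pi / 2"])
      show "((arctan \<circ> real_of_ereal) \<longlongrightarrow> - (pi / 2)) (at_right (- \<infinity>))"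
        "((arctan \<circ> real_of_ereal) \<longlongrightarrow> pi / 2) (at_left \<infinity>)"
        using tendsto_arctan_at_bot tendsto_arctan_at_top by (simp_all add: ereal_tendsto_simps)
      show "isCont (\<lambda>x. inverse (1 + x\<^sup>2)) x" for x :: real
        by (intro continuous_intros) (simp add: add_nonneg_eq_0_iff)
      show "DERIV arctan x :> inverse (1 + x\<^sup>2)" for x
        by (rule DERIV_arctan)
      show "AE x :: real in lborel. - \<infinity> < ereal x \<longrightarrow> ereal x < \<infinity> \<longrightarrow> 0 \<le> inverse (1 + x\<^sup>2)"
        by simp
    qed simp
    then show ?thesis
      by (simp add: set_integrable_def)
  qed
  then have "integrable lborel (\<lambda>z :: real^3. \<Prod>i\<in>UNIV. complex_of_real (inverse (1 + (z $ i)\<^sup>2)))"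
    by (intro lborel_vec_integrable_prod integrable_of_real)
  from integrable_norm[OF this]
  have int: "integrable lborel (\<lambda>z :: real^3. \<Prod>i\<in>UNIV. inverse (1 + (z $ i)\<^sup>2))"
  proof -
    have "norm (\<Prod>i\<in>UNIV. complex_of_real (inverse (1 + (z $ i)\<^sup>2))) = (\<Prod>i\<in>UNIV. inverse (1 + (z $ i)\<^sup>2))"
      for z :: "real ^ 3"
      unfolding prod_norm[symmetric] norm_of_real by simp
    with \<open>integrable lborel (\<lambda>z :: real^3. norm _)\<close> show ?thesis by (simp only:)
  qed
  show ?thesis
    unfolding L2_iff
  proof (rule conjI)
    show "integrable lborel (\<lambda>z. (norm (kernel_bound z))\<^sup>2)"
    proof (rule Bochner_Integration.integrable_bound[OF int])
      have "(norm (kernel_bound z))\<^sup>2 \<le> (\<Prod>i\<in>UNIV. inverse (1 + (z $ i)\<^sup>2))" for z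
      proof -
        have w: "0 < 1 + (norm z)\<^sup>2"
          by (simp add: add_pos_nonneg)
        have "(norm (kernel_bound z))\<^sup>2 = inverse ((1 + (norm z)\<^sup>2) ^ 3)"
        proof -
          have "(sqrt (1 + (norm z)\<^sup>2) ^ 3)\<^sup>2 = (sqrt (1 + (norm z)\<^sup>2) ^ 2) ^ 3"
            by (simp only: power_mult[symmetric] mult.commute)
          also have "\<dots> = (1 + (norm z)\<^sup>2) ^ 3"
            using w by (simp only: real_sqrt_pow2 less_imp_le)
          finally show ?thesis
            by (simp only: kernel_bound_def real_norm_def power2_abs power_one_over power_divide power_one inverse_eq_divide)
        qed
        also have "\<dots> = (\<Prod>i\<in>(UNIV :: 3 set). inverse (1 + (norm z)\<^sup>2))"
          by (simp add: power_inverse)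
        also have "\<dots> \<le> (\<Prod>i\<in>UNIV. inverse (1 + (z $ i)\<^sup>2))"
        proof (intro prod_mono conjI)
          fix i
          have "\<bar>z $ i\<bar>\<^sup>2 \<le> (norm z)\<^sup>2"
            by (intro power_mono component_le_norm_cart) simp
          then show "inverse (1 + (norm z)\<^sup>2) \<le> inverse (1 + (z $ i)\<^sup>2)"
            by (intro le_imp_inverse_le) (simp_all add: add_pos_nonneg)
          show "0 \<le> inverse (1 + (norm z)\<^sup>2)"
            using w by simp
        qed
        finally show ?thesis .
      qed
      then show "AE z in lborel. norm ((norm (kernel_bound z))\<^sup>2) \<le> norm (\<Prod>i\<in>UNIV. inverse (1 + (z $ i)\<^sup>2))"
        by (intro AE_I2) (simp add: order_trans[OF _ abs_ge_self])
    qed simp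
  qed measurable
qed

text \<open>The constant is 2^3: \<open>sqrt (1 + (norm z)\<^sup>2)\<close> is at most 2 in the unit
  ball and at most \<open>2 * norm z\<close> outside.\<close>

lemma kernel_bound_lower:
  "norm z \<le> 1 \<Longrightarrow> 1 \<le> 8 * kernel_bound z" "1 \<le> norm z \<Longrightarrow> 1 / norm z ^ 3 \<le> 8 * kernel_bound z"
proof -
  let ?w = "sqrt (1 + (norm z)\<^sup>2)"
  have w: "0 < ?w"
    by (simp add: add_pos_nonneg)
  {
    assume "norm z \<le> 1"
    then have "(norm z)\<^sup>2 \<le> 1"
      by (simp add: power_le_one)
    then have "?w \<le> 2"
      by (intro real_le_lsqrt) auto
    then have "?w ^ 3 \<le> 2 ^ 3"
      using w by (intro power_mono) auto
    then show "1 \<le> 8 * kernel_bound z"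
      using w by (simp add: kernel_bound_def)
  next
    assume z: "1 \<le> norm z"
    then have "1 \<le> (norm z)\<^sup>2"
      by (simp add: one_le_power)
    then have "?w \<le> 2 * norm z"
      by (intro real_le_lsqrt) (auto simp: power_mult_distrib)
    then have "?w ^ 3 \<le> (2 * norm z) ^ 3"
      using w by (intro power_mono) auto
    then have "1 * ?w ^ 3 \<le> 8 * norm z ^ 3"
      by (simp add: power_mult_distrib)
    moreover have "0 < norm z ^ 3"
      using z by (intro zero_less_power) linarith
    ultimately show "1 / norm z ^ 3 \<le> 8 * kernel_bound z"
      using w by (simp add: kernel_bound_def divide_simps)
  }
qed

text \<open>Inside the unit ball the bound b^2 is used, outside the decay 1 / (pi |z|^2)^2, which
  after multiplication by |z| leaves |z|^-3.\<close>

lemma radial_part_norm_le: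
  assumes b: "0 \<le> b"
  shows "radial_part 0 b ((norm z)\<^sup>2) * norm z \<le> 8 * (b\<^sup>2 + 1) * kernel_bound (z :: real ^ 3)"
proof (cases "norm z \<le> 1")
  case True
  have "radial_part 0 b ((norm z)\<^sup>2) * norm z \<le> b\<^sup>2 * 1"
    using True radial_part_le[OF b] radial_part_nonneg by (intro mult_mono) auto
  also have "\<dots> \<le> (b\<^sup>2 + 1) * (8 * kernel_bound z)"
    using kernel_bound_lower(1)[OF True] by (intro mult_mono) auto
  finally show ?thesis by (simp add: mult_ac)
next
  case False
  then have z: "1 < norm z" by simp
  have "radial_part 0 b ((norm z)\<^sup>2) * norm z \<le> 1 / (pi * (norm z)\<^sup>2)\<^sup>2 * norm z"
    using z b by (intro mult_right_mono radial_part_le') auto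
  also have "\<dots> = (1 / pi\<^sup>2) * (1 / norm z ^ 3)"
    using z by (simp add: field_simps power2_eq_square power3_eq_cube)
  also have "\<dots> \<le> 1 * (8 * kernel_bound z)"
  proof (intro mult_mono)
    have "1 \<le> pi\<^sup>2"
      using pi_gt3 by (intro one_le_power) simp
    then show "1 / pi\<^sup>2 \<le> 1" by simp
    show "1 / norm z ^ 3 \<le> 8 * kernel_bound z"
      using z by (intro kernel_bound_lower(2)) simp
  qed auto
  also have "\<dots> \<le> (b\<^sup>2 + 1) * (8 * kernel_bound z)"
    using kernel_bound_pos[of z] by (intro mult_right_mono) auto
  finally show ?thesis by (simp add: mult_ac)
qed

section \<open>Vectors, the symbol of the Hilbert transformation and Gaussian kernels\<close>

lemma bounded_linear_cl_vec: "bounded_linear cl_vec"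
proof -
  have "linear cl_vec"
    by (auto intro!: linearI simp: cl_vec_def scaleR_add_left scaleR_add_right)
  then show ?thesis
    by (simp add: linear_conv_bounded_linear)
qed

lemmas cl_vec_linear = linear_0[OF bounded_linear.linear[OF bounded_linear_cl_vec]]
  linear_cmul[OF bounded_linear.linear[OF bounded_linear_cl_vec]]
  linear_neg[OF bounded_linear.linear[OF bounded_linear_cl_vec]]

lemma norm_cl_vec: "norm (cl_vec z) = norm z"
proof -
  have "(norm (cl_vec z))\<^sup>2 = (norm z)\<^sup>2"
    by (simp add: power2_norm_eq_inner cl_vec_def e1_def e2_def e3_def inner_add_left inner_add_right
        inner_axis_axis inner_vec_def[of z] sum_3)
  then show ?thesis
    by (simp add: power2_eq_iff_nonneg)
qed

lemma measurable_cl_vec[measurable]: "cl_vec \<in> borel_measurable borel"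
  by (intro borel_measurable_continuous_onI linear_continuous_on bounded_linear_cl_vec)

text \<open>On vectors \<open>sgn\<close> is the normalization, with value 0 at the origin, which is
  a null set.\<close>

definition hilbert_symbol :: "real ^ 3 \<Rightarrow> cl3" where
  "hilbert_symbol \<xi> = (- \<i>) *s cl_vec (sgn \<xi>)"

lemma measurable_hilbert_symbol[measurable]: "hilbert_symbol \<in> borel_measurable borel"
proof -
  have [measurable]: "(sgn :: real^3 \<Rightarrow> _) \<in> borel_measurable borel"
    unfolding sgn_div_norm[abs_def] by measurable
  show ?thesis unfolding hilbert_symbol_def[abs_def] by measurable
qed

lemma norm_hilbert_symbol_le: "norm (hilbert_symbol \<xi>) \<le> 1"
  by (simp add: hilbert_symbol_def norm_smult norm_cl_vec norm_sgn)

lemma norm_scaleR_hilbert_symbol: "norm \<xi> *\<^sub>R hilbert_symbol \<xi> = (- \<i>) *s cl_vec \<xi>"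
  by (cases "\<xi> = 0") (simp_all add: hilbert_symbol_def sgn_div_norm cl_vec_linear smult_scaleR)

text \<open>For \<open>a \<rightarrow> 0\<close> and \<open>b \<rightarrow> \<infinity>\<close> the kernel \<open>gauss_kernel a b\<close> tends to \<open>cl_vec z / (pi^2 |z|^4)\<close>.\<close>

definition gauss_kernel :: "real \<Rightarrow> real \<Rightarrow> real ^ 3 \<Rightarrow> cl3" where
  "gauss_kernel a b z = radial_part a b ((norm z)\<^sup>2) *\<^sub>R cl_vec z"

lemma measurable_gauss_kernel[measurable]: "gauss_kernel a b \<in> borel_measurable borel"
  unfolding gauss_kernel_def radial_part_def by measurable

lemma norm_gauss_kernel_le: "0 \<le> a \<Longrightarrow> 0 \<le> b \<Longrightarrow> norm (gauss_kernel a b z) \<le> 8 * (b\<^sup>2 + 1) * kernel_bound z"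
proof -
  assume a: "0 \<le> a" and b: "0 \<le> b"
  have "norm (gauss_kernel a b z) = radial_part a b ((norm z)\<^sup>2) * norm z"
    using radial_part_nonneg[OF a] by (simp add: gauss_kernel_def norm_cl_vec)
  also have "\<dots> \<le> radial_part 0 b ((norm z)\<^sup>2) * norm z"
    by (intro mult_right_mono radial_part_mono a) simp
  also have "\<dots> \<le> 8 * (b\<^sup>2 + 1) * kernel_bound z"
    by (rule radial_part_norm_le[OF b])
  finally show ?thesis .
qed

lemma gauss_kernel_L2:
  assumes "0 \<le> a" "0 \<le> b" shows "gauss_kernel a b \<in> L2"
proof (rule L2_dominated[OF kernel_bound_L2 measurable_gauss_kernel])
  show "AE z in lborel. norm (gauss_kernel a b z) \<le> 8 * (b\<^sup>2 + 1) * norm (kernel_bound z)"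
    by (intro AE_I2) (simp only: real_norm_def abs_of_pos[OF kernel_bound_pos] norm_gauss_kernel_le[OF assms])
qed simp

lemma
  assumes t: "0 < t"
  shows gauss_cl_vec_integrable: "integrable lborel (\<lambda>z. gauss t z *\<^sub>R (ek (z \<bullet> \<xi>) *s cl_vec z))"
    and gauss_cl_vec_integral: "(LINT z|lborel. gauss t z *\<^sub>R (ek (z \<bullet> \<xi>) *s cl_vec z))
      = (gauss (1 / t) \<xi> / sqrt t ^ 3 / t) *\<^sub>R ((- \<i>) *s cl_vec \<xi>)"
proof -
  let ?g = "\<lambda>j z. complex_of_real (z $ j * gauss t z) * ek (z \<bullet> \<xi>)"
  have g: "integrable lborel (?g j)" for j
    using gauss_moment_ek_integrable[OF t, of j \<xi>] by simp
  have gi: "(LINT z|lborel. ?g j z) = complex_of_real (\<xi> $ j * (gauss (1 / t) \<xi> / sqrt t ^ 3 / t)) * (- \<i>)" for j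
    using gauss_moment_ek_integral[OF t, of j \<xi>] by (simp add: mult_ac)
  note bl = bounded_bilinear.bounded_linear_left[OF bounded_bilinear_smult]
  have eq: "gauss t z *\<^sub>R (ek (z \<bullet> \<xi>) *s cl_vec z) = ?g 1 z *s e1 + ?g 2 z *s e2 + ?g 3 z *s e3" for z
    by (simp add: cl_vec_def vec_eq_iff complex_eq_iff algebra_simps)
  have i: "integrable lborel (\<lambda>z. ?g j z *s v)" for j and v :: cl3
    by (intro integrable_bounded_linear[OF bl] g)
  have ii: "(LINT z|lborel. ?g j z *s v) = (LINT z|lborel. ?g j z) *s v" for j and v :: cl3
    by (intro integral_bounded_linear bl g)
  show "integrable lborel (\<lambda>z. gauss t z *\<^sub>R (ek (z \<bullet> \<xi>) *s cl_vec z))"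
    unfolding eq by (intro Bochner_Integration.integrable_add i)
  have "(LINT z|lborel. gauss t z *\<^sub>R (ek (z \<bullet> \<xi>) *s cl_vec z))
      = (LINT z|lborel. ?g 1 z) *s e1 + (LINT z|lborel. ?g 2 z) *s e2 + (LINT z|lborel. ?g 3 z) *s e3"
    unfolding eq
    by (simp only: Bochner_Integration.integral_add Bochner_Integration.integrable_add i ii)
  also have "\<dots> = (gauss (1 / t) \<xi> / sqrt t ^ 3 / t) *\<^sub>R ((- \<i>) *s cl_vec \<xi>)"
    unfolding gi by (simp add: cl_vec_def vec_eq_iff complex_eq_iff algebra_simps)
  finally show "(LINT z|lborel. gauss t z *\<^sub>R (ek (z \<bullet> \<xi>) *s cl_vec z))
      = (gauss (1 / t) \<xi> / sqrt t ^ 3 / t) *\<^sub>R ((- \<i>) *s cl_vec \<xi>)" .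
qed

text \<open>This is the substitution u = r / sqrt t, carried out through the antiderivative
  \<open>- erf_pi (r / sqrt t)\<close>. The result never exceeds 1, which bounds the multipliers
  uniformly.\<close>

lemma erf_pi_integral:
  assumes a: "0 < a" and ab: "a \<le> b" and r: "0 \<le> r"
  shows "(LINT t|lborel. indicator {a..b} t *\<^sub>R (r * exp (- pi * (1 / t) * r\<^sup>2) / sqrt t ^ 3)) = erf_pi (r / sqrt a) - erf_pi (r / sqrt b)"
proof -
  let ?F = "\<lambda>t. - erf_pi (r / sqrt t)"
  have d: "(?F has_real_derivative (r * exp (- pi * (1 / t) * r\<^sup>2) / sqrt t ^ 3)) (at t)" if "0 < t" for t
  proof -
    have s: "0 < sqrt t"
      using that by simp
    have D: "((\<lambda>t. r / sqrt t) has_real_derivative (0 * sqrt t - r * (inverse (sqrt t) / 2)) / (sqrt t * sqrt t)) (at t)"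
      by (rule DERIV_divide[OF DERIV_const DERIV_real_sqrt[OF that]]) (use s in simp)
    have "(0 * w - r * (inverse w / 2)) / (w * w) = - (r / (2 * w ^ 3))" if "0 < w" for w :: real
      using that by (simp add: field_simps power3_eq_cube)
    note D[unfolded this[OF s]]
    then have "((\<lambda>t. r / sqrt t) has_real_derivative - (r / (2 * sqrt t ^ 3))) (at t)"
      .
    note Ed = DERIV_minus[OF erf_pi_deriv[OF this]]
    have "(r / sqrt t)\<^sup>2 = 1 / t * r\<^sup>2"
      using that by (simp add: power_divide)
    then have e: "- pi * (r / sqrt t)\<^sup>2 = - pi * (1 / t) * r\<^sup>2"
      by (simp only: mult.assoc)
    have "- (2 * E * - (r / (2 * w))) = r * E / w" for E w :: real
      by simp
    from Ed[unfolded this] show ?thesis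
      by (simp only: e)
  qed
  have "(LINT t|lborel. indicator {a..b} t *\<^sub>R (r * exp (- pi * (1 / t) * r\<^sup>2) / sqrt t ^ 3)) = ?F b - ?F a"
  proof (rule integral_FTC_atLeastAtMost[OF ab])
    fix t assume "a \<le> t" "t \<le> b"
    then show "(?F has_vector_derivative (r * exp (- pi * (1 / t) * r\<^sup>2) / sqrt t ^ 3)) (at t within {a..b})"
      using a by (intro has_vector_derivative_at_within[OF d[unfolded has_real_derivative_iff_has_vector_derivative]]) simp
  next
    show "continuous_on {a..b} (\<lambda>t. r * exp (- pi * (1 / t) * r\<^sup>2) / sqrt t ^ 3)"
      using a by (intro continuous_intros ballI; simp)
  qed
  then show ?thesis by simp
qed

text \<open>Fubini in z and t: as 0 < a, the function \<open>gauss a z * norm z\<close> dominates,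
  up to the factor b, all terms of the superposition. \<open>erf_pi_integral\<close> with r =
  |\<xi>| then integrates their transforms over t.\<close>

lemma
  assumes a: "0 < a" and ab: "a \<le> b"
  shows gauss_kernel_integrable: "integrable lborel (gauss_kernel a b)"
    and ft_gauss_kernel: "ft (gauss_kernel a b) \<xi> = (erf_pi (norm \<xi> / sqrt a) - erf_pi (norm \<xi> / sqrt b)) *\<^sub>R hilbert_symbol \<xi>"
proof -
  let ?c = "\<lambda>t. indicator {a..b} t * t"
  define \<Phi> where "\<Phi> \<xi> z t = (indicator {a..b} t *\<^sub>R (t * exp (- pi * t * (norm z)\<^sup>2))) *\<^sub>R (ek (z \<bullet> \<xi>) *s cl_vec z)"
    for \<xi> and z :: "real ^ 3" and t :: real
  have \<Phi>t: "(LINT t|lborel. \<Phi> \<xi> z t) = ek (z \<bullet> \<xi>) *s gauss_kernel a b z" for \<xi> z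
    unfolding \<Phi>_def gauss_kernel_def radial_part_def by (simp only: integral_scaleR_left[OF radial_part_integrable] smult_scaleR)
  have \<Phi>g: "\<Phi> \<xi> z t = ?c t *\<^sub>R (gauss t z *\<^sub>R (ek (z \<bullet> \<xi>) *s cl_vec z))" for \<xi> z t
    by (simp add: \<Phi>_def gauss_def)
  have m: "(\<lambda>(z, t). \<Phi> \<xi> z t) \<in> borel_measurable (lborel \<Otimes>\<^sub>M lborel)" for \<xi>
    unfolding \<Phi>_def by measurable
  have i: "integrable lborel (\<lambda>z. \<Phi> \<xi> z t)" for \<xi> t
  proof (cases "t \<in> {a..b}")
    case True
    then show ?thesis
      unfolding \<Phi>g using a by (intro integrable_scaleR_right gauss_cl_vec_integrable) simp
  qed (simp add: \<Phi>g)
  have i': "AE t in lborel. integrable lborel (\<lambda>z. \<Phi> \<xi> z t)" for \<xi>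
    using i by simp
  let ?C = "LINT z|lborel. gauss a z * norm z"
  have gC: "integrable lborel (\<lambda>z. gauss a z * norm z)"
    using integrable_norm[OF gauss_cl_vec_integrable[OF a, of 0]] by (simp add: norm_cl_vec)
  have n: "integrable lborel (\<lambda>t. LINT z|lborel. norm (\<Phi> \<xi> z t))" for \<xi>
  proof (rule Bochner_Integration.integrable_bound)
    show "integrable lborel (\<lambda>t. indicator {a..b} t *\<^sub>R (b * ?C))"
      by (intro integrable_scaleR_left integrable_real_indicator) (auto simp: ennreal_less_top ab)
    have "(LINT z|lborel. norm (\<Phi> \<xi> z t)) \<le> indicator {a..b} t *\<^sub>R (b * ?C)" for t
    proof (cases "t \<in> {a..b}")
      case True
      have "(LINT z|lborel. norm (\<Phi> \<xi> z t)) \<le> (LINT z|lborel. b * (gauss a z * norm z))"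
      proof (intro integral_mono integrable_norm i integrable_mult_right gC)
        fix z
        have "gauss t z \<le> gauss a z"
          using True by (simp add: gauss_def mult_right_mono)
        then have "t * (gauss t z * norm z) \<le> b * (gauss a z * norm z)"
          using True a by (intro mult_mono mult_right_mono) auto
        then show "norm (\<Phi> \<xi> z t) \<le> b * (gauss a z * norm z)"
          using True a by (simp add: \<Phi>g norm_smult norm_cl_vec abs_mult)
      qed
      then show ?thesis using True by simp
    qed (simp add: \<Phi>g)
    then show "AE t in lborel. norm (LINT z|lborel. norm (\<Phi> \<xi> z t)) \<le> norm (indicator {a..b} t *\<^sub>R (b * ?C))"
      by (intro AE_I2) (simp only: real_norm_def abs_of_nonneg[OF Bochner_Integration.integral_nonneg[OF norm_ge_zero]]
            order_trans[OF _ abs_ge_self])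
    have "(\<lambda>(t, z). norm (\<Phi> \<xi> z t)) \<in> borel_measurable (lborel \<Otimes>\<^sub>M lborel)"
      unfolding \<Phi>_def by measurable
    then show "(\<lambda>t. LINT z|lborel. norm (\<Phi> \<xi> z t)) \<in> borel_measurable lborel"
      by (rule lborel.borel_measurable_lebesgue_integral)
  qed
  show "integrable lborel (gauss_kernel a b)"
    using Fubini_integrable_iterated[OF m i' n, of 0] by (simp add: \<Phi>t)
  have "ft (gauss_kernel a b) \<xi> = (LINT t|lborel. (LINT z|lborel. \<Phi> \<xi> z t))"
    unfolding ft_def \<Phi>t[symmetric] by (rule Fubini_swap[OF m i' n])
  also have "\<dots> = (LINT t|lborel. (indicator {a..b} t *\<^sub>R (norm \<xi> * exp (- pi * (1 / t) * (norm \<xi>)\<^sup>2) / sqrt t ^ 3)) *\<^sub>R hilbert_symbol \<xi>)"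
  proof (rule Bochner_Integration.integral_cong[OF refl])
    fix t
    show "(LINT z|lborel. \<Phi> \<xi> z t) = (indicator {a..b} t *\<^sub>R (norm \<xi> * exp (- pi * (1 / t) * (norm \<xi>)\<^sup>2) / sqrt t ^ 3)) *\<^sub>R hilbert_symbol \<xi>"
    proof (cases "t \<in> {a..b}")
      case True
      then have t: "0 < t"
        using a by simp
      have "(LINT z|lborel. \<Phi> \<xi> z t) = t *\<^sub>R ((gauss (1 / t) \<xi> / sqrt t ^ 3 / t) *\<^sub>R ((- \<i>) *s cl_vec \<xi>))"
      proof -
        have "(LINT z|lborel. \<Phi> \<xi> z t) = (LINT z|lborel. t *\<^sub>R (gauss t z *\<^sub>R (ek (z \<bullet> \<xi>) *s cl_vec z)))"
          unfolding \<Phi>g using True by (simp only: indicator_simps mult_1_left)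
        also have "\<dots> = t *\<^sub>R (LINT z|lborel. gauss t z *\<^sub>R (ek (z \<bullet> \<xi>) *s cl_vec z))"
          by (intro integral_scaleR_right gauss_cl_vec_integrable t)
        finally show ?thesis
          by (simp only: gauss_cl_vec_integral[OF t])
      qed
      \<comment> \<open>The weight t cancels the factor 1 / t of the Gaussian moment and leaves
        t^(-3/2).\<close>
      also have "\<dots> = (norm \<xi> * exp (- pi * (1 / t) * (norm \<xi>)\<^sup>2) / sqrt t ^ 3) *\<^sub>R hilbert_symbol \<xi>"
        unfolding norm_scaleR_hilbert_symbol[symmetric] using t by (simp add: gauss_def mult.commute)
      finally show ?thesis
        using True by simp
    qed (simp add: \<Phi>g)
  qed
  also have "\<dots> = (erf_pi (norm \<xi> / sqrt a) - erf_pi (norm \<xi> / sqrt b)) *\<^sub>R hilbert_symbol \<xi>"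
  proof -
    have "integrable lborel (\<lambda>t. indicator {a..b} t *\<^sub>R (norm \<xi> * exp (- pi * (1 / t) * (norm \<xi>)\<^sup>2) / sqrt t ^ 3))"
      using a by (intro borel_integrable_compact continuous_intros ballI; simp)
    from integral_scaleR_left[OF this, of "hilbert_symbol \<xi>"] show ?thesis
      unfolding erf_pi_integral[OF a ab norm_ge_zero] by simp
  qed
  finally show "ft (gauss_kernel a b) \<xi> = (erf_pi (norm \<xi> / sqrt a) - erf_pi (norm \<xi> / sqrt b)) *\<^sub>R hilbert_symbol \<xi>" .
qed

lemma is_multiplier_gauss_kernel_pos:
  assumes "0 < a" "a \<le> b"
  shows "is_multiplier (gauss_kernel a b) (\<lambda>\<xi>. (erf_pi (norm \<xi> / sqrt a) - erf_pi (norm \<xi> / sqrt b)) *\<^sub>R hilbert_symbol \<xi>)"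
  using is_multiplier_ft[OF gauss_kernel_integrable[OF assms] gauss_kernel_L2] assms ft_gauss_kernel[OF assms]
  by (simp add: ft_gauss_kernel[OF assms, abs_def])

text \<open>The limit a \<rightarrow> 0 leaves the integrable kernels, so only the multiplier
  property is carried along; the majorant in terms of \<open>kernel_bound\<close> does not depend on
  a.\<close>

lemma is_multiplier_gauss_kernel:
  assumes b: "0 < b"
  shows "is_multiplier (gauss_kernel 0 b) (\<lambda>\<xi>. (1 - erf_pi (norm \<xi> / sqrt b)) *\<^sub>R hilbert_symbol \<xi>)"
proof (rule is_multiplier_limit)
  define a where "a n = b / (real n + 1)" for n :: nat
  have a: "0 < a n" "a n \<le> b" for n
    using b by (simp_all add: a_def field_simps)
  have az: "a \<longlonglongrightarrow> 0"
    using tendsto_mult_right_zero[OF LIMSEQ_inverse_real_of_nat, of b] unfolding a_def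
    by (simp add: divide_inverse add.commute)
  show "is_multiplier (gauss_kernel (a n) b) (\<lambda>\<xi>. (erf_pi (norm \<xi> / sqrt (a n)) - erf_pi (norm \<xi> / sqrt b)) *\<^sub>R hilbert_symbol \<xi>)" for n
    using a by (rule is_multiplier_gauss_kernel_pos)
  show "norm (gauss_kernel (a n) b z) \<le> norm (8 * (b\<^sup>2 + 1) * kernel_bound z)" for n z
    using norm_gauss_kernel_le[of "a n" b z] a(1)[of n] b by (simp add: abs_mult abs_of_pos kernel_bound_pos)
  show "(\<lambda>z. 8 * (b\<^sup>2 + 1) * kernel_bound z) \<in> L2"
    using L2_scaleR[OF kernel_bound_L2, of "8 * (b\<^sup>2 + 1)"] by simp
  show "(\<lambda>n. gauss_kernel (a n) b z) \<longlonglongrightarrow> gauss_kernel 0 b z" for z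
  \<comment> \<open>The closed form of \<open>radial_part\<close> divides by |z|^2; at the origin
    the vector factor is zero.\<close>
  proof (cases "z = 0")
    case False
    then have q: "0 < (norm z)\<^sup>2"
      by simp
    have "(\<lambda>n. radial_part (a n) b ((norm z)\<^sup>2)) \<longlonglongrightarrow> radial_part 0 b ((norm z)\<^sup>2)"
      unfolding radial_part_eq[OF q a(2)] radial_part_eq[OF q less_imp_le[OF b]]
      using q by (intro tendsto_intros az) auto
    then show ?thesis
      unfolding gauss_kernel_def by (intro tendsto_scaleR tendsto_const)
  qed (simp add: gauss_kernel_def cl_vec_linear)
  show "norm ((erf_pi (norm \<xi> / sqrt (a n)) - erf_pi (norm \<xi> / sqrt b)) *\<^sub>R hilbert_symbol \<xi>) \<le> 1" for n \<xi>
  proof -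
    have "\<bar>erf_pi (norm \<xi> / sqrt (a n)) - erf_pi (norm \<xi> / sqrt b)\<bar> \<le> 1"
      using erf_pi_bounds[of "norm \<xi> / sqrt (a n)"] erf_pi_bounds[of "norm \<xi> / sqrt b"] a(1)[of n] b by auto
    then show ?thesis
      using norm_hilbert_symbol_le[of \<xi>] by (simp add: mult_le_one)
  qed
  show "(\<lambda>n. (erf_pi (norm \<xi> / sqrt (a n)) - erf_pi (norm \<xi> / sqrt b)) *\<^sub>R hilbert_symbol \<xi>) \<longlonglongrightarrow> (1 - erf_pi (norm \<xi> / sqrt b)) *\<^sub>R hilbert_symbol \<xi>" for \<xi>
  proof (cases "\<xi> = 0")
    case False
    have "filterlim (\<lambda>n. norm \<xi> / sqrt (a n)) at_top sequentially"
      using False a(1) tendsto_real_sqrt[OF az]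
      by (intro LIM_at_top_divide[OF tendsto_const]) (simp_all add: always_eventually)
    then have "(\<lambda>n. erf_pi (norm \<xi> / sqrt (a n))) \<longlonglongrightarrow> 1"
      by (rule filterlim_compose[OF erf_pi_tendsto_1])
    then show ?thesis
      by (intro tendsto_intros)
  qed (simp add: hilbert_symbol_def cl_vec_linear)
qed

text \<open>The cutoff \<open>b = 1 / \<epsilon>^2\<close> scales like the sharp truncation at \<open>\<epsilon>\<close>, so the difference \<open>kernel_diff \<epsilon>\<close>
  of the two regularized kernels is a dilation of \<open>kernel_diff 1\<close>, which is odd and integrable.\<close>

definition kernel_diff :: "real \<Rightarrow> real ^ 3 \<Rightarrow> cl3" where
  "kernel_diff \<epsilon> z = ((if \<epsilon> < norm z then 1 / (pi\<^sup>2 * norm z ^ 4) else 0) - radial_part 0 (1 / \<epsilon>\<^sup>2) ((norm z)\<^sup>2)) *\<^sub>R cl_vec z"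

lemma measurable_kernel_diff[measurable]: "kernel_diff \<epsilon> \<in> borel_measurable borel"
  unfolding kernel_diff_def radial_part_def by measurable

lemma norm_kernel_diff_small: "norm z \<le> 1 \<Longrightarrow> norm (kernel_diff 1 z) = radial_part 0 1 ((norm z)\<^sup>2) * norm z"
  using radial_part_nonneg[of 0 1 "(norm z)\<^sup>2"] by (simp add: kernel_diff_def norm_cl_vec)

text \<open>Outside the unit ball the sharp kernel is the whole superposition over t > 0, so the
  difference is its tail over t > 1, which decays like a Gaussian. The first bound gives
  integrability, the second membership in L^2.\<close>

lemma kernel_diff_large:
  assumes z: "1 < norm z"
  shows "norm (kernel_diff 1 z) \<le> gauss 1 z * norm z" "norm (kernel_diff 1 z) \<le> 1 / norm z ^ 3"
proof -
  let ?x = "pi * (norm z)\<^sup>2"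
  let ?d = "(1 / ?x + 1 / ?x\<^sup>2) * exp (- ?x)"
  have q: "1 < (norm z)\<^sup>2"
    using z by (simp add: one_less_power)
  \<comment> \<open>With \<open>?x\<close> at least 2 the two terms in the prefactor of
    \<open>?d\<close> are at most 1 / 2 each, whence the constant 1 in the Gaussian bound.\<close>
  have x: "2 \<le> ?x"
    using mult_mono[of 2 pi 1 "(norm z)\<^sup>2"] q pi_gt3 by simp
  have 4: "pi\<^sup>2 * norm z ^ 4 = ?x\<^sup>2"
    by (simp add: power_mult_distrib flip: power_mult)
  have p: "radial_part 0 1 ((norm z)\<^sup>2) = 1 / ?x\<^sup>2 - ?d"
    using radial_part_eq[OF less_trans[OF zero_less_one q] zero_le_one] by simp
  have D: "kernel_diff 1 z = ?d *\<^sub>R cl_vec z"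
    using z p by (simp only: kernel_diff_def 4 if_True one_power2 div_by_1 diff_diff_eq2 add_diff_cancel_left')
  have d0: "0 \<le> ?d"
    using x by (intro mult_nonneg_nonneg add_nonneg_nonneg) auto
  have n: "norm (kernel_diff 1 z) = ?d * norm z"
    unfolding D using d0 by (simp only: norm_scaleR norm_cl_vec abs_of_nonneg)
  have "1 / ?x \<le> 1 / 2"
    using x by (intro divide_left_mono) auto
  moreover have "1 / ?x\<^sup>2 \<le> 1 / 2"
    using x power_mono[OF x, of 2] by (intro divide_left_mono) auto
  ultimately have "?d \<le> 1 * exp (- ?x)"
    by (intro mult_right_mono) auto
  then show "norm (kernel_diff 1 z) \<le> gauss 1 z * norm z"
    unfolding n gauss_def by (intro mult_right_mono) simp_all
  have "?d \<le> 1 / ?x\<^sup>2"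
    using p radial_part_nonneg[of 0 1 "(norm z)\<^sup>2"] by linarith
  also have "\<dots> \<le> 1 / norm z ^ 4"
  proof (intro divide_left_mono)
    have "1 * norm z ^ 4 \<le> pi\<^sup>2 * norm z ^ 4"
      using pi_gt3 by (intro mult_right_mono one_le_power) auto
    then show "norm z ^ 4 \<le> ?x\<^sup>2"
      unfolding 4 by simp
    have "0 < norm z" "0 < ?x"
      using z x by linarith+
    then show "0 < ?x\<^sup>2 * norm z ^ 4"
      by (rule mult_pos_pos[OF zero_less_power zero_less_power, rotated])
  qed simp
  finally have "?d * norm z \<le> 1 / norm z ^ 4 * norm z"
    by (intro mult_right_mono) auto
  also have "\<dots> = 1 / norm z ^ 3"
    using z by (simp add: power_numeral_reduce)
  finally show "norm (kernel_diff 1 z) \<le> 1 / norm z ^ 3"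
    unfolding n .
qed

lemma kernel_diff_integrable1: "integrable lborel (kernel_diff 1)"
proof (rule Bochner_Integration.integrable_bound)
  have "integrable lborel (\<lambda>z. gauss 1 z * norm z)"
    using integrable_norm[OF gauss_cl_vec_integrable[of 1 0]] by (simp add: norm_cl_vec)
  then show "integrable lborel (\<lambda>z. indicator (cball 0 1) z + gauss 1 z * norm z)"
    using emeasure_bounded_finite[OF bounded_cball, of "0 :: real^3" 1]
    by (intro Bochner_Integration.integrable_add integrable_real_indicator) simp_all
  have "norm (kernel_diff 1 z) \<le> indicator (cball 0 1) z + gauss 1 z * norm z" for z
  proof (cases "norm z \<le> 1")
    case True
    have "radial_part 0 1 ((norm z)\<^sup>2) * norm z \<le> 1 * 1"
      using radial_part_le[of 1 "(norm z)\<^sup>2"] radial_part_nonneg[of 0] True by (intro mult_mono) auto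
    moreover have "indicator (cball 0 1) z = (1 :: real)"
      using True by simp
    ultimately show ?thesis
      using norm_kernel_diff_small[OF True] mult_nonneg_nonneg[OF gauss_nonneg[of 1 z] norm_ge_zero[of z]] by linarith
  next
    case False
    then show ?thesis using kernel_diff_large(1)[of z] by simp
  qed
  then show "AE z in lborel. norm (kernel_diff 1 z) \<le> norm (indicator (cball 0 1) z + gauss 1 z * norm z)"
    by (intro AE_I2) (simp only: real_norm_def order_trans[OF _ abs_ge_self])
qed measurable

lemma kernel_diff_L2_1: "kernel_diff 1 \<in> L2"
proof (rule L2_dominated[OF kernel_bound_L2 measurable_kernel_diff])
  have "norm (kernel_diff 1 z) \<le> 16 * kernel_bound z" for z
  proof (cases "norm z \<le> 1")
    case True
    then show ?thesis
      using radial_part_norm_le[of 1 z] norm_kernel_diff_small[OF True] by simp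
  next
    case False
    then have "norm (kernel_diff 1 z) \<le> 8 * kernel_bound z"
      using kernel_diff_large(2)[of z] kernel_bound_lower(2)[of z] by simp
    then show ?thesis
      using kernel_bound_pos[of z] by simp
  qed
  then show "AE z in lborel. norm (kernel_diff 1 z) \<le> 16 * norm (kernel_bound z)"
    by (intro AE_I2) (simp only: real_norm_def abs_of_pos[OF kernel_bound_pos])
qed simp

text \<open>Under simultaneous scaling of z and \<epsilon> the scalar factor has degree -4 and the
  vector factor degree 1; the total -3 is the degree of a dilation that preserves the
  integral.\<close>

lemma kernel_diff_scale:
  assumes e: "0 < \<epsilon>"
  shows "kernel_diff \<epsilon> z = (1 / \<epsilon>^3) *\<^sub>R kernel_diff 1 (0 + (1 / \<epsilon>) *\<^sub>R z)"
proof (cases "z = 0")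
  case False
  let ?n = "norm z / \<epsilon>"
  have n: "norm ((1 / \<epsilon>) *\<^sub>R z) = ?n"
    using e by simp
  have lt: "1 < ?n \<longleftrightarrow> \<epsilon> < norm z"
    using e by (simp add: field_simps)
  have p: "radial_part 0 (1 / \<epsilon>\<^sup>2) ((norm z)\<^sup>2) = (1 / \<epsilon>^4) * radial_part 0 1 (?n\<^sup>2)"
    using radial_part_scale[OF e, of "(norm z)\<^sup>2"] False by (simp add: power_divide)
  have k: "1 / (pi\<^sup>2 * norm z ^ 4) = (1 / \<epsilon>^4) * (1 / (pi\<^sup>2 * ?n ^ 4))"
    using e by (simp add: power_divide)
  have c: "(1 / \<epsilon>^4) *\<^sub>R cl_vec z = (1 / \<epsilon>^3) *\<^sub>R cl_vec ((1 / \<epsilon>) *\<^sub>R z)"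
    using e by (simp add: cl_vec_linear power_numeral_reduce)
  have "kernel_diff \<epsilon> z = ((if 1 < ?n then 1 / (pi\<^sup>2 * ?n ^ 4) else 0) - radial_part 0 1 (?n\<^sup>2)) *\<^sub>R ((1 / \<epsilon>^4) *\<^sub>R cl_vec z)"
    unfolding kernel_diff_def p k lt[symmetric] by (simp add: algebra_simps del: times_divide_eq_left)
  then show ?thesis
    unfolding c kernel_diff_def add_0_left n by simp
qed (simp add: kernel_diff_def cl_vec_linear)

text \<open>The dilation preserves the L^1 norm and rescales the frequency; both the bound uniform
  in \<epsilon> and the limit at \<epsilon> \<rightarrow> 0 come from this.\<close>

lemma
  assumes e: "0 < \<epsilon>"
  shows kernel_diff_integrable: "integrable lborel (kernel_diff \<epsilon>)" and kernel_diff_L2: "kernel_diff \<epsilon> \<in> L2"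
    and ft_kernel_diff: "ft (kernel_diff \<epsilon>) \<xi> = ft (kernel_diff 1) (\<epsilon> *\<^sub>R \<xi>)"
proof -
  have c: "1 / \<epsilon> \<noteq> 0"
    using e by simp
  note eq = kernel_diff_scale[OF e, abs_def]
  show "integrable lborel (kernel_diff \<epsilon>)"
    unfolding eq by (intro integrable_scaleR_right lborel_integrable_affine3[OF c] kernel_diff_integrable1)
  have "(\<lambda>z. kernel_diff 1 (0 + (1 / \<epsilon>) *\<^sub>R z)) \<in> L2"
    unfolding L2_iff using lborel_integrable_affine3[OF c L2_integrable[OF kernel_diff_L2_1], of 0]
    by (intro conjI) measurable
  then show "kernel_diff \<epsilon> \<in> L2"
    unfolding eq by (rule L2_scaleR)
  have "ek (z \<bullet> \<xi>) *s kernel_diff \<epsilon> z = (1 / \<epsilon>^3) *\<^sub>R (ek ((0 + (1 / \<epsilon>) *\<^sub>R z) \<bullet> (\<epsilon> *\<^sub>R \<xi>)) *s kernel_diff 1 (0 + (1 / \<epsilon>) *\<^sub>R z))" for z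
    unfolding kernel_diff_scale[OF e, of z] using e by (simp add: smult_scaleR)
  then have "ft (kernel_diff \<epsilon>) \<xi> = (1 / \<epsilon>^3) *\<^sub>R (LINT z|lborel. ek ((0 + (1 / \<epsilon>) *\<^sub>R z) \<bullet> (\<epsilon> *\<^sub>R \<xi>)) *s kernel_diff 1 (0 + (1 / \<epsilon>) *\<^sub>R z))"
    unfolding ft_def
    by (simp only: integral_scaleR_right)
  also have "\<dots> = (1 / \<epsilon>^3) *\<^sub>R (1 / \<bar>1 / \<epsilon>\<bar>^3) *\<^sub>R ft (kernel_diff 1) (\<epsilon> *\<^sub>R \<xi>)"
    unfolding ft_def by (simp only: lborel_integral_affine3[OF c ft_integrable[OF kernel_diff_integrable1]])
  also have "\<dots> = ft (kernel_diff 1) (\<epsilon> *\<^sub>R \<xi>)"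
    using e by (simp add: power_divide)
  finally show "ft (kernel_diff \<epsilon>) \<xi> = ft (kernel_diff 1) (\<epsilon> *\<^sub>R \<xi>)" .
qed

lemma kernel_diff_integral: "(LINT z|lborel. kernel_diff 1 z) = 0"
proof -
  have "kernel_diff 1 (0 - z) = - kernel_diff 1 z" for z
    by (simp add: kernel_diff_def cl_vec_linear)
  then have "(LINT z|lborel. kernel_diff 1 z) = - (LINT z|lborel. kernel_diff 1 z)"
    using lborel_integral_shift(3)[OF kernel_diff_integrable1, of 0] by simp
  then have "2 *\<^sub>R (LINT z|lborel. kernel_diff 1 z) = 0"
    unfolding scaleR_2 eq_neg_iff_add_eq_0 .
  then show ?thesis by simp
qed

lemma ft_kernel_diff_tendsto: "((\<lambda>\<epsilon>. ft (kernel_diff \<epsilon>) \<xi>) \<longlongrightarrow> 0) (at_right 0)"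
proof (rule tendsto_at_right_sequentially[OF zero_less_one])
  fix S :: "nat \<Rightarrow> real" assume S: "\<And>n. 0 < S n" "S \<longlonglongrightarrow> 0"
  have "(\<lambda>n. LINT z|lborel. ek (z \<bullet> (S n *\<^sub>R \<xi>)) *s kernel_diff 1 z) \<longlonglongrightarrow> (LINT z|lborel. kernel_diff 1 z)"
  proof (rule integral_dominated_convergence)
    show "integrable lborel (\<lambda>z. norm (kernel_diff 1 z))"
      by (intro integrable_norm kernel_diff_integrable1)
    have "(\<lambda>n. ek (z \<bullet> (S n *\<^sub>R \<xi>)) *s kernel_diff 1 z) \<longlonglongrightarrow> ek (z \<bullet> (0 *\<^sub>R \<xi>)) *s kernel_diff 1 z" for z
    proof (intro bounded_bilinear.tendsto[OF bounded_bilinear_smult] tendsto_const)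
      have "isCont ek (z \<bullet> (0 *\<^sub>R \<xi>))"
        using continuous_ek[OF continuous_on_id[of UNIV]] by (simp add: continuous_on_eq_continuous_at)
      then show "(\<lambda>n. ek (z \<bullet> (S n *\<^sub>R \<xi>))) \<longlonglongrightarrow> ek (z \<bullet> (0 *\<^sub>R \<xi>))"
        by (rule isCont_tendsto_compose) (intro tendsto_intros S)
    qed
    then show "AE z in lborel. (\<lambda>n. ek (z \<bullet> (S n *\<^sub>R \<xi>)) *s kernel_diff 1 z) \<longlonglongrightarrow> kernel_diff 1 z"
      by simp
    show "AE z in lborel. norm (ek (z \<bullet> (S n *\<^sub>R \<xi>)) *s kernel_diff 1 z) \<le> norm (kernel_diff 1 z)" for n
      by (simp add: norm_smult)
  qed measurable
  then show "(\<lambda>n. ft (kernel_diff (S n)) \<xi>) \<longlonglongrightarrow> 0"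
    unfolding ft_kernel_diff[OF S(1)] kernel_diff_integral by (simp add: ft_def)
qed

section \<open>The truncated kernel as a multiplier\<close>

definition hilbert_kernel :: "real \<Rightarrow> real ^ 3 \<Rightarrow> cl3" where
  "hilbert_kernel \<epsilon> z = (if \<epsilon> < norm z then 1 / (pi\<^sup>2 * norm z ^ 4) else 0) *\<^sub>R cl_vec z"

lemma hilbert_kernel_split: "hilbert_kernel \<epsilon> = (\<lambda>z. gauss_kernel 0 (1 / \<epsilon>\<^sup>2) z + kernel_diff \<epsilon> z)"
  by (rule ext) (simp add: hilbert_kernel_def gauss_kernel_def kernel_diff_def scaleR_diff_left)

lemma hilbert_trunc_conv: "hilbert_trunc \<epsilon> f = conv (hilbert_kernel \<epsilon>) f"
proof
  fix x
  have "hilbert_kernel \<epsilon> (x - y) \<odot> f y = (1 / pi\<^sup>2) *\<^sub>R (indicator {y. \<epsilon> < norm (x - y)} y *\<^sub>R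
      ((1 / norm (x - y) ^ 4) *\<^sub>R (cl_vec (x - y) \<odot> f y)))" for y
    by (simp add: hilbert_kernel_def bounded_bilinear.scaleR_left[OF bounded_bilinear_cl_mult])
  \<comment> \<open>Scaling is invertible, so it commutes with the integral even where the integrand
    is not integrable and both sides are 0.\<close>
  moreover have "(LINT y|lborel. (1 / pi\<^sup>2) *\<^sub>R (F y :: cl3)) = (1 / pi\<^sup>2) *\<^sub>R (LINT y|lborel. F y)"
    for F :: "real^3 \<Rightarrow> cl3"
    by (rule integral_bounded_linear'[where T' = "\<lambda>v. pi\<^sup>2 *\<^sub>R v"]) (simp_all add: bounded_linear_scaleR_right)
  ultimately show "hilbert_trunc \<epsilon> f x = conv (hilbert_kernel \<epsilon>) f x"
    by (simp only: conv_def hilbert_trunc_def set_lebesgue_integral_def)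
qed

lemma is_multiplier_hilbert_kernel:
  assumes e: "0 < \<epsilon>"
  shows "is_multiplier (hilbert_kernel \<epsilon>) (\<lambda>\<xi>. (1 - erf_pi (\<epsilon> * norm \<xi>)) *\<^sub>R hilbert_symbol \<xi> + ft (kernel_diff \<epsilon>) \<xi>)"
proof -
  have n: "norm \<xi> / sqrt (1 / \<epsilon>\<^sup>2) = \<epsilon> * norm \<xi>" for \<xi> :: "real^3"
    using e by (simp add: real_sqrt_divide)
  have p: "0 < 1 / \<epsilon>\<^sup>2"
    using e by simp
  note is_multiplier_add[OF is_multiplier_gauss_kernel[OF p] is_multiplier_ft[OF kernel_diff_integrable[OF e] kernel_diff_L2[OF e]]]
  then show ?thesis
    unfolding n hilbert_kernel_split .
qed

text \<open>The multipliers of the truncations are bounded independently of \<epsilon>, by 1 plus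
  the L^1 norm of \<open>kernel_diff 1\<close>, and converge to the symbol at every \<xi>.\<close>

lemma has_hilbert_fourier:
  assumes fg: "has_fourier f g" and h: "has_fourier h (\<lambda>\<xi>. hilbert_symbol \<xi> \<odot> g \<xi>)"
  shows "has_hilbert f h"
proof -
  let ?m = "\<lambda>\<epsilon> \<xi>. (1 - erf_pi (\<epsilon> * norm \<xi>)) *\<^sub>R hilbert_symbol \<xi> + ft (kernel_diff \<epsilon>) \<xi>"
  have "L2_lim (\<lambda>\<epsilon>. conv (hilbert_kernel \<epsilon>) f) (at_right 0) h"
  proof (rule is_multiplier_L2_lim[OF is_multiplier_hilbert_kernel _ _ fg h measurable_hilbert_symbol])
    show "norm (?m \<epsilon> \<xi>) \<le> 1 + (LINT z|lborel. norm (kernel_diff 1 z))" if e: "0 < \<epsilon>" for \<epsilon> \<xi>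
    proof (rule norm_triangle_mono)
      have "\<bar>1 - erf_pi (\<epsilon> * norm \<xi>)\<bar> \<le> 1"
        using erf_pi_bounds[of "\<epsilon> * norm \<xi>"] e by auto
      then show "norm ((1 - erf_pi (\<epsilon> * norm \<xi>)) *\<^sub>R hilbert_symbol \<xi>) \<le> 1"
        using norm_hilbert_symbol_le[of \<xi>] by (simp add: mult_le_one)
      show "norm (ft (kernel_diff \<epsilon>) \<xi>) \<le> (LINT z|lborel. norm (kernel_diff 1 z))"
        unfolding ft_kernel_diff[OF e] by (rule norm_ft_le[OF kernel_diff_integrable1])
    qed
    show "((\<lambda>\<epsilon>. ?m \<epsilon> \<xi>) \<longlongrightarrow> hilbert_symbol \<xi>) (at_right 0)" for \<xi>
    proof -
      have "((\<lambda>\<epsilon>. erf_pi (\<epsilon> * norm \<xi>)) \<longlongrightarrow> erf_pi (0 * norm \<xi>)) (at_right 0)"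
        by (rule isCont_tendsto_compose[OF erf_pi_isCont]) (intro tendsto_intros)
      then have "((\<lambda>\<epsilon>. ?m \<epsilon> \<xi>) \<longlongrightarrow> (1 - erf_pi (0 * norm \<xi>)) *\<^sub>R hilbert_symbol \<xi> + 0) (at_right 0)"
        by (intro tendsto_intros ft_kernel_diff_tendsto)
      then show ?thesis by simp
    qed
  qed
  then show ?thesis
    using has_fourier_L2(1)[OF fg] by (simp add: has_hilbert_def hilbert_trunc_conv)
qed

section \<open>Eigenspaces of the Hilbert transformation\<close>

lemmas cl_scaleR = bounded_bilinear.scaleR_left[OF bounded_bilinear_cl_mult]
  bounded_bilinear.scaleR_right[OF bounded_bilinear_cl_mult]

lemma cl_vec_anticommutator: "cl_vec u \<odot> cl_vec v + cl_vec v \<odot> cl_vec u = (- 2 * (u \<bullet> v)) *\<^sub>R cl_one"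
  unfolding cl_vec_def
  by (simp add: cl_scaleR cl_simps inner_vec_def sum_3) (simp add: vec_eq_iff complex_eq_iff algebra_simps)

lemma cl_vec_square: "cl_vec u \<odot> cl_vec u = - ((norm u)\<^sup>2 *\<^sub>R cl_one)"
proof -
  have "2 *\<^sub>R (cl_vec u \<odot> cl_vec u) = 2 *\<^sub>R (- ((norm u)\<^sup>2 *\<^sub>R cl_one))"
    unfolding scaleR_2[of "cl_vec u \<odot> cl_vec u"] cl_vec_anticommutator by (simp add: power2_norm_eq_inner)
  then show ?thesis
    by (rule scaleR_left_imp_eq[rotated]) simp
qed

text \<open>A unit vector squares to -1 and so does -\<i>; the two signs cancel.\<close>

lemma hilbert_symbol_square: "\<xi> \<noteq> 0 \<Longrightarrow> hilbert_symbol \<xi> \<odot> (hilbert_symbol \<xi> \<odot> v) = v"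
  unfolding hilbert_symbol_def cl_assoc[symmetric] cl_bilinear(7,8) cl_vec_square
  by (simp add: norm_sgn cl_bilinear vector_smult_assoc cl_one_left)

lemma hilbert_symbol_minus: "hilbert_symbol (- \<xi>) = \<i> *s cl_vec (sgn \<xi>)"
  by (simp add: hilbert_symbol_def cl_vec_linear sgn_minus)

lemma cl_vec_scalar_part: "cl_vec u $ (False, False, False) = 0"
  by (simp add: cl_vec_def e1_def e2_def e3_def axis_def)

lemma cl_one_scalar_part: "cl_one $ (False, False, False) = 1"
  by (simp add: cl_one_def)

lemma AE_lborel_nonzero: "AE x in (lborel :: (real ^ 3) measure). x \<noteq> 0"
  by (rule AE_lborel_singleton)

lemma AE_lborel_uminus:
  assumes "AE x in (lborel :: (real ^ 3) measure). P x" shows "AE x in lborel. P (- x)"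
proof -
  have d: "distr lborel borel (\<lambda>x::real^3. - x) = lborel"
    using lborel_affine[of "-1" "0 :: real^3"] by (simp add: density_1)
  have "AE x in distr lborel borel (\<lambda>x::real^3. - x). P x"
    unfolding d by (rule assms)
  then show ?thesis
    by (rule AE_distrD[rotated]) simp
qed

lemma has_hilbert_exists:
  assumes fg: "has_fourier f g"
  obtains h where "has_fourier h (\<lambda>\<xi>. hilbert_symbol \<xi> \<odot> g \<xi>)" "has_hilbert f h"
proof -
  have "(\<lambda>\<xi>. hilbert_symbol \<xi> \<odot> g \<xi>) \<in> L2"
    by (rule L2_cl_mult[OF measurable_hilbert_symbol norm_hilbert_symbol_le has_fourier_L2(2)[OF fg]])
  then obtain h where "has_fourier h (\<lambda>\<xi>. hilbert_symbol \<xi> \<odot> g \<xi>)"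
    by (rule has_fourier_surj)
  with has_hilbert_fourier[OF fg] that show ?thesis by blast
qed

text \<open>Uniqueness of limits in L^2 makes the multiplier formula an equivalence, which turns
  questions about H into pointwise ones.\<close>

lemma has_hilbert_iff:
  assumes fg: "has_fourier f g" and hk: "has_fourier h k"
  shows "has_hilbert f h \<longleftrightarrow> (AE \<xi> in lborel. k \<xi> = hilbert_symbol \<xi> \<odot> g \<xi>)"
proof
  assume H: "has_hilbert f h"
  obtain h' where h': "has_fourier h' (\<lambda>\<xi>. hilbert_symbol \<xi> \<odot> g \<xi>)" "has_hilbert f h'"
    using has_hilbert_exists[OF fg] .
  have "AE x in lborel. h' x = h x"
    using H h'(2) unfolding has_hilbert_def by (intro L2_lim_unique_AE[of _ "at_right 0"]) auto
  from has_fourier_cong_left[OF h'(1) L2_measurable[OF has_fourier_L2(1)[OF hk]] this]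
  show "AE \<xi> in lborel. k \<xi> = hilbert_symbol \<xi> \<odot> g \<xi>"
    by (rule has_fourier_unique[OF hk])
next
  assume eq: "AE \<xi> in lborel. k \<xi> = hilbert_symbol \<xi> \<odot> g \<xi>"
  have "(\<lambda>\<xi>. hilbert_symbol \<xi> \<odot> g \<xi>) \<in> borel_measurable borel"
    by (rule L2_measurable[OF L2_cl_mult[OF measurable_hilbert_symbol norm_hilbert_symbol_le has_fourier_L2(2)[OF fg]]])
  from has_fourier_cong_right[OF hk this eq] show "has_hilbert f h"
    by (rule has_hilbert_fourier[OF fg])
qed

definition eigenspace :: "complex \<Rightarrow> (real ^ 3 \<Rightarrow> cl3) set" where
  "eigenspace s = {f. has_hilbert f (\<lambda>x. s *s f x)}"

lemma eigenspace_L2: "f \<in> eigenspace s \<Longrightarrow> f \<in> L2"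
  by (simp add: eigenspace_def has_hilbert_def)

lemma eigenspace_iff:
  assumes "has_fourier f g"
  shows "f \<in> eigenspace s \<longleftrightarrow> (AE \<xi> in lborel. s *s g \<xi> = hilbert_symbol \<xi> \<odot> g \<xi>)"
  unfolding eigenspace_def mem_Collect_eq using has_hilbert_iff[OF assms has_fourier_smult[OF assms, of s]] .

lemma eigenspace_add:
  assumes "f \<in> eigenspace s" "g \<in> eigenspace s"
  shows "(\<lambda>x. f x + g x) \<in> eigenspace s"
proof -
  obtain f' g' where F: "has_fourier f f'" "has_fourier g g'"
    using has_fourier_exists[OF eigenspace_L2[OF assms(1)]] has_fourier_exists[OF eigenspace_L2[OF assms(2)]] by metis
  have "AE \<xi> in lborel. s *s f' \<xi> = hilbert_symbol \<xi> \<odot> f' \<xi>" "AE \<xi> in lborel. s *s g' \<xi> = hilbert_symbol \<xi> \<odot> g' \<xi>"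
    using assms F by (simp_all add: eigenspace_iff)
  then have "AE \<xi> in lborel. s *s (f' \<xi> + g' \<xi>) = hilbert_symbol \<xi> \<odot> (f' \<xi> + g' \<xi>)"
    by eventually_elim (simp add: cl_bilinear vector_add_ldistrib)
  then show ?thesis
    using eigenspace_iff[OF has_fourier_add[OF F]] by simp
qed

lemma eigenspace_smult:
  assumes "f \<in> eigenspace s"
  shows "(\<lambda>x. c *s f x) \<in> eigenspace s"
proof -
  obtain f' where F: "has_fourier f f'"
    using has_fourier_exists[OF eigenspace_L2[OF assms]] .
  have "AE \<xi> in lborel. s *s f' \<xi> = hilbert_symbol \<xi> \<odot> f' \<xi>"
    using assms F by (simp add: eigenspace_iff)
  then have "AE \<xi> in lborel. s *s (c *s f' \<xi>) = hilbert_symbol \<xi> \<odot> (c *s f' \<xi>)"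
  proof eventually_elim
    case (elim \<xi>)
    have "s *s (c *s f' \<xi>) = c *s (s *s f' \<xi>)"
      by (simp add: vector_smult_assoc mult.commute)
    then show ?case
      unfolding cl_bilinear elim .
  qed
  then show ?thesis
    using eigenspace_iff[OF has_fourier_smult[OF F, of c]] by simp
qed

lemma eigenspace_0: "(\<lambda>x. 0) \<in> eigenspace s"
  by (simp add: eigenspace_iff[OF has_fourier_0] cl_bilinear)

text \<open>The defect of the eigenvalue equation depends continuously on the transform and vanishes
  for that of each \<open>F n\<close>, so for the limit it is at most a multiple of the distance
  from \<open>F n\<close> to f.\<close>

lemma eigenspace_closed:
  assumes F: "\<And>n. F n \<in> eigenspace s" and lim: "L2_lim F sequentially f"
  shows "f \<in> eigenspace s"
proof -
  have f: "f \<in> L2" and lim': "(\<lambda>n. N2 (\<lambda>x. F n x - f x)) \<longlonglongrightarrow> 0"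
    using lim by (simp_all add: L2_lim_iff)
  obtain g where g: "has_fourier f g"
    using has_fourier_exists[OF f] .
  have gL: "g \<in> L2"
    using has_fourier_L2(2)[OF g] .
  let ?d = "\<lambda>\<xi>. s *s g \<xi> - hilbert_symbol \<xi> \<odot> g \<xi>"
  note hL = L2_cl_mult[OF measurable_hilbert_symbol norm_hilbert_symbol_le]
  have sL: "(\<lambda>\<xi>. s *s u \<xi>) \<in> L2" and sN: "N2 (\<lambda>\<xi>. s *s u \<xi>) \<le> norm s * N2 u"
    if u: "u \<in> L2" for u :: "real^3 \<Rightarrow> cl3"
  proof -
    have m: "(\<lambda>\<xi>. s *s u \<xi>) \<in> borel_measurable borel"
      using L2_measurable[OF u] by measurable
    show "(\<lambda>\<xi>. s *s u \<xi>) \<in> L2" "N2 (\<lambda>\<xi>. s *s u \<xi>) \<le> norm s * N2 u"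
      using L2_dominated[OF u m norm_ge_zero[of s]] N2_dominated[OF u m norm_ge_zero[of s]] by (simp_all add: norm_smult)
  qed
  have dL: "?d \<in> L2"
    by (intro L2_diff sL hL gL)
  have "N2 ?d \<le> (norm s + cl_bound) * N2 (\<lambda>x. F n x - f x)" for n
  proof -
    obtain G where G: "has_fourier (F n) G"
      using has_fourier_exists[OF eigenspace_L2[OF F]] .
    have GL: "G \<in> L2"
      using has_fourier_L2(2)[OF G] .
    let ?u = "\<lambda>\<xi>. g \<xi> - G \<xi>"
    have uL: "?u \<in> L2"
      by (intro L2_diff gL GL)
    have "AE \<xi> in lborel. s *s G \<xi> = hilbert_symbol \<xi> \<odot> G \<xi>"
      using F[of n] eigenspace_iff[OF G] by simp
    then have ae: "AE \<xi> in lborel. ?d \<xi> = s *s ?u \<xi> + hilbert_symbol \<xi> \<odot> (- ?u \<xi>)"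
      by eventually_elim (simp add: cl_bilinear vector_ssub_ldistrib)
    have uL': "(\<lambda>\<xi>. - ?u \<xi>) \<in> L2"
      by (rule L2_uminus[OF uL])
    have "N2 ?d = N2 (\<lambda>\<xi>. s *s ?u \<xi> + hilbert_symbol \<xi> \<odot> (- ?u \<xi>))"
      by (rule N2_cong_AE[OF L2_measurable[OF dL] L2_measurable[OF L2_add(1)[OF sL[OF uL] hL[OF uL']]] ae])
    also have "\<dots> \<le> norm s * N2 ?u + cl_bound * 1 * N2 (\<lambda>\<xi>. - ?u \<xi>)"
      by (intro order_trans[OF N2_triangle[OF sL[OF uL] hL[OF uL']]] add_mono sN[OF uL]
          N2_cl_mult[OF measurable_hilbert_symbol norm_hilbert_symbol_le uL'])
    also have "\<dots> = (norm s + cl_bound) * N2 ?u"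
      unfolding N2_uminus by (simp add: algebra_simps)
    also have "N2 ?u = N2 (\<lambda>x. F n x - f x)"
      using has_fourier_N2[OF has_fourier_diff[OF G g]] N2_commute[of G g] by simp
    finally show ?thesis .
  qed
  then have "N2 ?d \<le> 0"
    by (intro tendsto_lowerbound[OF tendsto_mult_right_zero[OF lim', of "norm s + cl_bound"]] always_eventually allI) simp_all
  then have "N2 ?d = 0"
    using N2_nonneg[of ?d] by linarith
  then have "AE \<xi> in lborel. s *s g \<xi> = hilbert_symbol \<xi> \<odot> g \<xi>"
    using N2_zero_iff[OF dL] by simp
  then show ?thesis
    using eigenspace_iff[OF g] by simp
qed

lemma eigenspace_subspace: "L2_subspace (eigenspace s)"
  unfolding L2_subspace_def
  using eigenspace_L2 eigenspace_0 eigenspace_add eigenspace_smult eigenspace_closed by blast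

lemma eigenspace_maximal: "maximal_invariant_subspace s (eigenspace s)"
proof -
  have "has_hilbert f (\<lambda>x. s *s f x)" if "f \<in> eigenspace s" for f
    using that by (simp add: eigenspace_def)
  moreover have "(\<lambda>x. s *s f x) \<in> eigenspace s" if "f \<in> eigenspace s" for f
    by (rule eigenspace_smult[OF that])
  moreover have "W = eigenspace s" if "\<forall>f\<in>W. has_hilbert f (\<lambda>x. s *s f x)" "eigenspace s \<subseteq> W" for W
    using that by (auto simp: eigenspace_def)
  ultimately show ?thesis
    unfolding maximal_invariant_subspace_def invariant_subspace_def
    using eigenspace_subspace by blast
qed

lemma eigenspace_Int:
  assumes "f \<in> eigenspace s" "f \<in> eigenspace t" "s \<noteq> t"
  shows "AE x in lborel. f x = 0"
proof -
  obtain g where g: "has_fourier f g"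
    using has_fourier_exists[OF eigenspace_L2[OF assms(1)]] .
  have "AE \<xi> in lborel. s *s g \<xi> = hilbert_symbol \<xi> \<odot> g \<xi>" "AE \<xi> in lborel. t *s g \<xi> = hilbert_symbol \<xi> \<odot> g \<xi>"
    using assms eigenspace_iff[OF g] by simp_all
  then have "AE \<xi> in lborel. g \<xi> = 0"
  proof eventually_elim
    case (elim \<xi>)
    then have "(s - t) *s g \<xi> = 0"
      by (simp add: vector_sub_rdistrib)
    then show ?case
      using assms(3) by simp
  qed
  then have "N2 f = 0"
    using N2_zero_iff[OF has_fourier_L2(2)[OF g]] has_fourier_N2[OF g] by simp
  then show ?thesis
    using N2_zero_iff[OF has_fourier_L2(1)[OF g]] by simp
qed

text \<open>Up to the factor 1 / 2 this is the projection: the symbol maps 1 + s times itself to s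
  times the same element, since both s and the symbol square to one.\<close>

lemma eigenspace_projection:
  assumes fg: "has_fourier f g" and hk: "has_fourier h (\<lambda>\<xi>. hilbert_symbol \<xi> \<odot> g \<xi>)" and s: "s * s = 1"
  shows "(\<lambda>x. f x + s *s h x) \<in> eigenspace s"
proof -
  have "AE \<xi> in lborel. s *s (g \<xi> + s *s (hilbert_symbol \<xi> \<odot> g \<xi>)) = hilbert_symbol \<xi> \<odot> (g \<xi> + s *s (hilbert_symbol \<xi> \<odot> g \<xi>))"
    using AE_lborel_nonzero
    by eventually_elim (simp add: cl_bilinear hilbert_symbol_square vector_add_ldistrib vector_smult_assoc s add.commute)
  then show ?thesis
    using eigenspace_iff[OF has_fourier_add[OF fg has_fourier_smult[OF hk, of s]]] by simp
qed

lemma eigenspace_sum: "L2_direct_sum (eigenspace 1) (eigenspace (- 1))"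
  unfolding L2_direct_sum_def
proof (intro conjI ballI set_eqI iffI)
  fix f :: "real^3 \<Rightarrow> cl3" assume "f \<in> L2"
  then obtain g where g: "has_fourier f g"
    using has_fourier_exists by blast
  obtain h where h: "has_fourier h (\<lambda>\<xi>. hilbert_symbol \<xi> \<odot> g \<xi>)"
    using has_hilbert_exists[OF g] .
  have "(\<lambda>x. (1/2) *s (f x + 1 *s h x)) \<in> eigenspace 1"
    "(\<lambda>x. (1/2) *s (f x + (- 1) *s h x)) \<in> eigenspace (- 1)"
    by (intro eigenspace_smult eigenspace_projection[OF g h]; simp)+
  moreover have "f = (\<lambda>x. (1/2) *s (f x + 1 *s h x) + (1/2) *s (f x + (- 1) *s h x))"
    by (simp add: fun_eq_iff vec_eq_iff)
  ultimately show "f \<in> {\<lambda>x. f x + g x |f g. f \<in> eigenspace 1 \<and> g \<in> eigenspace (- 1)}"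
    by (intro CollectI exI conjI) assumption+
next
  fix f assume "f \<in> {\<lambda>x. f x + g x |f g. f \<in> eigenspace 1 \<and> g \<in> eigenspace (- 1)}"
  then show "f \<in> L2"
    using L2_add eigenspace_L2 by blast
next
  fix f assume "f \<in> eigenspace 1 \<inter> eigenspace (- 1)"
  then show "AE x in lborel. f x = 0"
    by (intro eigenspace_Int[of f 1 "- 1"]) auto
qed

text \<open>Project the function whose transform is the indicator of the unit cube: 1 + s times the
  symbol has scalar part 1 and so never vanishes.\<close>

lemma eigenspace_nonzero:
  assumes s: "s * s = 1"
  obtains f where "f \<in> eigenspace s" "\<not> (AE x in lborel. f x = 0)"
proof -
  let ?B = "cbox 0 One :: (real^3) set"
  let ?c = "\<lambda>\<xi>. indicator ?B \<xi> *\<^sub>R cl_one"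
  have "?c \<in> L2"
    by (intro L2_indicator) (simp_all add: emeasure_bounded_finite[OF bounded_cbox, unfolded infinity_ennreal_def])
  then obtain f where f: "has_fourier f ?c"
    by (rule has_fourier_surj)
  obtain h where h: "has_fourier h (\<lambda>\<xi>. hilbert_symbol \<xi> \<odot> ?c \<xi>)"
    using has_hilbert_exists[OF f] .
  note F = has_fourier_add[OF f has_fourier_smult[OF h, of s]]
  have "\<not> (AE x in lborel. f x + s *s h x = 0)"
  proof
    assume "AE x in lborel. f x + s *s h x = 0"
    then have "N2 (\<lambda>\<xi>. ?c \<xi> + s *s (hilbert_symbol \<xi> \<odot> ?c \<xi>)) = 0"
      using N2_zero_iff[OF has_fourier_L2(1)[OF F]] has_fourier_N2[OF F] by simp
    then have "AE \<xi> in lborel. ?c \<xi> + s *s (hilbert_symbol \<xi> \<odot> ?c \<xi>) = 0"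
      using N2_zero_iff[OF has_fourier_L2(2)[OF F]] by simp
    then have "AE \<xi> in lborel. \<xi> \<notin> ?B"
    proof eventually_elim
      case (elim \<xi>)
      show ?case
      proof
        assume "\<xi> \<in> ?B"
        with elim have "cl_one + s *s hilbert_symbol \<xi> = 0"
          by (simp add: cl_one_right)
        then have "(cl_one + s *s hilbert_symbol \<xi>) $ (False, False, False) = 0"
          by simp
        then show False
          by (simp add: hilbert_symbol_def cl_vec_scalar_part cl_one_scalar_part)
      qed
    qed
    then have "emeasure lborel ?B = 0"
      by (subst (asm) AE_iff_measurable[of ?B]) auto
    then show False
      by (simp add: emeasure_lborel_cbox)
  qed
  then show ?thesis
    using that eigenspace_projection[OF f h s] by blast
qed

lemma eigenspace_nontrivial:
  assumes s: "s * s = 1"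
  shows "nontrivial_subspace (eigenspace s)"
  unfolding nontrivial_subspace_def
proof (rule conjI)
  show "\<exists>f\<in>eigenspace s. \<not> (AE x in lborel. f x = 0)"
    using eigenspace_nonzero[OF s] by blast
  \<comment> \<open>A nonzero element of the opposite eigenspace witnesses that this one is
    proper.\<close>
  obtain f where f: "f \<in> eigenspace (- s)" "\<not> (AE x in lborel. f x = 0)"
    using eigenspace_nonzero[of "- s"] s by auto
  have "s \<noteq> - s"
    using s by auto
  then have "f \<notin> eigenspace s"
    using eigenspace_Int[of f s "- s"] f by blast
  then show "eigenspace s \<noteq> L2"
    using eigenspace_L2[OF f(1)] by blast
qed

section \<open>Spinors\<close>

text \<open>The pseudoscalar e3 e1 e2 is central because the dimension is odd.\<close>

lemma cl_p_cl_vec: "cl_p \<odot> cl_vec u = cl_vec u \<odot> cl_p"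
proof -
  have "cl_p \<odot> e1 = e1 \<odot> cl_p" "cl_p \<odot> e2 = e2 \<odot> cl_p" "cl_p \<odot> e3 = e3 \<odot> cl_p"
    unfolding cl_p_def by (simp_all add: cl_simps)
  then show ?thesis
    unfolding cl_vec_def by (simp only: cl_bilinear(1,2) cl_scaleR)
qed

section \<open>Coordinates in the eight blades\<close>

lemma blade_forall: "(\<forall>C :: blade. P C) \<longleftrightarrow>
  P (False, False, False) \<and> P (True, False, False) \<and> P (False, True, False) \<and> P (False, False, True) \<and>
  P (True, True, False) \<and> P (True, False, True) \<and> P (False, True, True) \<and> P (True, True, True)"
    (is "?L \<longleftrightarrow> ?R")
proof
  assume R: ?R
  show ?L
  proof
    fix C :: blade
    obtain a b c where "C = (a, b, c)"
      by (cases C)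
    then show "P C"
      using R by (cases a; cases b; cases c; simp only:)
  qed
qed simp

lemma e3_components:
  "(e3 \<odot> v) $ (False, False, False) = - v $ (False, False, True)"
  "(e3 \<odot> v) $ (True, False, False) = v $ (True, False, True)"
  "(e3 \<odot> v) $ (False, True, False) = v $ (False, True, True)"
  "(e3 \<odot> v) $ (False, False, True) = v $ (False, False, False)"
  "(e3 \<odot> v) $ (True, True, False) = - v $ (True, True, True)"
  "(e3 \<odot> v) $ (True, False, True) = - v $ (True, False, False)"
  "(e3 \<odot> v) $ (False, True, True) = - v $ (False, True, False)"
  "(e3 \<odot> v) $ (True, True, True) = v $ (True, True, False)"
  by (simp_all add: e3_def axis_mult blade_sign_def blade_diff_def)

lemma cl_p_components:
  "(cl_p \<odot> v) $ (False, False, False) = v $ (False, False, False) - v $ (True, True, True)"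
  "(cl_p \<odot> v) $ (True, False, False) = v $ (True, False, False) + v $ (False, True, True)"
  "(cl_p \<odot> v) $ (False, True, False) = v $ (False, True, False) - v $ (True, False, True)"
  "(cl_p \<odot> v) $ (False, False, True) = v $ (False, False, True) + v $ (True, True, False)"
  "(cl_p \<odot> v) $ (True, True, False) = v $ (True, True, False) + v $ (False, False, True)"
  "(cl_p \<odot> v) $ (True, False, True) = v $ (True, False, True) - v $ (False, True, False)"
  "(cl_p \<odot> v) $ (False, True, True) = v $ (False, True, True) + v $ (True, False, False)"
  "(cl_p \<odot> v) $ (True, True, True) = v $ (True, True, True) - v $ (False, False, False)"
  unfolding cl_p_def cl_bilinear cl_assoc cl_one_left
  by (simp_all add: e1_def e2_def e3_def axis_mult blade_sign_def blade_diff_def)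

text \<open>Half of \<open>cl_p\<close> is an idempotent, so membership in the ideal becomes a
  linear equation.\<close>

lemma cl_p_square: "cl_p \<odot> (cl_p \<odot> v) = 2 *s (cl_p \<odot> v)"
  unfolding vec_eq_iff blade_forall by (simp add: cl_p_components)

text \<open>Index 1 appears as \<open>Suc 0\<close>, the form to which the simplifier rewrites
  it.\<close>

lemma w_components:
  "w_plus (Suc 0) = (\<chi> C. if C = (True, False, False) then 1 else if C = (False, True, False) then \<i>
     else if C = (False, True, True) then 1 else if C = (True, False, True) then - \<i> else 0)"
  "w_plus 2 = (\<chi> C. if C = (False, False, False) then 1 else if C = (False, False, True) then \<i>
     else if C = (True, True, False) then \<i> else if C = (True, True, True) then - 1 else 0)"
  "w_minus (Suc 0) = (\<chi> C. if C = (False, False, False) then 1 else if C = (False, False, True) then - \<i>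
     else if C = (True, True, False) then - \<i> else if C = (True, True, True) then - 1 else 0)"
  "w_minus 2 = (\<chi> C. if C = (True, False, False) then 1 else if C = (False, True, False) then - \<i>
     else if C = (False, True, True) then 1 else if C = (True, False, True) then \<i> else 0)"
  unfolding vec_eq_iff blade_forall w_plus_def w_minus_def
  by (simp_all add: cl_p_components cl_bilinear cl_assoc,
      simp_all add: e1_def e2_def cl_one_def axis_mult_axis blade_sign_def blade_diff_def,
      simp_all add: axis_def)

text \<open>Indices 1 and 2 are a computation in coordinates; 3 and 4 follow because
  \<open>w_dependent\<close> makes them scalar multiples.\<close>

lemma w_eigen:
  assumes "j \<in> {1..4}"
  shows "\<i> *s (e3 \<odot> w_plus j) = w_plus j" "\<i> *s (e3 \<odot> w_minus j) = (- 1) *s w_minus j"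
proof -
  have 1: "\<i> *s (e3 \<odot> w_plus 1) = w_plus 1" "\<i> *s (e3 \<odot> w_plus 2) = w_plus 2"
    "\<i> *s (e3 \<odot> w_minus 1) = (- 1) *s w_minus 1" "\<i> *s (e3 \<odot> w_minus 2) = (- 1) *s w_minus 2"
    unfolding vec_eq_iff blade_forall by (simp_all add: e3_components) (simp_all add: w_components)
  have 2: "\<i> *s (e3 \<odot> (c *s w)) = s *s (c *s w)" if "\<i> *s (e3 \<odot> w) = s *s w" for c s w
  proof -
    have "\<i> *s (e3 \<odot> (c *s w)) = c *s (\<i> *s (e3 \<odot> w))"
      by (simp add: cl_bilinear vector_smult_assoc mult.commute)
    then show ?thesis
      unfolding that by (simp add: vector_smult_assoc mult.commute)
  qed
  have "j = 1 \<or> j = 2 \<or> j = 3 \<or> j = 4"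
    using assms by auto
  then show "\<i> *s (e3 \<odot> w_plus j) = w_plus j" "\<i> *s (e3 \<odot> w_minus j) = (- 1) *s w_minus j"
    using 1 2[of "w_plus 1" 1 \<i>] 2[of "w_plus 2" 1 "- \<i>"] 2[OF 1(3), of \<i>] 2[OF 1(4), of "- \<i>"]
    unfolding w_dependent[symmetric] by (elim disjE; simp only: vector_smult_lid)+
qed

text \<open>The ideal condition reduces eight coordinates to four and the eigenvalue equation
  reduces these to two, those at 1 and e1. In \<open>w_plus 1\<close> and \<open>w_plus 2\<close>
  these two coordinates are 0 or 1, so they serve as coefficients.\<close>

lemma spinor_decomposition_plus:
  assumes p: "cl_p \<odot> v = 2 *s v" and e: "\<i> *s (e3 \<odot> v) = v"
  shows "v = v $ (True, False, False) *s w_plus 1 + v $ (False, False, False) *s w_plus 2"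
proof -
  have P: "(cl_p \<odot> v) $ C = 2 * v $ C" for C
    unfolding p by simp
  have E: "\<i> * (e3 \<odot> v) $ C = v $ C" for C
    using arg_cong[OF e, of "\<lambda>x. x $ C"] by simp
  have c1: "v $ (True, True, True) = - v $ (False, False, False)" "v $ (False, True, True) = v $ (True, False, False)"
      "v $ (False, True, False) = - v $ (True, False, True)" "v $ (True, True, False) = v $ (False, False, True)"
    using P[of "(False, False, False)"] P[of "(True, False, False)"] P[of "(False, True, False)"] P[of "(False, False, True)"]
    by (simp_all add: cl_p_components eq_neg_iff_add_eq_0 algebra_simps)
  have c2: "v $ (True, False, True) = - \<i> * v $ (True, False, False)" "v $ (False, False, True) = \<i> * v $ (False, False, False)"
    using E[of "(True, False, True)"] E[of "(False, False, True)"] by (simp_all add: e3_components)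
  show ?thesis
    unfolding vec_eq_iff blade_forall by (simp add: w_components c1 c2)
qed

text \<open>Here the scalar coordinate belongs to \<open>w_minus 1\<close> and the one at e1 to
  \<open>w_minus 2\<close>, opposite to the other sign.\<close>

lemma spinor_decomposition_minus:
  assumes p: "cl_p \<odot> v = 2 *s v" and e: "\<i> *s (e3 \<odot> v) = (- 1) *s v"
  shows "v = v $ (False, False, False) *s w_minus 1 + v $ (True, False, False) *s w_minus 2"
proof -
  have P: "(cl_p \<odot> v) $ C = 2 * v $ C" for C
    unfolding p by simp
  have E: "\<i> * (e3 \<odot> v) $ C = - v $ C" for C
    using arg_cong[OF e, of "\<lambda>x. x $ C"] by simp
  have c1: "v $ (True, True, True) = - v $ (False, False, False)" "v $ (False, True, True) = v $ (True, False, False)"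
      "v $ (False, True, False) = - v $ (True, False, True)" "v $ (True, True, False) = v $ (False, False, True)"
    using P[of "(False, False, False)"] P[of "(True, False, False)"] P[of "(False, True, False)"] P[of "(False, False, True)"]
    by (simp_all add: cl_p_components eq_neg_iff_add_eq_0 algebra_simps)
  have c2: "v $ (True, False, True) = \<i> * v $ (True, False, False)" "v $ (False, False, True) = - \<i> * v $ (False, False, False)"
    using E[of "(True, False, True)"] E[of "(False, False, True)"] by (simp_all add: e3_components)
  show ?thesis
    unfolding vec_eq_iff blade_forall by (simp add: w_components c1 c2)
qed

text \<open>On a product of two vectors, a scalar plus a bivector, this changes the sign of the
  bivector part: it is the Clifford conjugation. The linear formula makes measurability evident, in
  contrast to \<open>cl_inv\<close>.\<close>

definition cl_conj :: "cl3 \<Rightarrow> cl3" where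
  "cl_conj a = (2 * a $ (False, False, False)) *s cl_one - a"

lemma measurable_cl_conj[measurable]:
  assumes [measurable]: "f \<in> borel_measurable M"
  shows "(\<lambda>x. cl_conj (f x)) \<in> borel_measurable M"
proof -
  have [measurable]: "(\<lambda>x. f x $ C) \<in> borel_measurable M" for C
    using assms by (intro borel_measurable_continuous_on[where f = "\<lambda>v. v $ C"] continuous_on_component continuous_on_id)
  show ?thesis unfolding cl_conj_def by measurable
qed

lemma Spin3_cl_conj:
  assumes "a \<in> Spin3"
  shows "a \<odot> cl_conj a = cl_one" "cl_conj a \<odot> a = cl_one" "norm a \<le> cl_bound" "norm (cl_conj a) \<le> cl_bound"
    "cl_p \<odot> a = a \<odot> cl_p" "cl_p \<odot> cl_conj a = cl_conj a \<odot> cl_p" "cl_inv a = cl_conj a"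
proof -
  obtain u v where a: "a = cl_vec u \<odot> cl_vec v" and n: "norm u = 1" "norm v = 1"
    using assms by (auto simp: Spin3_def)
  have sq: "cl_vec u \<odot> (cl_vec u \<odot> x) = - x" "cl_vec v \<odot> (cl_vec v \<odot> x) = - x" for x
    unfolding cl_assoc[symmetric] cl_vec_square n by (simp_all add: cl_bilinear cl_one_left)
  \<comment> \<open>Thus vu is - 2 (u \<bullet> v) - uv; as the scalar part of uv is - (u \<bullet>
    v), this is \<open>cl_conj a\<close>.\<close>
  have ac: "cl_vec u \<odot> cl_vec v + cl_vec v \<odot> cl_vec u = complex_of_real (- 2 * (u \<bullet> v)) *s cl_one"
    unfolding cl_vec_anticommutator of_real_smult ..
  have "a $ (False, False, False) = - (u \<bullet> v)"
    unfolding a cl_vec_def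
    by (simp add: cl_scaleR cl_simps,
        simp add: e1_def e2_def e3_def cl_one_def axis_mult_axis blade_sign_def blade_diff_def,
        simp add: axis_def inner_vec_def sum_3 scaleR_conv_of_real mult.commute)
  then have "cl_conj a = complex_of_real (- 2 * (u \<bullet> v)) *s cl_one - cl_vec u \<odot> cl_vec v"
    by (simp add: cl_conj_def a)
  then have c: "cl_conj a = cl_vec v \<odot> cl_vec u"
    unfolding ac[symmetric] by simp
  show 1: "a \<odot> cl_conj a = cl_one"
    unfolding c unfolding a cl_assoc sq cl_bilinear cl_vec_square n by simp
  show 2: "cl_conj a \<odot> a = cl_one"
    unfolding c unfolding a cl_assoc sq cl_bilinear cl_vec_square n by simp
  show "norm a \<le> cl_bound"
    using norm_cl_mult[of "cl_vec u" "cl_vec v"] unfolding a norm_cl_vec n by simp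
  show "norm (cl_conj a) \<le> cl_bound"
    using norm_cl_mult[of "cl_vec v" "cl_vec u"] unfolding c norm_cl_vec n by simp
  have pc: "cl_p \<odot> (cl_vec x \<odot> cl_vec y) = (cl_vec x \<odot> cl_vec y) \<odot> cl_p" for x y
    by (metis cl_assoc cl_p_cl_vec)
  show "cl_p \<odot> a = a \<odot> cl_p" "cl_p \<odot> cl_conj a = cl_conj a \<odot> cl_p"
    unfolding c unfolding a by (rule pc)+
  show "cl_inv a = cl_conj a"
    unfolding cl_inv_def
  proof (rule the_equality)
    fix b assume "a \<odot> b = cl_one \<and> b \<odot> a = cl_one"
    then have b: "a \<odot> b = cl_one"
      by simp
    have "b = cl_conj a \<odot> a \<odot> b"
      by (simp only: 2 cl_one_left)
    then show "b = cl_conj a"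
      by (simp only: cl_assoc b cl_one_right)
  qed (use 1 2 in simp)
qed

text \<open>\<open>\<gamma>\<close> is only measurable on the sphere, so the origin is sent to an arbitrary unit vector.\<close>

definition spinor_field :: "(real ^ 3 \<Rightarrow> cl3) \<Rightarrow> real ^ 3 \<Rightarrow> cl3" where
  "spinor_field \<gamma> y = \<gamma> (if y = 0 then axis 1 1 else y /\<^sub>R norm y)"

lemma measurable_spinor_field:
  assumes "spinor_choice \<gamma>"
  shows "spinor_field \<gamma> \<in> borel_measurable borel"
proof -
  have "(\<lambda>y :: real^3. if y = 0 then axis 1 1 else y /\<^sub>R norm y) \<in> borel \<rightarrow>\<^sub>M restrict_space borel (sphere 0 1)"
    by (intro measurable_restrict_space2) (auto simp: norm_axis_1)
  moreover have "\<gamma> \<in> borel_measurable (restrict_space borel (sphere 0 1))"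
    using assms by (simp add: spinor_choice_def)
  ultimately show ?thesis
    unfolding spinor_field_def by (rule measurable_compose)
qed

lemma spinor_field_Spin3:
  assumes "spinor_choice \<gamma>"
  shows "spinor_field \<gamma> y \<in> Spin3"
  using assms by (auto simp: spinor_choice_def spinor_field_def norm_axis_1)

text \<open>With the inverse moved to the other side, the rotation rule says that \<gamma>
  intertwines the symbol with e3.\<close>

lemma spinor_field_rotates:
  assumes "spinor_choice \<gamma>" "y \<noteq> 0"
  shows "cl_vec (sgn y) \<odot> spinor_field \<gamma> y = spinor_field \<gamma> y \<odot> e3"
proof -
  let ?a = "spinor_field \<gamma> y"
  note S = Spin3_cl_conj[OF spinor_field_Spin3[OF assms(1), of y]]
  have "?a \<odot> e3 \<odot> cl_inv ?a = cl_vec (sgn y)"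
    using assms by (auto simp: spinor_choice_def spinor_field_def sgn_div_norm)
  then have "cl_vec (sgn y) \<odot> ?a = ?a \<odot> e3 \<odot> cl_conj ?a \<odot> ?a"
    unfolding S(7) by simp
  also have "\<dots> = ?a \<odot> e3 \<odot> (cl_conj ?a \<odot> ?a)"
    by (rule cl_assoc)
  finally show ?thesis
    unfolding S(2) cl_one_right .
qed

lemma AE_spinor_field: "AE y in lborel. \<gamma> (y /\<^sub>R norm y) = spinor_field \<gamma> y"
  using AE_lborel_nonzero by eventually_elim (simp add: spinor_field_def)

section \<open>Functions with values in the ideal\<close>

lemma p_valued_iff: "f \<in> p_valued \<longleftrightarrow> (AE x in lborel. cl_p \<odot> f x = 2 *s f x)"
proof -
  have "(\<exists>a. v = cl_p \<odot> a) \<longleftrightarrow> cl_p \<odot> v = 2 *s v" for v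
  proof
    assume "cl_p \<odot> v = 2 *s v"
    then have "(1/2) *s (2 *s v) = cl_p \<odot> ((1/2) *s v)"
      by (simp only: cl_bilinear)
    then show "\<exists>a. v = cl_p \<odot> a"
      by (auto simp: vector_smult_assoc)
  qed (auto simp: cl_p_square)
  then show ?thesis
    by (simp add: p_valued_def)
qed

text \<open>The ideal is cut out by a linear equation with constant coefficients, which the
  transform respects; the converse uses inversion.\<close>

lemma p_valued_fourier:
  assumes fg: "has_fourier f g"
  shows "f \<in> p_valued \<longleftrightarrow> g \<in> p_valued"
proof -
  have imp: "k \<in> p_valued" if hk: "has_fourier h k" and h: "h \<in> p_valued" for h k
  proof -
    have ae: "AE x in lborel. cl_p \<odot> h x = 2 *s h x"
      using h by (simp add: p_valued_iff)
    note s = has_fourier_smult[OF hk, of 2]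
    have "has_fourier (\<lambda>x. 2 *s h x) (\<lambda>x. cl_p \<odot> k x)"
      by (rule has_fourier_cong_left[OF has_fourier_cl_mult[OF hk] L2_measurable[OF has_fourier_L2(1)[OF s]] ae])
    from has_fourier_unique[OF this s] show ?thesis
      by (simp add: p_valued_iff)
  qed
  show ?thesis
  proof
    assume "g \<in> p_valued"
    from imp[OF has_fourier_inversion[OF fg] this] have "AE x in lborel. cl_p \<odot> f (- x) = 2 *s f (- x)"
      by (simp add: p_valued_iff)
    from AE_lborel_uminus[OF this] show "f \<in> p_valued"
      by (simp add: p_valued_iff)
  qed (rule imp[OF fg])
qed

lemma p_valued_add: "f \<in> p_valued \<Longrightarrow> g \<in> p_valued \<Longrightarrow> (\<lambda>x. f x + g x) \<in> p_valued"
  unfolding p_valued_iff by (elim AE_mp, intro AE_I2) (simp add: cl_bilinear vector_add_ldistrib)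

text \<open>In the frame \<gamma> the symbol acts as multiplication by \<i> e3, for which w is an
  eigenvector, and rotors commute with \<open>cl_p\<close>. The symbol is evaluated at - y because
  the transform of f is the reflection of g.\<close>

lemma fourier_image_spinor_space:
  assumes \<gamma>: "spinor_choice \<gamma>" and w: "\<i> *s (e3 \<odot> w) = s *s w" "w = cl_p \<odot> a"
    and f: "f \<in> fourier_image (spinor_space \<gamma> w)"
  shows "f \<in> eigenspace s" "f \<in> p_valued"
proof -
  obtain g \<beta> where gf: "has_fourier g f" and g: "AE y in lborel. g y = \<beta> y *s (\<gamma> (y /\<^sub>R norm y) \<odot> w)"
    using f by (auto simp: fourier_image_def spinor_space_def)
  have "AE y in lborel. s *s g y = hilbert_symbol (- y) \<odot> g y"
    using g AE_lborel_nonzero AE_spinor_field[of \<gamma>]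
  proof eventually_elim
    case (elim y)
    let ?a = "spinor_field \<gamma> y"
    have "hilbert_symbol (- y) \<odot> (?a \<odot> w) = \<i> *s (cl_vec (sgn y) \<odot> ?a \<odot> w)"
      by (simp only: hilbert_symbol_minus cl_bilinear cl_assoc)
    also have "\<dots> = ?a \<odot> (\<i> *s (e3 \<odot> w))"
      unfolding spinor_field_rotates[OF \<gamma> elim(2)] by (simp only: cl_bilinear cl_assoc)
    also have "\<dots> = s *s (?a \<odot> w)"
      unfolding w(1) by (simp only: cl_bilinear)
    finally have "hilbert_symbol (- y) \<odot> (?a \<odot> w) = s *s (?a \<odot> w)" .
    then show ?case
      unfolding elim(1) elim(3) cl_bilinear(8) by (simp only: vector_smult_assoc mult.commute)
  qed
  from AE_lborel_uminus[OF this] have "AE y in lborel. s *s g (- y) = hilbert_symbol y \<odot> g (- y)"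
    by simp
  then show "f \<in> eigenspace s"
    using eigenspace_iff[OF has_fourier_inversion[OF gf]] by simp
  have "AE y in lborel. cl_p \<odot> g y = 2 *s g y"
    using g AE_spinor_field[of \<gamma>]
  proof eventually_elim
    case (elim y)
    let ?a = "spinor_field \<gamma> y"
    have "cl_p \<odot> (?a \<odot> w) = ?a \<odot> (cl_p \<odot> (cl_p \<odot> a))"
      unfolding w(2) cl_assoc[symmetric] Spin3_cl_conj(5)[OF spinor_field_Spin3[OF \<gamma>]] ..
    then have "cl_p \<odot> (?a \<odot> w) = 2 *s (?a \<odot> w)"
      unfolding cl_p_square w(2) by (simp only: cl_bilinear)
    then show ?case
      unfolding elim(1) elim(2) cl_bilinear(8) by (simp only: vector_smult_assoc mult.commute)
  qed
  then show "f \<in> p_valued"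
    using p_valued_fourier[OF gf] by (simp add: p_valued_iff)
qed

lemma zero_in_fourier_image: "(\<lambda>x. 0) \<in> fourier_image (spinor_space \<gamma> w)"
proof -
  have "(\<lambda>x. 0) \<in> spinor_space \<gamma> w"
    unfolding spinor_space_def
    by (intro CollectI conjI exI[of _ "\<lambda>x. 0"] L2_0) simp
  then show ?thesis
    unfolding fourier_image_def using has_fourier_0 by blast
qed

lemma sum4_subset:
  assumes \<gamma>: "spinor_choice \<gamma>"
    and w: "\<And>j. j \<in> {1..4} \<Longrightarrow> \<i> *s (e3 \<odot> w j) = s *s w j" "\<And>j. \<exists>a. w j = cl_p \<odot> a"
  shows "sum4 (\<lambda>j. fourier_image (spinor_space \<gamma> (w j))) \<subseteq> eigenspace s \<inter> p_valued"
proof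
  fix f assume "f \<in> sum4 (\<lambda>j. fourier_image (spinor_space \<gamma> (w j)))"
  then obtain F where f: "f = (\<lambda>x. \<Sum>j = 1..4. F j x)"
    and F: "\<And>j. j \<in> {1..4::nat} \<Longrightarrow> F j \<in> fourier_image (spinor_space \<gamma> (w j))"
    by (auto simp: sum4_def)
  have F': "F j \<in> eigenspace s" "F j \<in> p_valued" if "j \<in> {1..4}" for j
    using fourier_image_spinor_space[OF \<gamma> w(1)[OF that] _ F[OF that]] w(2)[of j] by blast+
  have "f = (\<lambda>x. F 1 x + F 2 x + F 3 x + F 4 x)"
    unfolding f by (simp add: numeral_eq_Suc)
  moreover have "(\<lambda>x. F 1 x + F 2 x + F 3 x + F 4 x) \<in> eigenspace s"
    by (intro eigenspace_add F') simp_all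
  moreover have "(\<lambda>x. F 1 x + F 2 x + F 3 x + F 4 x) \<in> p_valued"
    by (intro p_valued_add F') simp_all
  ultimately show "f \<in> eigenspace s \<inter> p_valued"
    by simp
qed

text \<open>In the rotor frame the preimage of f splits pointwise along \<open>w 1\<close> and
  \<open>w 2\<close>, with coefficients in L^2. The summands of index 3 and 4 are taken to be
  zero.\<close>

lemma sum4_supset:
  assumes \<gamma>: "spinor_choice \<gamma>"
    and dec: "\<And>v. cl_p \<odot> v = 2 *s v \<Longrightarrow> \<i> *s (e3 \<odot> v) = s *s v \<Longrightarrow> v = v $ A *s w 1 + v $ B *s w 2"
  shows "eigenspace s \<inter> p_valued \<subseteq> sum4 (\<lambda>j. fourier_image (spinor_space \<gamma> (w j)))"
proof
  fix f assume f: "f \<in> eigenspace s \<inter> p_valued"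
  obtain g0 where g0: "has_fourier f g0"
    using has_fourier_exists[OF eigenspace_L2] f by blast
  define g where "g y = g0 (- y)" for y
  have gf: "has_fourier g f"
    using has_fourier_reflect[OF has_fourier_inversion[OF g0]] by (simp add: g_def[abs_def])
  have gL: "g \<in> L2"
    using has_fourier_L2(1)[OF gf] .
  have [measurable]: "g \<in> borel_measurable borel" "spinor_field \<gamma> \<in> borel_measurable borel"
    by (rule L2_measurable[OF gL], rule measurable_spinor_field[OF \<gamma>])
  note S = Spin3_cl_conj[OF spinor_field_Spin3[OF \<gamma>]]
  have "AE y in lborel. s *s g0 y = hilbert_symbol y \<odot> g0 y"
    using f eigenspace_iff[OF g0] by simp
  from AE_lborel_uminus[OF this] have eig: "AE y in lborel. s *s g y = hilbert_symbol (- y) \<odot> g y"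
    by (simp add: g_def)
  have pv: "AE y in lborel. cl_p \<odot> g y = 2 *s g y"
    using f p_valued_fourier[OF gf] by (simp add: p_valued_iff)
  \<comment> \<open>The inverse rotor is \<open>cl_conj\<close>, measurable and bounded in norm by
    \<open>cl_bound\<close>, so v inherits measurability and square integrability from g.\<close>
  define v where "v y = cl_conj (spinor_field \<gamma> y) \<odot> g y" for y
  have vm: "(\<lambda>y. v y $ C) \<in> borel_measurable borel" for C
  proof -
    have "v \<in> borel_measurable borel"
      unfolding v_def by measurable
    then show ?thesis
      by (intro borel_measurable_continuous_on[where f = "\<lambda>v. v $ C"] continuous_on_component continuous_on_id)
  qed
  have vL: "(\<lambda>y. v y $ C) \<in> L2" for C
  proof (rule L2_dominated[OF gL vm])
    have "norm (v y $ C) \<le> cl_bound * cl_bound * norm (g y)" for y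
    proof -
      have "norm (v y $ C) \<le> norm (v y)"
        by (rule Finite_Cartesian_Product.norm_nth_le)
      also have "\<dots> \<le> cl_bound * (norm (cl_conj (spinor_field \<gamma> y)) * norm (g y))"
        unfolding v_def by (rule norm_cl_mult)
      also have "\<dots> \<le> cl_bound * (cl_bound * norm (g y))"
        using cl_bound_pos S(4)[of y] by (intro mult_left_mono mult_right_mono) auto
      finally show ?thesis by (simp add: mult.assoc)
    qed
    then show "AE y in lborel. norm (v y $ C) \<le> cl_bound * cl_bound * norm (g y)"
      by simp
  qed (use cl_bound_pos in simp)
  have split: "AE y in lborel. g y = v y $ A *s (spinor_field \<gamma> y \<odot> w 1) + v y $ B *s (spinor_field \<gamma> y \<odot> w 2)"
    using eig pv AE_lborel_nonzero
  proof eventually_elim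
    case (elim y)
    let ?a = "spinor_field \<gamma> y"
    have gv: "g y = ?a \<odot> v y"
      by (simp only: v_def cl_assoc[symmetric] S(1) cl_one_left)
    have "cl_p \<odot> v y = cl_conj ?a \<odot> (cl_p \<odot> g y)"
      unfolding v_def cl_assoc[symmetric] S(6) ..
    then have p: "cl_p \<odot> v y = 2 *s v y"
      unfolding elim(2) by (simp only: v_def cl_bilinear)
    have "hilbert_symbol (- y) \<odot> g y = \<i> *s (cl_vec (sgn y) \<odot> ?a \<odot> v y)"
      unfolding gv by (simp only: hilbert_symbol_minus cl_bilinear cl_assoc)
    also have "\<dots> = ?a \<odot> (\<i> *s (e3 \<odot> v y))"
      unfolding spinor_field_rotates[OF \<gamma> elim(3)] by (simp only: cl_bilinear cl_assoc)
    finally have "s *s g y = ?a \<odot> (\<i> *s (e3 \<odot> v y))"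
      using elim(1) by simp
    then have "cl_conj ?a \<odot> (s *s g y) = cl_conj ?a \<odot> ?a \<odot> (\<i> *s (e3 \<odot> v y))"
      by (simp only: cl_assoc)
    then have e: "\<i> *s (e3 \<odot> v y) = s *s v y"
      unfolding S(2) cl_one_left by (simp only: cl_bilinear v_def)
    have "?a \<odot> v y = ?a \<odot> (v y $ A *s w 1 + v y $ B *s w 2)"
      by (rule arg_cong[OF dec[OF p e]])
    then show ?case
      unfolding gv[symmetric] by (simp only: cl_bilinear)
  qed
  have bL: "(\<lambda>y. v y $ C *s (spinor_field \<gamma> y \<odot> x)) \<in> L2" for C x
  proof (rule L2_dominated[OF vL])
    show "(\<lambda>y. v y $ C *s (spinor_field \<gamma> y \<odot> x)) \<in> borel_measurable borel"
      using vm by measurable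
    have "norm (spinor_field \<gamma> y \<odot> x) \<le> cl_bound * (cl_bound * norm x)" for y
      using cl_bound_pos S(3)[of y] by (intro order_trans[OF norm_cl_mult] mult_left_mono mult_right_mono) auto
    then have "norm (v y $ C *s (spinor_field \<gamma> y \<odot> x)) \<le> cl_bound * (cl_bound * norm x) * norm (v y $ C)" for y
      unfolding norm_smult by (subst mult.commute) (intro mult_right_mono, auto)
    then show "AE y in lborel. norm (v y $ C *s (spinor_field \<gamma> y \<odot> x)) \<le> cl_bound * (cl_bound * norm x) * norm (v y $ C)"
      by simp
  qed (use cl_bound_pos in simp)
  let ?g2 = "\<lambda>y. v y $ B *s (spinor_field \<gamma> y \<odot> w 2)"
  obtain f2 where f2: "has_fourier ?g2 f2"
    using has_fourier_exists[OF bL] .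
  have mem: "h \<in> spinor_space \<gamma> (w j)"
    if "h \<in> L2" "AE y in lborel. h y = v y $ C *s (spinor_field \<gamma> y \<odot> w j)" for h j C
    unfolding spinor_space_def
  proof (intro CollectI conjI exI)
    show "AE y in lborel. h y = v y $ C *s (\<gamma> (y /\<^sub>R norm y) \<odot> w j)"
      using that(2) AE_spinor_field[of \<gamma>] by eventually_elim simp
  qed (rule that(1), rule vL)
  have "?g2 \<in> spinor_space \<gamma> (w 2)"
    by (rule mem[OF bL AE_I2[OF refl]])
  then have "f2 \<in> fourier_image (spinor_space \<gamma> (w 2))"
    unfolding fourier_image_def using f2 by blast
  \<comment> \<open>The first summand is f minus the second one rather than a separately chosen
    transform, so that the sum is f at every point and not merely almost everywhere.\<close>
  moreover have "(\<lambda>x. f x - f2 x) \<in> fourier_image (spinor_space \<gamma> (w 1))"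
  proof -
    note F = has_fourier_diff[OF gf f2]
    have "(\<lambda>y. g y - ?g2 y) \<in> spinor_space \<gamma> (w 1)"
    proof (rule mem[OF has_fourier_L2(1)[OF F]])
      show "AE y in lborel. g y - ?g2 y = v y $ A *s (spinor_field \<gamma> y \<odot> w 1)"
        using split by eventually_elim simp
    qed
    then show ?thesis
      unfolding fourier_image_def using F by blast
  qed
  moreover define F where "F j = (if j = 1 then (\<lambda>x. f x - f2 x) else if j = 2 then f2 else (\<lambda>x. 0))" for j :: nat
  ultimately have "\<forall>j\<in>{1..4}. F j \<in> fourier_image (spinor_space \<gamma> (w j))"
    using zero_in_fourier_image by auto
  moreover have "f = (\<lambda>x. \<Sum>j = 1..4. F j x)"
    by (simp add: F_def numeral_eq_Suc)
  ultimately show "f \<in> sum4 (\<lambda>j. fourier_image (spinor_space \<gamma> (w j)))"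
    unfolding sum4_def by blast
qed

theorem theorem7p5:
  fixes \<gamma> :: "real ^ 3 \<Rightarrow> cl3"
  assumes "spinor_choice \<gamma>"
  shows "\<exists>Hp Hm. 
    nontrivial_subspace Hp \<and> maximal_invariant_subspace 1 Hp \<and>
    nontrivial_subspace Hm \<and> maximal_invariant_subspace (- 1) Hm \<and>
    L2_direct_sum Hp Hm \<and>
    (\<forall>f\<in>Hp. has_hilbert f f) \<and>
    (\<forall>g\<in>Hm. has_hilbert g (\<lambda>x. - g x)) \<and>
    Hp \<inter> p_valued = sum4 (H_plus \<gamma>) \<and>
    Hm \<inter> p_valued = sum4 (H_minus \<gamma>)"
proof (intro exI conjI)
  show "nontrivial_subspace (eigenspace 1)" "nontrivial_subspace (eigenspace (- 1))"
    by (rule eigenspace_nontrivial; simp)+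
  show "maximal_invariant_subspace 1 (eigenspace 1)" "maximal_invariant_subspace (- 1) (eigenspace (- 1))"
    by (rule eigenspace_maximal)+
  show "L2_direct_sum (eigenspace 1) (eigenspace (- 1))"
    by (rule eigenspace_sum)
  show "\<forall>f\<in>eigenspace 1. has_hilbert f f" "\<forall>g\<in>eigenspace (- 1). has_hilbert g (\<lambda>x. - g x)"
    by (simp_all add: eigenspace_def)
  show "eigenspace 1 \<inter> p_valued = sum4 (H_plus \<gamma>)"
  proof
    show "eigenspace 1 \<inter> p_valued \<subseteq> sum4 (H_plus \<gamma>)"
      unfolding H_plus_def[abs_def]
      by (rule sum4_supset[OF assms spinor_decomposition_plus]) (simp_all only: vector_smult_lid)
    show "sum4 (H_plus \<gamma>) \<subseteq> eigenspace 1 \<inter> p_valued"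
      unfolding H_plus_def[abs_def]
      by (rule sum4_subset[OF assms _ w_in_ideal(2)]) (simp only: w_eigen vector_smult_lid)
  qed
  show "eigenspace (- 1) \<inter> p_valued = sum4 (H_minus \<gamma>)"
  proof
    show "eigenspace (- 1) \<inter> p_valued \<subseteq> sum4 (H_minus \<gamma>)"
      unfolding H_minus_def[abs_def]
      by (rule sum4_supset[OF assms spinor_decomposition_minus])
    show "sum4 (H_minus \<gamma>) \<subseteq> eigenspace (- 1) \<inter> p_valued"
      unfolding H_minus_def[abs_def]
      by (rule sum4_subset[OF assms _ w_in_ideal(1)]) (simp only: w_eigen)
  qed
qed

end
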